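(* Let $t_0\in\mathbb{R}$ and $0<\Lambda_1\leq\Lambda_2$ be real numbers, let $S:[t_0,+\infty)\to\mathbb{R}$ be a continuous non-increasing function with $S(t)\to 0$ as $t\to+\infty$, and let $\gamma:[t_0,+\infty)\to[0,+\infty)$ be a continuous monotone (either non-increasing or non-decreasing) function. For every $t\geq t_0$ let $$G(t):=\int_{t_0}^t\gamma(\tau)^2\,d\tau,\qquad M(t):=\max\{G(\tau)S(\tau):\tau\in[t_0,t]\}.$$ Let $A$ be a multiplication operator in a real Hilbert space $\mathcal{H}$. Assume in addition that (i) the spectrum of $A$ contains the half-line $(\lambda_0^2,+\infty)$ for some real number $\lambda_0\geq 0$; (ii) $\Lambda_2>\Lambda_1$, and $\sup\{G(\tau)S(\tau):\tau\geq t_0\}=+\infty$; (iii) $\gamma\in C^3([t_0,+\infty))$, and there exists a constant $\Lambda_3$ such that $$\max\{|\gamma'(t)|,|\gamma''(t)|,|\gamma'''(t)|\}\leq\Lambda_3\gamma(t)\qquad\forall t\geq t_0.$$ Then there exist a coefficient $c\in\mathcal{PS}(t_0,\Lambda_1,\Lambda_2,S,\gamma)$, a nonzero solution $u$ to $u''(t)+c(t)Au(t)=0$ in $[t_0,+\infty)$, a positive real number $H_5$, and a sequence $\{b_k\}_{k\geq 1}\subseteq[t_0,+\infty)$ with $b_k\to+\infty$ such that $$\mathcal{E}_u(b_k)\geq\mathcal{E}_u(t_0)\cdot\exp\left(H_5M(b_k)^{1/2}\right)\qquad\forall k\geq 1.$$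
   Context: Multiplication operators. A linear operator $A$ in a real Hilbert space $\mathcal{H}$ is called a multiplication operator if it is unitarily equivalent to a non-negative multiplication operator in some $L^2$ space: there exist a measure space $(\mathcal{M},\mu)$, a measurable function $\lambda:\mathcal{M}\to[0,+\infty)$ and a surjective linear isometry $\mathscr{F}:\mathcal{H}\to L^2(\mathcal{M},\mu)$ such that $u\in D(A)$ if and only if $\lambda(\xi)^2[\mathscr{F}u](\xi)\in L^2(\mathcal{M},\mu)$, and $[\mathscr{F}(Au)](\xi)=\lambda(\xi)^2[\mathscr{F}u](\xi)$ for every $u\in D(A)$. Correspondingly, $A^{1/2}$ is the operator that acts as multiplication by $\lambda(\xi)$. Spectrum. The spectrum of such an $A$ is the set of all real numbers $\lambda^2$ such that $\mu(\{\xi\in\mathcal{M}:\lambda(\xi)^2\in[\lambda^2-r,\lambda^2+r]\})>0$ for every $r>0$. Admissible propagation speeds. $\mathcal{PS}(t_0,\Lambda_1,\Lambda_2,S,\gamma)$ is the set of all functions $c:[t_0,+\infty)\to\mathbb{R}$ of class $C^2$ such that: - $\Lambda_1\leq c(t)\leq\Lambda_2$ for every $t\geq t_0$; - there exists a real number $c_\infty$ such that $\int_t^{+\infty}|c(\tau)-c_\infty|\,d\tau\leq S(t)$ for every $t\geq t_0$ (such $c_\infty$ is necessarily unique and belongs to $[\Lambda_1,\Lambda_2]$); - $|c'(t)|\leq\gamma(t)$ and $|c''(t)|\leq\gamma(t)^2$ for every $t\geq t_0$. Solutions. A solution to $u''(t)+c(t)Au(t)=0$ is a weak solution $u\in C^0([t_0,+\infty),D(A^{1/2}))\cap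 C^1([t_0,+\infty),\mathcal{H})$, i.e. for every $\varphi\in D(A^{1/2})$ the function $t\mapsto\langle u'(t),\varphi\rangle$ is differentiable with derivative $-c(t)\langle A^{1/2}u(t),A^{1/2}\varphi\rangle$. Energy. For a solution $u$ corresponding to a coefficient $c$ with constant $c_\infty$, $$\mathcal{E}_u(t):=\frac{\|u'(t)\|_{\mathcal{H}}^2}{c_\infty^{1/2}}+c_\infty^{1/2}\|A^{1/2}u(t)\|_{\mathcal{H}}^2.$$
   Formalization: The measure μ is assumed semifinite (each set of positive measure contains one of finite positive measure); otherwise false: for μ infinite on all nonempty subsets of [0,∞), λ(ξ)=ξ, L² is {0} while the defined spectrum is [0,∞). Each A has such a representation. *)

theory Defs
  imports "HOL-Analysis.Analysis"
begin

section \<open>Calculus on a closed half-line\<close>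

text \<open>Functions on \<open>[t0, +\<infinity>)\<close> are total functions whose values to the left of \<open>t0\<close> are never
  used: derivatives are taken within \<open>{t0..}\<close>, hence are one-sided at \<open>t0\<close>.\<close>

definition half_deriv :: "real \<Rightarrow> (real \<Rightarrow> 'b::real_normed_vector) \<Rightarrow> real \<Rightarrow> 'b" where
  "half_deriv t0 f t = vector_derivative f (at t within {t0..})"

definition C_half :: "nat \<Rightarrow> real \<Rightarrow> (real \<Rightarrow> 'b::real_normed_vector) \<Rightarrow> bool" where
  "C_half k t0 f \<longleftrightarrow>
     (\<forall>j<k. (half_deriv t0 ^^ j) f differentiable_on {t0..}) \<and>
     continuous_on {t0..} ((half_deriv t0 ^^ k) f)"

section \<open>Multiplication operators\<close>

text \<open>Representatives of the elements of \<open>L\<^sup>2(\<mu>)\<close>; equality in \<open>L\<^sup>2(\<mu>)\<close> is equality almost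
  everywhere.\<close>

definition L2_fun :: "'m measure \<Rightarrow> ('m \<Rightarrow> real) set" where
  "L2_fun \<mu> = {f \<in> borel_measurable \<mu>. integrable \<mu> (\<lambda>\<xi>. (f \<xi>)\<^sup>2)}"

text \<open>\<open>F u\<close> is a representative of the image of \<open>u\<close>, so linearity and surjectivity are up to null
  sets.\<close>

definition surj_isometry_L2 :: "'m measure \<Rightarrow> ('h::real_inner \<Rightarrow> 'm \<Rightarrow> real) \<Rightarrow> bool" where
  "surj_isometry_L2 \<mu> F \<longleftrightarrow>
     (\<forall>u. F u \<in> L2_fun \<mu>) \<and>
     (\<forall>u v. AE \<xi> in \<mu>. F (u + v) \<xi> = F u \<xi> + F v \<xi>) \<and>
     (\<forall>a u. AE \<xi> in \<mu>. F (a *\<^sub>R u) \<xi> = a * F u \<xi>) \<and>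
     (\<forall>u. norm u = sqrt (\<integral>\<xi>. (F u \<xi>)\<^sup>2 \<partial>\<mu>)) \<and>
     (\<forall>f\<in>L2_fun \<mu>. \<exists>u. AE \<xi> in \<mu>. F u \<xi> = f \<xi>)"

text \<open>The operator with domain \<open>domA\<close> and action \<open>A\<close> (irrelevant outside \<open>domA\<close>) is represented
  by \<open>(\<mu>, \<lambda>, F)\<close> as multiplication by \<open>\<lambda>\<^sup>2\<close>.\<close>

definition multiplication_operator ::
  "'h set \<Rightarrow> ('h \<Rightarrow> 'h) \<Rightarrow> 'm measure \<Rightarrow> ('m \<Rightarrow> real) \<Rightarrow> ('h::real_inner \<Rightarrow> 'm \<Rightarrow> real) \<Rightarrow> bool" where
  "multiplication_operator domA A \<mu> lam F \<longleftrightarrow>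
     lam \<in> borel_measurable \<mu> \<and> (\<forall>\<xi>\<in>space \<mu>. 0 \<le> lam \<xi>) \<and>
     surj_isometry_L2 \<mu> F \<and>
     (\<forall>u. u \<in> domA \<longleftrightarrow> (\<lambda>\<xi>. (lam \<xi>)\<^sup>2 * F u \<xi>) \<in> L2_fun \<mu>) \<and>
     (\<forall>u\<in>domA. AE \<xi> in \<mu>. F (A u) \<xi> = (lam \<xi>)\<^sup>2 * F u \<xi>)"

text \<open>The square root \<open>A\<^sup>1\<^sup>/\<^sup>2\<close>: multiplication by \<open>\<lambda>\<close>, transported to the Hilbert space. For \<open>u\<close> in
  the domain the element \<open>v\<close> below exists and is unique because \<open>F\<close> is a surjective isometry.\<close>

definition sqrt_dom :: "'m measure \<Rightarrow> ('m \<Rightarrow> real) \<Rightarrow> ('h \<Rightarrow> 'm \<Rightarrow> real) \<Rightarrow> 'h set" where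
  "sqrt_dom \<mu> lam F = {u. (\<lambda>\<xi>. lam \<xi> * F u \<xi>) \<in> L2_fun \<mu>}"

definition sqrt_op :: "'m measure \<Rightarrow> ('m \<Rightarrow> real) \<Rightarrow> ('h \<Rightarrow> 'm \<Rightarrow> real) \<Rightarrow> 'h \<Rightarrow> 'h" where
  "sqrt_op \<mu> lam F u = (THE v. AE \<xi> in \<mu>. F v \<xi> = lam \<xi> * F u \<xi>)"

text \<open>For \<open>\<mu>\<close> semifinite this is the spectrum of the operator. In general, sets of infinite measure
  without subsets of finite positive measure are invisible in \<open>L\<^sup>2(\<mu>)\<close> but count here.\<close>

definition mult_spectrum :: "'m measure \<Rightarrow> ('m \<Rightarrow> real) \<Rightarrow> real set" where
  "mult_spectrum \<mu> lam =
     {s\<^sup>2 | s::real. \<forall>r>0. 0 < emeasure \<mu> {\<xi> \<in> space \<mu>. (lam \<xi>)\<^sup>2 \<in> {s\<^sup>2 - r .. s\<^sup>2 + r}}}"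

text \<open>The library locale \<open>semifinite_measure\<close> does not require the subset of finite measure to have
  positive measure, so every measure satisfies it; this is the usual notion.\<close>

definition is_semifinite :: "'m measure \<Rightarrow> bool" where
  "is_semifinite \<mu> \<longleftrightarrow>
     (\<forall>B\<in>sets \<mu>. 0 < emeasure \<mu> B \<longrightarrow>
        (\<exists>C\<in>sets \<mu>. C \<subseteq> B \<and> 0 < emeasure \<mu> C \<and> emeasure \<mu> C < \<infinity>))"

lemma sigma_finite_imp_is_semifinite:
  assumes "sigma_finite_measure \<mu>"
  shows "is_semifinite \<mu>"
  unfolding is_semifinite_def
proof (intro ballI impI)
  fix B assume B: "B \<in> sets \<mu>" "0 < emeasure \<mu> B"
  interpret sigma_finite_measure \<mu> by fact
  show "\<exists>C\<in>sets \<mu>. C \<subseteq> B \<and> 0 < emeasure \<mu> C \<and> emeasure \<mu> C < \<infinity>"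
  proof (cases "emeasure \<mu> B = \<infinity>")
    case True
    obtain Z where "Z \<in> sets \<mu>" "Z \<subseteq> B" "emeasure \<mu> Z < \<infinity>" "emeasure \<mu> Z > ennreal 0"
      using approx_PInf_emeasure_with_finite[OF B(1) True, of 0] by metis
    then show ?thesis by auto
  next
    case False
    then have "emeasure \<mu> B < \<infinity>"
      by (simp add: top.not_eq_extremum)
    with B show ?thesis by blast
  qed
qed

section \<open>Propagation speeds\<close>

definition asymptotic_speed :: "real \<Rightarrow> (real \<Rightarrow> real) \<Rightarrow> (real \<Rightarrow> real) \<Rightarrow> real \<Rightarrow> bool" where
  "asymptotic_speed t0 S c cinf \<longleftrightarrow>
     (\<forall>t\<ge>t0. (\<lambda>\<tau>. \<bar>c \<tau> - cinf\<bar>) integrable_on {t..} \<and> integral {t..} (\<lambda>\<tau>. \<bar>c \<tau> - cinf\<bar>) \<le> S t)"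

definition propagation_speeds ::
  "real \<Rightarrow> real \<Rightarrow> real \<Rightarrow> (real \<Rightarrow> real) \<Rightarrow> (real \<Rightarrow> real) \<Rightarrow> (real \<Rightarrow> real) set" where
  "propagation_speeds t0 L1 L2 S \<gamma> =
     {c. C_half 2 t0 c \<and>
         (\<forall>t\<ge>t0. L1 \<le> c t \<and> c t \<le> L2) \<and>
         (\<exists>cinf. asymptotic_speed t0 S c cinf) \<and>
         (\<forall>t\<ge>t0. \<bar>half_deriv t0 c t\<bar> \<le> \<gamma> t \<and>
                  \<bar>half_deriv t0 (half_deriv t0 c) t\<bar> \<le> (\<gamma> t)\<^sup>2)}"

definition G_fun :: "real \<Rightarrow> (real \<Rightarrow> real) \<Rightarrow> real \<Rightarrow> real" where
  "G_fun t0 \<gamma> t = integral {t0..t} (\<lambda>\<tau>. (\<gamma> \<tau>)\<^sup>2)"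

text \<open>For continuous \<open>\<gamma>\<close> and \<open>S\<close> the supremum is attained, i.e. it is a maximum.\<close>

definition M_fun :: "real \<Rightarrow> (real \<Rightarrow> real) \<Rightarrow> (real \<Rightarrow> real) \<Rightarrow> real \<Rightarrow> real" where
  "M_fun t0 S \<gamma> t = (SUP \<tau>\<in>{t0..t}. G_fun t0 \<gamma> \<tau> * S \<tau>)"

section \<open>Solutions and energy\<close>

text \<open>Weak solutions of \<open>u'' + c(t) A u = 0\<close>. Continuity with values in \<open>D(A\<^sup>1\<^sup>/\<^sup>2)\<close> refers to the
  graph norm, i.e. both \<open>u\<close> and \<open>A\<^sup>1\<^sup>/\<^sup>2 u\<close> are continuous.\<close>

definition weak_solution ::
  "'m measure \<Rightarrow> ('m \<Rightarrow> real) \<Rightarrow> ('h::{real_inner,complete_space} \<Rightarrow> 'm \<Rightarrow> real) \<Rightarrow>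
   real \<Rightarrow> (real \<Rightarrow> real) \<Rightarrow> (real \<Rightarrow> 'h) \<Rightarrow> bool" where
  "weak_solution \<mu> lam F t0 c u \<longleftrightarrow>
     (\<forall>t\<ge>t0. u t \<in> sqrt_dom \<mu> lam F) \<and>
     continuous_on {t0..} u \<and>
     continuous_on {t0..} (\<lambda>t. sqrt_op \<mu> lam F (u t)) \<and>
     C_half 1 t0 u \<and>
     (\<forall>\<phi>\<in>sqrt_dom \<mu> lam F. \<forall>t\<ge>t0.
        ((\<lambda>s. inner (half_deriv t0 u s) \<phi>) has_real_derivative
           - c t * inner (sqrt_op \<mu> lam F (u t)) (sqrt_op \<mu> lam F \<phi>)) (at t within {t0..}))"

definition energy ::
  "'m measure \<Rightarrow> ('m \<Rightarrow> real) \<Rightarrow> ('h::{real_inner,complete_space} \<Rightarrow> 'm \<Rightarrow> real) \<Rightarrow>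
   real \<Rightarrow> real \<Rightarrow> (real \<Rightarrow> 'h) \<Rightarrow> real \<Rightarrow> real" where
  "energy \<mu> lam F t0 cinf u t =
     (norm (half_deriv t0 u t))\<^sup>2 / sqrt cinf + sqrt cinf * (norm (sqrt_op \<mu> lam F (u t)))\<^sup>2"

end

theory Submission
  imports Defs
begin

text \<open>The growth comes from parametric resonance. A single frequency \<open>l\<close> sees the oscillator
\<open>w'' + c(t) l\<^sup>2 w = 0\<close>. If \<open>c\<close> oscillates about a constant \<open>\<kappa>\<^sup>2\<close> with exactly twice the frequency
\<open>\<kappa> l\<close> of the unperturbed oscillator and with amplitude \<open>\<epsilon>(t)\<close>, the energy grows like
\<open>exp (const * \<integral> \<epsilon> l)\<close>. The constraints \<open>\<bar>c'\<bar> \<le> \<gamma>\<close> and \<open>\<bar>c''\<bar> \<le> \<gamma>\<^sup>2\<close> permit \<open>\<epsilon>\<close> of order \<open>\<gamma>\<^sup>2 / l\<^sup>2\<close> as long as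
\<open>\<gamma> \<le> l\<close>. On an interval that ends at \<open>b\<close> the constraint \<open>\<integral> \<bar>c - \<kappa>\<^sup>2\<bar> \<le> S\<close> then reads \<open>G(b) / l\<^sup>2 \<le> const * S(b)\<close>,
so the best frequency is \<open>l = sqrt (G(b) / S(b))\<close>, and the exponent becomes
\<open>G(b) / l = sqrt (G(b) S(b))\<close>, which is \<open>sqrt (M(b))\<close> when \<open>b\<close> is a time at which \<open>G S\<close> attains a new maximum.

On one interval the resonance is explicit: the function \<open>sin (m s) / m * exp (\<integral> e sin\<^sup>2 (m s))\<close> solves an
oscillator equation whose speed can be read off, and \<open>e\<close> is a small multiple of \<open>\<gamma>\<^sup>2 / l\<close> times a smooth
cutoff (lemma \<open>resonant_block\<close>). Three derivatives of \<open>e\<close> enter \<open>c''\<close>, which is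
where the bounds on three derivatives of \<open>\<gamma>\<close> are used. Averaging \<open>sin\<^sup>2\<close> gives the exponent
(\<open>resonant_integral_lower_bound\<close>).

These resonances are placed on consecutive intervals \<open>[b k, b (k+1)]\<close> (\<open>resonance_sequence\<close>), each at its own
frequency; \<open>S (b (k+1)) \<le> S (b k) / 2\<close> makes the contributions to \<open>\<integral> \<bar>c - \<kappa>\<^sup>2\<bar>\<close> telescope (\<open>resonant_speed\<close>). A mode that
is to grow on the \<open>k\<close>-th interval may have lost energy before, but the energy
\<open>v\<^sup>2 + c l\<^sup>2 w\<^sup>2\<close> changes on \<open>[t0, b k]\<close> at most by the factor \<open>exp (\<integral> \<gamma> / \<Lambda>1)\<close>, whatever the frequency
(\<open>oscillator_energy_bounds\<close>). This factor is known once \<open>b k\<close> is, so \<open>b (k+1)\<close> can be chosen so late that half of the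
exponent pays for this loss and for the weight \<open>2\<^sup>-\<^sup>k\<close> that the mode receives in the superposition.

The operator need not have eigenvectors, so each mode is spread over a set of finite positive measure on which
\<open>\<lambda>\<^sup>2\<close> is very close to the resonant value; scalar solutions depend continuously on \<open>\<lambda>\<^sup>2\<close> (they
are power series in it, \<open>linear_oscillator_solution\<close>), so the growth persists there (\<open>resonant_mode\<close>). The
solution in the Hilbert space is assembled fibrewise, and dominated convergence turns the pointwise equation into
the weak one (\<open>fiberwise_weak_solution\<close>).\<close>

section \<open>Weak solutions from fibrewise solutions\<close>

lemma L2_funD:
  assumes "f \<in> L2_fun \<mu>"
  shows "f \<in> borel_measurable \<mu>" "integrable \<mu> (\<lambda>p. (f p)\<^sup>2)"
  using assms by (auto simp: L2_fun_def)

lemma L2_fun_dominated: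
  assumes "f \<in> borel_measurable \<mu>" "integrable \<mu> g" "\<And>p. p \<in> space \<mu> \<Longrightarrow> (f p)\<^sup>2 \<le> g p"
  shows "f \<in> L2_fun \<mu>"
  unfolding L2_fun_def
proof (intro CollectI conjI assms(1))
  show "integrable \<mu> (\<lambda>p. (f p)\<^sup>2)"
    by (rule Bochner_Integration.integrable_bound[OF assms(2)])
      (use assms in \<open>auto intro!: AE_I2 order_trans[OF _ abs_ge_self]\<close>)
qed

lemma integrable_L2_product:
  fixes f g :: "'m \<Rightarrow> real"
  assumes f: "f \<in> L2_fun \<mu>" and g: "g \<in> L2_fun \<mu>"
  shows "integrable \<mu> (\<lambda>p. f p * g p)"
proof (rule Bochner_Integration.integrable_bound)
  show "integrable \<mu> (\<lambda>p. (f p)\<^sup>2 + (g p)\<^sup>2)"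
    using L2_funD[OF f] L2_funD[OF g] by simp
  show "(\<lambda>p. f p * g p) \<in> borel_measurable \<mu>"
    using L2_funD[OF f] L2_funD[OF g] by simp
  have "\<bar>f p * g p\<bar> \<le> (f p)\<^sup>2 + (g p)\<^sup>2" for p
  proof -
    have "2 * (\<bar>f p\<bar> * \<bar>g p\<bar>) \<le> (f p)\<^sup>2 + (g p)\<^sup>2"
      using sum_squares_bound[of "\<bar>f p\<bar>" "\<bar>g p\<bar>"] by simp
    moreover have "0 \<le> \<bar>f p\<bar> * \<bar>g p\<bar>" by simp
    ultimately show ?thesis unfolding abs_mult by linarith
  qed
  then show "AE p in \<mu>. norm (f p * g p) \<le> norm ((f p)\<^sup>2 + (g p)\<^sup>2)"
    by (auto intro!: AE_I2)
qed

lemma at_within_half_line_neq_bot: "(t::real) \<ge> t0 \<Longrightarrow> at t within {t0..} \<noteq> bot"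
proof -
  assume t: "t \<ge> t0"
  have "at t within {t..} \<le> at t within {t0..}" by (rule at_le) (use t in auto)
  moreover have "at t within {t..} \<noteq> bot"
    by (metis Ici_subset_Ioi_iff at_within_Ici_at_right trivial_limit_at_right_real)
  ultimately show ?thesis using bot.extremum_uniqueI by metis
qed

text \<open>Elements of the Hilbert space are handled through functions: \<open>repr f\<close> below is the vector represented by \<open>f\<close>.
Identities between vectors become almost-everywhere identities, and limits follow from dominated convergence.\<close>

locale L2_representation =
  fixes \<mu> :: "'m measure" and F :: "'h::{real_inner,complete_space} \<Rightarrow> 'm \<Rightarrow> real"
  assumes iso: "surj_isometry_L2 \<mu> F"
begin

lemma F_L2: "F u \<in> L2_fun \<mu>"
  using iso by (simp add: surj_isometry_L2_def)

lemma F_measurable [measurable]: "F u \<in> borel_measurable \<mu>"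
  using L2_funD[OF F_L2] by simp

lemma F_add: "AE p in \<mu>. F (u + v) p = F u p + F v p"
  using iso by (simp add: surj_isometry_L2_def)

lemma F_scale: "AE p in \<mu>. F (a *\<^sub>R u) p = a * F u p"
  using iso by (simp add: surj_isometry_L2_def)

lemma F_diff: "AE p in \<mu>. F (u - v) p = F u p - F v p"
  using F_add[of u "(-1) *\<^sub>R v"] F_scale[of "-1" v] by eventually_elim simp

lemma norm_sq: "(norm u)\<^sup>2 = (\<integral>p. (F u p)\<^sup>2 \<partial>\<mu>)"
proof -
  have "norm u = sqrt (\<integral>p. (F u p)\<^sup>2 \<partial>\<mu>)"
    using iso by (simp add: surj_isometry_L2_def)
  then show ?thesis by simp
qed

text \<open>By polarisation: only the norm is prescribed by the isometry.\<close>

lemma inner_eq: "inner u v = (\<integral>p. F u p * F v p \<partial>\<mu>)"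
proof -
  have "(norm (u + v))\<^sup>2 = (\<integral>p. (F u p + F v p)\<^sup>2 \<partial>\<mu>)"
    unfolding norm_sq using F_add[of u v]
    by (intro integral_cong_AE) auto
  also have "\<dots> = (\<integral>p. ((F u p)\<^sup>2 + (F v p)\<^sup>2) + 2 * (F u p * F v p) \<partial>\<mu>)"
    by (intro Bochner_Integration.integral_cong) (auto simp: power2_eq_square algebra_simps)
  also have "\<dots> = (norm u)\<^sup>2 + (norm v)\<^sup>2 + 2 * (\<integral>p. F u p * F v p \<partial>\<mu>)"
    using L2_funD[OF F_L2, of u] L2_funD[OF F_L2, of v] integrable_L2_product[OF F_L2 F_L2, of u v]
    by (simp add: norm_sq)
  moreover have "(norm (u + v))\<^sup>2 = (norm u)\<^sup>2 + (norm v)\<^sup>2 + 2 * inner u v"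
    by (simp add: power2_norm_eq_inner inner_add inner_commute)
  ultimately show ?thesis by simp
qed

lemma F_inj:
  assumes "AE p in \<mu>. F u p = F v p"
  shows "u = v"
proof -
  have "(norm (u - v))\<^sup>2 = (\<integral>p. 0 \<partial>\<mu>)"
    unfolding norm_sq
  proof (intro integral_cong_AE)
    show "AE p in \<mu>. (F (u - v) p)\<^sup>2 = 0"
      using assms F_diff[of u v] by eventually_elim simp
  qed auto
  then show ?thesis by simp
qed

definition repr :: "('m \<Rightarrow> real) \<Rightarrow> 'h" where
  "repr f = (SOME u. AE p in \<mu>. F u p = f p)"

lemma F_repr: "f \<in> L2_fun \<mu> \<Longrightarrow> AE p in \<mu>. F (repr f) p = f p"
  unfolding repr_def by (rule someI_ex) (use iso in \<open>simp add: surj_isometry_L2_def\<close>)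

lemma norm_repr_sq: "f \<in> L2_fun \<mu> \<Longrightarrow> (norm (repr f))\<^sup>2 = (\<integral>p. (f p)\<^sup>2 \<partial>\<mu>)"
  unfolding norm_sq using F_repr[of f] L2_funD[of f \<mu>] by (intro integral_cong_AE) auto

lemma sqrt_op_eqI:
  assumes "AE p in \<mu>. F v p = lam p * F u p"
  shows "sqrt_op \<mu> lam F u = v"
  unfolding sqrt_op_def
proof (rule the_equality)
  show "AE p in \<mu>. F v p = lam p * F u p" by fact
  show "x = v" if "AE p in \<mu>. F x p = lam p * F u p" for x
    by (rule F_inj) (use that assms in eventually_elim, simp)
qed

lemma F_sqrt_op:
  assumes "u \<in> sqrt_dom \<mu> lam F"
  shows "AE p in \<mu>. F (sqrt_op \<mu> lam F u) p = lam p * F u p"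
proof -
  have *: "(\<lambda>p. lam p * F u p) \<in> L2_fun \<mu>" using assms by (simp add: sqrt_dom_def)
  show ?thesis using F_repr[OF *] sqrt_op_eqI[OF F_repr[OF *]] by simp
qed

lemma repr_tendsto_zero:
  assumes Z: "\<And>n::nat. AE p in \<mu>. F (Z n) p = f n p"
    and meas: "\<And>n. f n \<in> borel_measurable \<mu>"
    and lim: "\<And>p. p \<in> space \<mu> \<Longrightarrow> (\<lambda>n. f n p) \<longlonglongrightarrow> 0"
    and g: "integrable \<mu> g" and dom: "\<And>n p. p \<in> space \<mu> \<Longrightarrow> (f n p)\<^sup>2 \<le> g p"
  shows "Z \<longlonglongrightarrow> 0"
proof -
  have eq: "(norm (Z n))\<^sup>2 = (\<integral>p. (f n p)\<^sup>2 \<partial>\<mu>)" for n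
    unfolding norm_sq using Z[of n] meas[of n] by (intro integral_cong_AE) auto
  have "(\<lambda>n. \<integral>p. (f n p)\<^sup>2 \<partial>\<mu>) \<longlonglongrightarrow> (\<integral>p. 0 \<partial>\<mu>)"
  proof (rule integral_dominated_convergence[OF _ _ g])
    show "AE p in \<mu>. (\<lambda>n. (f n p)\<^sup>2) \<longlonglongrightarrow> 0"
      using lim by (intro AE_I2) (auto intro!: tendsto_eq_intros)
    show "AE p in \<mu>. norm ((f n p)\<^sup>2) \<le> g p" for n
      using dom by (intro AE_I2) auto
  qed (use meas in auto)
  then have "(\<lambda>n. (norm (Z n))\<^sup>2) \<longlonglongrightarrow> 0" by (simp add: eq)
  then have "(\<lambda>n. sqrt ((norm (Z n))\<^sup>2)) \<longlonglongrightarrow> sqrt 0" by (rule tendsto_real_sqrt)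
  then show ?thesis by (simp add: tendsto_norm_zero_iff)
qed

lemma repr_continuous_on:
  fixes f :: "real \<Rightarrow> 'm \<Rightarrow> real"
  assumes meas: "\<And>t. t \<ge> t0 \<Longrightarrow> f t \<in> borel_measurable \<mu>"
    and cont: "\<And>p. p \<in> space \<mu> \<Longrightarrow> continuous_on {t0..} (\<lambda>t. f t p)"
    and dom: "\<And>T. \<exists>g. integrable \<mu> g \<and> (\<forall>t\<in>{t0..T}. \<forall>p\<in>space \<mu>. (f t p)\<^sup>2 \<le> g p)"
  shows "continuous_on {t0..} (\<lambda>t. repr (f t))"
  unfolding continuous_on_sequentially
proof (intro allI ballI impI, elim conjE)
  fix X and t assume t: "t \<in> {t0..}" and X: "\<forall>n. X n \<in> {t0..}" and lim: "X \<longlonglongrightarrow> t"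
  obtain T where T: "\<And>n. X n \<le> T"
    using convergent_imp_Bseq[OF convergentI[OF lim]] unfolding Bseq_def
    by (metis abs_le_D1 real_norm_def)
  then have tT: "t \<le> T" using LIMSEQ_le_const2[OF lim] by blast
  obtain g where g: "integrable \<mu> g"
    and gd: "\<And>s p. s \<in> {t0..T} \<Longrightarrow> p \<in> space \<mu> \<Longrightarrow> (f s p)\<^sup>2 \<le> g p"
    using dom[of T] by blast
  have L2: "f s \<in> L2_fun \<mu>" if "s \<in> {t0..T}" for s
    using that by (intro L2_fun_dominated[OF meas g gd]) auto
  have XT: "X n \<in> {t0..T}" for n using X T by auto
  have tT': "t \<in> {t0..T}" using t tT by auto
  have "(\<lambda>n. repr (f (X n)) - repr (f t)) \<longlonglongrightarrow> 0"
  proof (rule repr_tendsto_zero)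
    show "AE p in \<mu>. F (repr (f (X n)) - repr (f t)) p = f (X n) p - f t p" for n
      using F_diff[of "repr (f (X n))" "repr (f t)"] F_repr[OF L2[OF XT[of n]]] F_repr[OF L2[OF tT']]
      by eventually_elim simp
    show "(\<lambda>p. f (X n) p - f t p) \<in> borel_measurable \<mu>" for n
      using meas[of "X n"] meas[of t] XT[of n] t by auto
    show "(\<lambda>n. f (X n) p - f t p) \<longlonglongrightarrow> 0" if "p \<in> space \<mu>" for p
    proof -
      have "((\<lambda>t. f t p) \<circ> X) \<longlonglongrightarrow> f t p"
        using cont[OF that] X lim t unfolding continuous_on_sequentially by blast
      then show ?thesis by (auto intro!: tendsto_eq_intros simp: o_def)
    qed
    show "integrable \<mu> (\<lambda>p. 4 * g p)" using g by simp
    show "(f (X n) p - f t p)\<^sup>2 \<le> 4 * g p" if "p \<in> space \<mu>" for n p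
    proof -
      have "(f (X n) p - f t p)\<^sup>2 \<le> 2 * (f (X n) p)\<^sup>2 + 2 * (f t p)\<^sup>2"
        using zero_le_power2[of "f (X n) p + f t p"] by (simp add: power2_eq_square algebra_simps)
      then show ?thesis using gd[OF XT[of n] that] gd[OF tT' that] by linarith
    qed
  qed
  then show "((\<lambda>t. repr (f t)) \<circ> X) \<longlonglongrightarrow> repr (f t)"
    by (simp add: o_def LIM_zero_iff)
qed

text \<open>The difference quotients of \<open>w\<close> are dominated through the mean value theorem: a square-integrable
bound for \<open>v\<close>, locally uniform in time, bounds them all.\<close>

lemma repr_has_vector_derivative:
  fixes w v :: "real \<Rightarrow> 'm \<Rightarrow> real"
  assumes w_meas: "\<And>t. t \<ge> t0 \<Longrightarrow> w t \<in> borel_measurable \<mu>"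
    and v_meas: "\<And>t. t \<ge> t0 \<Longrightarrow> v t \<in> borel_measurable \<mu>"
    and dw: "\<And>t p. t \<ge> t0 \<Longrightarrow> p \<in> space \<mu> \<Longrightarrow>
      ((\<lambda>s. w s p) has_real_derivative v t p) (at t within {t0..})"
    and dom: "\<And>T. \<exists>g. integrable \<mu> g \<and>
      (\<forall>t\<in>{t0..T}. \<forall>p\<in>space \<mu>. (w t p)\<^sup>2 \<le> g p \<and> (v t p)\<^sup>2 \<le> g p)"
    and t: "t \<ge> t0"
  shows "((\<lambda>t. repr (w t)) has_vector_derivative repr (v t)) (at t within {t0..})"
  unfolding has_vector_derivative_def has_derivative_within
proof (intro conjI)
  show "bounded_linear (\<lambda>x. x *\<^sub>R repr (v t))" by (rule bounded_linear_scaleR_left)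
  show "((\<lambda>y. (1 / norm (y - t)) *\<^sub>R (repr (w y) - (repr (w t) + (y - t) *\<^sub>R repr (v t)))) \<longlongrightarrow> 0)
      (at t within {t0..})"
    unfolding tendsto_at_iff_sequentially
  proof (intro allI impI)
    fix X assume X: "\<forall>n. X n \<in> {t0..} - {t}" and lim: "X \<longlonglongrightarrow> t"
    obtain T where T: "\<And>n. X n \<le> T"
      using convergent_imp_Bseq[OF convergentI[OF lim]] unfolding Bseq_def
      by (metis abs_le_D1 real_norm_def)
    then have tT: "t \<le> T" using LIMSEQ_le_const2[OF lim] by blast
    obtain g where g: "integrable \<mu> g"
      and gw: "\<And>s p. s \<in> {t0..T} \<Longrightarrow> p \<in> space \<mu> \<Longrightarrow> (w s p)\<^sup>2 \<le> g p"
      and gv: "\<And>s p. s \<in> {t0..T} \<Longrightarrow> p \<in> space \<mu> \<Longrightarrow> (v s p)\<^sup>2 \<le> g p"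
      using dom[of T] by blast
    have XT: "X n \<in> {t0..T}" "X n \<noteq> t" "X n \<ge> t0" for n using X T by auto
    have tT': "t \<in> {t0..T}" using t tT by auto
    have w2: "w s \<in> L2_fun \<mu>" if "s \<in> {t0..T}" for s
      using that by (intro L2_fun_dominated[OF w_meas g gw]) auto
    have v2: "v s \<in> L2_fun \<mu>" if "s \<in> {t0..T}" for s
      using that by (intro L2_fun_dominated[OF v_meas g gv]) auto
    show "((\<lambda>y. (1 / norm (y - t)) *\<^sub>R (repr (w y) - (repr (w t) + (y - t) *\<^sub>R repr (v t)))) \<circ> X)
        \<longlonglongrightarrow> 0"
      unfolding o_def
    proof (rule repr_tendsto_zero)
      fix n
      show "AE p in \<mu>. F ((1 / norm (X n - t)) *\<^sub>R
          (repr (w (X n)) - (repr (w t) + (X n - t) *\<^sub>R repr (v t)))) p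
          = (1 / \<bar>X n - t\<bar>) * (w (X n) p - (w t p + (X n - t) * v t p))"
        using F_scale[of "1 / norm (X n - t)" "repr (w (X n)) - (repr (w t) + (X n - t) *\<^sub>R repr (v t))"]
          F_diff[of "repr (w (X n))" "repr (w t) + (X n - t) *\<^sub>R repr (v t)"]
          F_add[of "repr (w t)" "(X n - t) *\<^sub>R repr (v t)"] F_scale[of "X n - t" "repr (v t)"]
          F_repr[OF w2[OF XT(1)[of n]]] F_repr[OF w2[OF tT']] F_repr[OF v2[OF tT']]
        by eventually_elim simp
      show "(\<lambda>p. (1 / \<bar>X n - t\<bar>) * (w (X n) p - (w t p + (X n - t) * v t p)))
          \<in> borel_measurable \<mu>"
        using w_meas[OF XT(3)[of n]] w_meas[OF t] v_meas[OF t] by auto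
    next
      fix p assume p: "p \<in> space \<mu>"
      have "((\<lambda>y. (1 / norm (y - t)) *\<^sub>R (w y p - (w t p + v t p * (y - t)))) \<longlongrightarrow> 0) (at t within {t0..})"
        using dw[OF t p] unfolding has_field_derivative_def has_derivative_within by blast
      then show "(\<lambda>n. (1 / \<bar>X n - t\<bar>) * (w (X n) p - (w t p + (X n - t) * v t p))) \<longlonglongrightarrow> 0"
        using X lim unfolding tendsto_at_iff_sequentially by (auto simp: o_def mult.commute)
    next
      show "integrable \<mu> (\<lambda>p. 4 * g p)" using g by simp
    next
      fix n p assume p: "p \<in> space \<mu>"
      define B where "B = sqrt (g p)"
      have g0: "0 \<le> g p" using gv[OF tT' p] zero_le_power2[of "v t p"] by linarith
      have vB: "\<bar>v s p\<bar> \<le> B" if "s \<in> {t0..T}" for s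
        using real_sqrt_le_mono[OF gv[OF that p]] by (simp add: B_def)
      have "norm (w (X n) p - w t p) \<le> B * norm (X n - t)"
      proof (rule field_differentiable_bound)
        show "convex {t0..T}" by simp
        show "((\<lambda>s. w s p) has_field_derivative v s p) (at s within {t0..T})" if "s \<in> {t0..T}" for s
          using dw[of s p] that p by (auto intro: DERIV_subset)
        show "norm (v s p) \<le> B" if "s \<in> {t0..T}" for s using vB[OF that] by simp
      qed (use XT tT' in auto)
      moreover have "\<bar>(X n - t) * v t p\<bar> \<le> B * \<bar>X n - t\<bar>"
        using mult_right_mono[OF vB[OF tT'], of "\<bar>X n - t\<bar>"]
        by (simp add: abs_mult mult.commute)
      ultimately have "\<bar>w (X n) p - (w t p + (X n - t) * v t p)\<bar> \<le> (2 * B) * \<bar>X n - t\<bar>"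
        by (simp add: abs_le_iff algebra_simps)
      then have "\<bar>(1 / \<bar>X n - t\<bar>) * (w (X n) p - (w t p + (X n - t) * v t p))\<bar> \<le> 2 * B"
        using XT(2)[of n] by (simp add: abs_mult field_simps)
      then have "\<bar>(1 / \<bar>X n - t\<bar>) * (w (X n) p - (w t p + (X n - t) * v t p))\<bar>\<^sup>2 \<le> (2 * B)\<^sup>2"
        by (intro power_mono) auto
      also have "\<dots> = 4 * g p" using g0 by (simp add: B_def power_mult_distrib)
      finally show "((1 / \<bar>X n - t\<bar>) * (w (X n) p - (w t p + (X n - t) * v t p)))\<^sup>2 \<le> 4 * g p"
        by (subst (asm) power2_abs)
    qed
  qed
qed

text \<open>The domination asks only for square-integrable bounds on \<open>w\<close>, \<open>v\<close> and \<open>lam * w\<close>, that is, for finite energy; \<open>lam\<^sup>2 * w\<close>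
need not be square integrable. That is why the second derivative can only be taken weakly: against a test
vector in the form domain one factor \<open>lam\<close> moves to the test
vector, and the difference quotients are bounded by a product of two square-integrable functions.\<close>

lemma fiberwise_weak_solution:
  fixes w v :: "real \<Rightarrow> 'm \<Rightarrow> real" and c :: "real \<Rightarrow> real"
  assumes lam: "lam \<in> borel_measurable \<mu>"
    and w_meas: "\<And>t. t \<ge> t0 \<Longrightarrow> w t \<in> borel_measurable \<mu>"
    and v_meas: "\<And>t. t \<ge> t0 \<Longrightarrow> v t \<in> borel_measurable \<mu>"
    and dw: "\<And>t p. t \<ge> t0 \<Longrightarrow> p \<in> space \<mu> \<Longrightarrow>
      ((\<lambda>s. w s p) has_real_derivative v t p) (at t within {t0..})"
    and dv: "\<And>t p. t \<ge> t0 \<Longrightarrow> p \<in> space \<mu> \<Longrightarrow>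
      ((\<lambda>s. v s p) has_real_derivative - c t * (lam p)\<^sup>2 * w t p) (at t within {t0..})"
    and c: "\<And>t. t \<ge> t0 \<Longrightarrow> \<bar>c t\<bar> \<le> \<Lambda>"
    and dom: "\<And>T. \<exists>g. integrable \<mu> g \<and> (\<forall>t\<in>{t0..T}. \<forall>p\<in>space \<mu>.
      (w t p)\<^sup>2 \<le> g p \<and> (v t p)\<^sup>2 \<le> g p \<and> (lam p * w t p)\<^sup>2 \<le> g p)"
  defines "u \<equiv> \<lambda>t. repr (w t)"
  shows "weak_solution \<mu> lam F t0 c u"
    and "t \<ge> t0 \<Longrightarrow> integrable \<mu> (\<lambda>p. (v t p)\<^sup>2)"
    and "t \<ge> t0 \<Longrightarrow> integrable \<mu> (\<lambda>p. (lam p * w t p)\<^sup>2)"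
    and "t \<ge> t0 \<Longrightarrow> (norm (half_deriv t0 u t))\<^sup>2 = (\<integral>p. (v t p)\<^sup>2 \<partial>\<mu>)"
    and "t \<ge> t0 \<Longrightarrow> (norm (sqrt_op \<mu> lam F (u t)))\<^sup>2 = (\<integral>p. (lam p * w t p)\<^sup>2 \<partial>\<mu>)"
proof -
  have L2: "w s \<in> L2_fun \<mu>" "v s \<in> L2_fun \<mu>" "(\<lambda>p. lam p * w s p) \<in> L2_fun \<mu>" if s: "s \<ge> t0" for s
  proof -
    obtain g where g: "integrable \<mu> g"
      "\<And>p. p \<in> space \<mu> \<Longrightarrow> (w s p)\<^sup>2 \<le> g p" "\<And>p. p \<in> space \<mu> \<Longrightarrow> (v s p)\<^sup>2 \<le> g p"
      "\<And>p. p \<in> space \<mu> \<Longrightarrow> (lam p * w s p)\<^sup>2 \<le> g p"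
      using dom[of s] s by fastforce
    show "w s \<in> L2_fun \<mu>" by (rule L2_fun_dominated[OF w_meas[OF s] g(1,2)])
    show "v s \<in> L2_fun \<mu>" by (rule L2_fun_dominated[OF v_meas[OF s] g(1,3)])
    show "(\<lambda>p. lam p * w s p) \<in> L2_fun \<mu>"
      by (rule L2_fun_dominated[OF _ g(1,4)]) (use lam w_meas[OF s] in measurable)
  qed
  have du: "(u has_vector_derivative repr (v s)) (at s within {t0..})" if s: "s \<ge> t0" for s
    unfolding u_def
  proof (rule repr_has_vector_derivative[OF w_meas v_meas dw _ s])
    show "\<exists>g. integrable \<mu> g \<and>
      (\<forall>t\<in>{t0..T}. \<forall>p\<in>space \<mu>. (w t p)\<^sup>2 \<le> g p \<and> (v t p)\<^sup>2 \<le> g p)" for T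
      using dom[of T] by blast
  qed
  have hd: "half_deriv t0 u s = repr (v s)" if s: "s \<ge> t0" for s
    unfolding half_deriv_def
    by (rule vector_derivative_within[OF at_within_half_line_neq_bot[OF s] du[OF s]])
  have Fu: "AE p in \<mu>. F (u s) p = w s p" if "s \<ge> t0" for s
    unfolding u_def by (rule F_repr[OF L2(1)[OF that]])
  have Fsq: "AE p in \<mu>. F (repr (\<lambda>p. lam p * w s p)) p = lam p * F (u s) p" if "s \<ge> t0" for s
    using F_repr[OF L2(3)[OF that]] Fu[OF that] by eventually_elim simp
  have sq: "sqrt_op \<mu> lam F (u s) = repr (\<lambda>p. lam p * w s p)" if s: "s \<ge> t0" for s
    by (rule sqrt_op_eqI[OF Fsq[OF s]])
  have cont_w: "continuous_on {t0..} (\<lambda>t. w t p)" if "p \<in> space \<mu>" for p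
    by (rule DERIV_continuous_on[where D = "\<lambda>t. v t p"]) (use dw that in auto)
  have cont_v: "continuous_on {t0..} (\<lambda>t. v t p)" if "p \<in> space \<mu>" for p
    by (rule DERIV_continuous_on[where D = "\<lambda>t. - c t * (lam p)\<^sup>2 * w t p"]) (use dv that in auto)
  have sd: "u s \<in> sqrt_dom \<mu> lam F" if s: "s \<ge> t0" for s
  proof -
    have "integrable \<mu> (\<lambda>p. (lam p * F (u s) p)\<^sup>2) \<longleftrightarrow> integrable \<mu> (\<lambda>p. (lam p * w s p)\<^sup>2)"
      by (rule integrable_cong_AE) (use lam w_meas[OF s] Fu[OF s] in auto)
    then show ?thesis
      using L2_funD[OF L2(3)[OF s]] lam by (simp add: sqrt_dom_def L2_fun_def)
  qed
  show "t \<ge> t0 \<Longrightarrow> integrable \<mu> (\<lambda>p. (v t p)\<^sup>2)"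
    and "t \<ge> t0 \<Longrightarrow> integrable \<mu> (\<lambda>p. (lam p * w t p)\<^sup>2)"
    using L2_funD[OF L2(2)] L2_funD[OF L2(3)] by auto
  show "t \<ge> t0 \<Longrightarrow> (norm (half_deriv t0 u t))\<^sup>2 = (\<integral>p. (v t p)\<^sup>2 \<partial>\<mu>)"
    using hd norm_repr_sq[OF L2(2)] by simp
  show "t \<ge> t0 \<Longrightarrow> (norm (sqrt_op \<mu> lam F (u t)))\<^sup>2 = (\<integral>p. (lam p * w t p)\<^sup>2 \<partial>\<mu>)"
    using sq norm_repr_sq[OF L2(3)] by simp
  have cont_u': "continuous_on {t0..} (\<lambda>t. repr (v t))"
  proof (rule repr_continuous_on[OF v_meas cont_v])
    show "\<exists>g. integrable \<mu> g \<and> (\<forall>t\<in>{t0..T}. \<forall>p\<in>space \<mu>. (v t p)\<^sup>2 \<le> g p)" for T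
      using dom[of T] by blast
  qed
  have cont_sq: "continuous_on {t0..} (\<lambda>t. repr (\<lambda>p. lam p * w t p))"
  proof (rule repr_continuous_on)
    show "(\<lambda>p. lam p * w t p) \<in> borel_measurable \<mu>" if "t \<ge> t0" for t
      using lam w_meas[OF that] by measurable
    show "continuous_on {t0..} (\<lambda>t. lam p * w t p)" if "p \<in> space \<mu>" for p
      by (intro continuous_intros cont_w that)
    show "\<exists>g. integrable \<mu> g \<and> (\<forall>t\<in>{t0..T}. \<forall>p\<in>space \<mu>. (lam p * w t p)\<^sup>2 \<le> g p)" for T
      using dom[of T] by blast
  qed
  have weak: "((\<lambda>s. inner (half_deriv t0 u s) \<phi>) has_real_derivative
      - c t * inner (sqrt_op \<mu> lam F (u t)) (sqrt_op \<mu> lam F \<phi>)) (at t within {t0..})"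
    if \<phi>: "\<phi> \<in> sqrt_dom \<mu> lam F" and t: "t \<ge> t0" for \<phi> t
    unfolding has_field_derivative_iff tendsto_at_iff_sequentially
  proof (intro allI impI)
    fix X assume X: "\<forall>n. X n \<in> {t0..} - {t}" and lim: "X \<longlonglongrightarrow> t"
    obtain T where T: "\<And>n. X n \<le> T"
      using convergent_imp_Bseq[OF convergentI[OF lim]] unfolding Bseq_def
      by (metis abs_le_D1 real_norm_def)
    then have tT: "t \<le> T" using LIMSEQ_le_const2[OF lim] by blast
    obtain g where g: "integrable \<mu> g"
      and gl: "\<And>s p. s \<in> {t0..T} \<Longrightarrow> p \<in> space \<mu> \<Longrightarrow> (lam p * w s p)\<^sup>2 \<le> g p"
      using dom[of T] by blast
    have XT: "X n \<in> {t0..T}" "X n \<noteq> t" "X n \<ge> t0" for n using X T by auto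
    have tT': "t \<in> {t0..T}" using t tT by auto
    have l\<phi>: "(\<lambda>p. lam p * F \<phi> p) \<in> L2_fun \<mu>" using \<phi> by (simp add: sqrt_dom_def)
    have c0: "0 \<le> \<Lambda>" using c[OF t] by (meson abs_ge_zero order_trans)
    define q where "q n p = (v (X n) p - v t p) / (X n - t) * F \<phi> p" for n p
    have quot: "(inner (half_deriv t0 u (X n)) \<phi> - inner (half_deriv t0 u t) \<phi>) / (X n - t)
        = (\<integral>p. q n p \<partial>\<mu>)" for n
    proof -
      have "inner (half_deriv t0 u (X n)) \<phi> - inner (half_deriv t0 u t) \<phi>
          = inner (repr (v (X n)) - repr (v t)) \<phi>"
        by (simp add: hd[OF XT(3)] hd[OF t] inner_diff_left)
      also have "\<dots> = (\<integral>p. F (repr (v (X n)) - repr (v t)) p * F \<phi> p \<partial>\<mu>)" by (rule inner_eq)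
      also have "\<dots> = (\<integral>p. (X n - t) * q n p \<partial>\<mu>)"
      proof (rule integral_cong_AE)
        show "AE p in \<mu>. F (repr (v (X n)) - repr (v t)) p * F \<phi> p = (X n - t) * q n p"
          using F_diff[of "repr (v (X n))" "repr (v t)"] F_repr[OF L2(2)[OF XT(3)[of n]]]
            F_repr[OF L2(2)[OF t]]
          by eventually_elim (use XT(2)[of n] in \<open>simp add: q_def\<close>)
        show "(\<lambda>p. (X n - t) * q n p) \<in> borel_measurable \<mu>"
          unfolding q_def using v_meas[OF XT(3)[of n]] v_meas[OF t] by measurable
      qed measurable
      finally show ?thesis using XT(2)[of n] by simp
    qed
    have limq: "(\<lambda>n. \<integral>p. q n p \<partial>\<mu>) \<longlonglongrightarrow> (\<integral>p. - c t * ((lam p * w t p) * (lam p * F \<phi> p)) \<partial>\<mu>)"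
    proof (rule integral_dominated_convergence)
      show "(\<lambda>p. - c t * ((lam p * w t p) * (lam p * F \<phi> p))) \<in> borel_measurable \<mu>"
        using lam w_meas[OF t] by measurable
      show "q n \<in> borel_measurable \<mu>" for n
        unfolding q_def using v_meas[OF XT(3)[of n]] v_meas[OF t] by measurable
      show "integrable \<mu> (\<lambda>p. \<Lambda> * (g p + (lam p * F \<phi> p)\<^sup>2))"
        using g L2_funD[OF l\<phi>] by simp
      show "AE p in \<mu>. (\<lambda>n. q n p) \<longlonglongrightarrow> - c t * ((lam p * w t p) * (lam p * F \<phi> p))"
      proof (rule AE_I2)
        fix p assume p: "p \<in> space \<mu>"
        have "((\<lambda>y. (v y p - v t p) / (y - t)) \<longlongrightarrow> - c t * (lam p)\<^sup>2 * w t p) (at t within {t0..})"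
          using dv[OF t p] unfolding has_field_derivative_iff .
        then have "(\<lambda>n. (v (X n) p - v t p) / (X n - t)) \<longlonglongrightarrow> - c t * (lam p)\<^sup>2 * w t p"
          using X lim unfolding tendsto_at_iff_sequentially by (auto simp: o_def)
        from tendsto_mult[OF this tendsto_const[of "F \<phi> p"]]
        show "(\<lambda>n. q n p) \<longlonglongrightarrow> - c t * ((lam p * w t p) * (lam p * F \<phi> p))"
          by (simp add: q_def power2_eq_square algebra_simps)
      qed
      show "AE p in \<mu>. norm (q n p) \<le> \<Lambda> * (g p + (lam p * F \<phi> p)\<^sup>2)" for n
      proof (rule AE_I2)
        fix p assume p: "p \<in> space \<mu>"
        define B where "B = sqrt (g p)"
        have g0: "0 \<le> g p" using gl[OF tT' p] zero_le_power2[of "lam p * w t p"] by linarith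
        have lB: "\<bar>lam p * w s p\<bar> \<le> B" if "s \<in> {t0..T}" for s
          using real_sqrt_le_mono[OF gl[OF that p]] by (simp add: B_def)
        have "norm (v (X n) p - v t p) \<le> (\<Lambda> * (\<bar>lam p\<bar> * B)) * norm (X n - t)"
        proof (rule field_differentiable_bound)
          show "convex {t0..T}" by simp
          show "((\<lambda>s. v s p) has_field_derivative - c s * (lam p)\<^sup>2 * w s p) (at s within {t0..T})"
            if "s \<in> {t0..T}" for s
            using dv[of s p] that p by (auto intro: DERIV_subset)
          show "norm (- c s * (lam p)\<^sup>2 * w s p) \<le> \<Lambda> * (\<bar>lam p\<bar> * B)" if "s \<in> {t0..T}" for s
          proof -
            have "norm (- c s * (lam p)\<^sup>2 * w s p) = \<bar>c s\<bar> * (\<bar>lam p\<bar> * \<bar>lam p * w s p\<bar>)"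
              by (simp add: abs_mult power2_eq_square)
            also have "\<dots> \<le> \<Lambda> * (\<bar>lam p\<bar> * B)"
              using c[of s] lB[OF that] that c0 by (intro mult_mono) (auto intro: mult_left_mono)
            finally show ?thesis .
          qed
        qed (use XT tT' in auto)
        then have "\<bar>(v (X n) p - v t p) / (X n - t)\<bar> \<le> \<Lambda> * (\<bar>lam p\<bar> * B)"
          using XT(2)[of n] by (simp add: abs_divide field_simps)
        then have "\<bar>q n p\<bar> \<le> \<Lambda> * (\<bar>lam p\<bar> * B) * \<bar>F \<phi> p\<bar>"
          unfolding q_def abs_mult by (intro mult_right_mono) auto
        also have "\<dots> = \<Lambda> * (B * \<bar>lam p * F \<phi> p\<bar>)" by (simp add: abs_mult)
        also have "\<dots> \<le> \<Lambda> * (g p + (lam p * F \<phi> p)\<^sup>2)"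
        proof (rule mult_left_mono[OF _ c0])
          have "2 * (B * \<bar>lam p * F \<phi> p\<bar>) \<le> B\<^sup>2 + (lam p * F \<phi> p)\<^sup>2"
            using sum_squares_bound[of B "\<bar>lam p * F \<phi> p\<bar>"] by simp
          moreover have "0 \<le> B * \<bar>lam p * F \<phi> p\<bar>" using g0 by (simp add: B_def)
          moreover have "B\<^sup>2 = g p" using g0 by (simp add: B_def)
          ultimately show "B * \<bar>lam p * F \<phi> p\<bar> \<le> g p + (lam p * F \<phi> p)\<^sup>2" by linarith
        qed
        finally show "norm (q n p) \<le> \<Lambda> * (g p + (lam p * F \<phi> p)\<^sup>2)" by simp
      qed
    qed
    have "inner (sqrt_op \<mu> lam F (u t)) (sqrt_op \<mu> lam F \<phi>)
        = (\<integral>p. (lam p * w t p) * (lam p * F \<phi> p) \<partial>\<mu>)"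
      unfolding inner_eq
    proof (rule integral_cong_AE)
      show "AE p in \<mu>. F (sqrt_op \<mu> lam F (u t)) p * F (sqrt_op \<mu> lam F \<phi>) p
          = (lam p * w t p) * (lam p * F \<phi> p)"
        using F_sqrt_op[OF sd[OF t]] F_sqrt_op[OF \<phi>] Fu[OF t] by eventually_elim simp
      show "(\<lambda>p. (lam p * w t p) * (lam p * F \<phi> p)) \<in> borel_measurable \<mu>"
        using lam w_meas[OF t] by measurable
    qed measurable
    then have "(\<integral>p. - c t * ((lam p * w t p) * (lam p * F \<phi> p)) \<partial>\<mu>)
        = - c t * inner (sqrt_op \<mu> lam F (u t)) (sqrt_op \<mu> lam F \<phi>)" by simp
    from limq[unfolded this] show "((\<lambda>y. (inner (half_deriv t0 u y) \<phi> - inner (half_deriv t0 u t) \<phi>) / (y - t)) \<circ> X)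
        \<longlonglongrightarrow> - c t * inner (sqrt_op \<mu> lam F (u t)) (sqrt_op \<mu> lam F \<phi>)"
      unfolding o_def quot .
  qed
  show "weak_solution \<mu> lam F t0 c u"
    unfolding weak_solution_def
  proof (intro conjI allI impI ballI)
    show "continuous_on {t0..} u"
      by (rule continuous_on_vector_derivative[where f' = "\<lambda>s. repr (v s)"]) (use du in auto)
    show "continuous_on {t0..} (\<lambda>t. sqrt_op \<mu> lam F (u t))"
      using cont_sq sq by (subst continuous_on_cong[OF refl, where g = "\<lambda>t. repr (\<lambda>p. lam p * w t p)"]) auto
    have "continuous_on {t0..} (half_deriv t0 u)"
      using cont_u' hd by (subst continuous_on_cong[OF refl, where g = "\<lambda>t. repr (v t)"]) auto
    moreover have "u differentiable_on {t0..}"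
      unfolding differentiable_on_def using du by (auto intro: differentiableI_vector)
    ultimately show "C_half 1 t0 u" by (simp add: C_half_def)
  qed (use sd weak in auto)
qed

end

section \<open>The scalar oscillator with a time-dependent speed\<close>

lemma half_line_derivI:
  fixes f :: "real \<Rightarrow> real"
  assumes "(f has_real_derivative D) (at t within {t0..b})" "t < b"
  shows "(f has_real_derivative D) (at t within {t0..})"
proof -
  have "at t within {t0..b} = at t within {t0..}"
    by (rule at_within_nhd[of t "{..<b}"]) (use assms(2) in auto)
  then show ?thesis using assms(1) by simp
qed

lemma half_line_antiderivative:
  fixes f :: "real \<Rightarrow> real"
  assumes "continuous_on {t0..} f" "t \<ge> t0"
  shows "((\<lambda>t. integral {t0..t} f) has_real_derivative f t) (at t within {t0..})"
proof (rule half_line_derivI)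
  show "((\<lambda>t. integral {t0..t} f) has_real_derivative f t) (at t within {t0..t + 1})"
    by (rule integral_has_real_derivative) (use assms in \<open>auto intro: continuous_on_subset\<close>)
qed simp

lemma series_has_real_derivative:
  fixes f f' :: "nat \<Rightarrow> real \<Rightarrow> real"
  assumes df: "\<And>n t. t \<ge> t0 \<Longrightarrow> (f n has_real_derivative f' n t) (at t within {t0..})"
    and f: "summable (\<lambda>n. f n t0)"
    and bound: "\<And>T. T \<ge> 1 \<Longrightarrow> \<exists>M. summable M \<and> (\<forall>n. \<forall>t\<in>{t0..t0 + T}. \<bar>f' n t\<bar> \<le> M n)"
    and t: "t \<ge> t0"
  shows "((\<lambda>t. \<Sum>n. f n t) has_real_derivative (\<Sum>n. f' n t)) (at t within {t0..})"
proof (rule half_line_derivI[of _ _ _ _ "t + 1"])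
  define T where "T = t - t0 + 1"
  then have T: "T \<ge> 1" "t0 + T = t + 1" using t by auto
  obtain M where M: "summable M" "\<And>n s. s \<in> {t0..t0 + T} \<Longrightarrow> \<bar>f' n s\<bar> \<le> M n"
    using bound[OF T(1)] by blast
  have "uniform_limit {t0..t0 + T} (\<lambda>n s. \<Sum>i<n. f' i s) (\<lambda>s. \<Sum>i. f' i s) sequentially"
    by (rule Weierstrass_m_test[OF _ M(1)]) (use M(2) in auto)
  then have "\<exists>g. \<forall>s\<in>{t0..t0 + T}. (\<lambda>n. f n s) sums g s \<and>
      (g has_field_derivative (\<Sum>i. f' i s)) (at s within {t0..t0 + T})"
    by (intro has_field_derivative_series[of _ _ _ _ t0])
      (use df f T in \<open>auto intro!: DERIV_subset[OF df]\<close>)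
  then obtain g where g: "\<And>s. s \<in> {t0..t + 1} \<Longrightarrow> (\<lambda>n. f n s) sums g s"
    "\<And>s. s \<in> {t0..t + 1} \<Longrightarrow> (g has_field_derivative (\<Sum>i. f' i s)) (at s within {t0..t + 1})"
    unfolding T(2) by blast
  show "((\<lambda>t. \<Sum>n. f n t) has_real_derivative (\<Sum>n. f' n t)) (at t within {t0..t + 1})"
  proof (rule has_field_derivative_transform_within[of g _ _ _ 1])
    show "g s = (\<Sum>n. f n s)" if "s \<in> {t0..t + 1}" for s using g(1)[OF that] by (rule sums_unique)
  qed (use g(2)[of t] t in auto)
qed simp

text \<open>The solution is sought as a power series in the spectral parameter \<open>z\<close>: its coefficients satisfy
\<open>x\<^sub>n'' = - c x\<^sub>n\<^sub>-\<^sub>1\<close> and are iterated integrals, bounded by \<open>const\<^sup>n / n!\<close>. Existence for all times and all \<open>z\<close>, and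
continuity in \<open>z\<close> for fixed time, come out together.\<close>

lemma linear_oscillator_solution:
  fixes c :: "real \<Rightarrow> real" and \<alpha> \<beta> t0 \<Lambda> :: real
  assumes c: "continuous_on {t0..} c" and cb: "\<And>t. t \<ge> t0 \<Longrightarrow> \<bar>c t\<bar> \<le> \<Lambda>"
  obtains X Y :: "real \<Rightarrow> real \<Rightarrow> real" where
    "\<And>z. X z t0 = \<alpha>" "\<And>z. Y z t0 = \<beta>"
    "\<And>z t. t \<ge> t0 \<Longrightarrow> (X z has_real_derivative Y z t) (at t within {t0..})"
    "\<And>z t. t \<ge> t0 \<Longrightarrow> (Y z has_real_derivative - c t * z * X z t) (at t within {t0..})"
    "\<And>z t. t \<ge> t0 \<Longrightarrow> isCont (\<lambda>z. X z t) z" "\<And>z t. t \<ge> t0 \<Longrightarrow> isCont (\<lambda>z. Y z t) z"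
proof -
  define x where "x = rec_nat (\<lambda>t. \<alpha> + \<beta> * (t - t0))
    (\<lambda>n f t. integral {t0..t} (\<lambda>r. integral {t0..r} (\<lambda>s. - c s * f s)))"
  have x0: "x 0 = (\<lambda>t. \<alpha> + \<beta> * (t - t0))" by (simp add: x_def)
  define y where "y n t = (case n of 0 \<Rightarrow> \<beta> | Suc m \<Rightarrow> integral {t0..t} (\<lambda>s. - c s * x m s))" for n t
  have yS: "y (Suc n) = (\<lambda>t. integral {t0..t} (\<lambda>s. - c s * x n s))" for n
    by (simp add: y_def fun_eq_iff)
  have xS: "x (Suc n) = (\<lambda>t. integral {t0..t} (y (Suc n)))" for n
    unfolding yS by (simp only: x_def nat.rec)
  have y0: "y 0 = (\<lambda>t. \<beta>)" by (simp add: y_def fun_eq_iff)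
  have \<Lambda>0: "\<Lambda> \<ge> 0" using cb[of t0] by auto
  have cont: "continuous_on {t0..} (x n) \<and> continuous_on {t0..} (y n)" for n
  proof (induction n)
    case 0 show ?case unfolding x0 y0 by (intro conjI continuous_intros)
  next
    case (Suc n)
    then have 1: "continuous_on {t0..} (\<lambda>s. - c s * x n s)" by (intro continuous_intros c) auto
    have 2: "continuous_on {t0..} (y (Suc n))"
      unfolding yS by (rule DERIV_continuous_on) (use half_line_antiderivative[OF 1] in auto)
    have "continuous_on {t0..} (x (Suc n))"
      unfolding xS by (rule DERIV_continuous_on) (use half_line_antiderivative[OF 2] in auto)
    with 2 show ?case by simp
  qed
  have dx: "(x n has_real_derivative y n t) (at t within {t0..})" if t: "t \<ge> t0" for n t
  proof (cases n)
    case 0 then show ?thesis by (auto simp: x0 y0 intro!: derivative_eq_intros)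
  next
    case (Suc m)
    show ?thesis unfolding Suc xS
      by (rule half_line_antiderivative) (use cont t in auto)
  qed
  have dy: "(y (Suc n) has_real_derivative - c t * x n t) (at t within {t0..})" if t: "t \<ge> t0" for n t
    unfolding yS by (rule half_line_antiderivative) (use cont[of n] t in \<open>auto intro!: continuous_intros c\<close>)
  \<comment> \<open>\<open>D T\<close> bounds the term of order zero on an interval of length \<open>T\<close>.\<close>
  define D where "D T = \<bar>\<alpha>\<bar> + \<bar>\<beta>\<bar> * T" for T
  have int: "integral {t0..t} (\<lambda>s. K * ((s - t0) ^ n / fact n)) = K * ((t - t0) ^ Suc n / fact (Suc n))"
    "(\<lambda>s. K * ((s - t0) ^ n / fact n)) integrable_on {t0..t}"
    if "t \<ge> t0" for K t n
  proof -
    have "((\<lambda>s. K * ((s - t0) ^ n / fact n)) has_integral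
        K * ((t - t0) ^ Suc n / fact (Suc n)) - K * ((t0 - t0) ^ Suc n / fact (Suc n))) {t0..t}"
    proof (rule fundamental_theorem_of_calculus[OF that])
      fix s :: real
      have "((\<lambda>s. K * ((s - t0) ^ Suc n / fact (Suc n))) has_real_derivative K * ((s - t0) ^ n / fact n))
          (at s within {t0..t})"
        by (rule derivative_eq_intros refl | simp)+
      then show "((\<lambda>s. K * ((s - t0) ^ Suc n / fact (Suc n))) has_vector_derivative K * ((s - t0) ^ n / fact n))
          (at s within {t0..t})"
        by (simp add: has_real_derivative_iff_has_vector_derivative)
    qed
    then show "integral {t0..t} (\<lambda>s. K * ((s - t0) ^ n / fact n)) = K * ((t - t0) ^ Suc n / fact (Suc n))"
      "(\<lambda>s. K * ((s - t0) ^ n / fact n)) integrable_on {t0..t}"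
      by (auto simp: has_integral_iff)
  qed
  have D0: "D T \<ge> 0" if "T \<ge> 1" for T using that by (simp add: D_def)
  have ybound: "\<bar>y (Suc n) t\<bar> \<le> \<Lambda> * (D T * (\<Lambda> * T) ^ n) * ((t - t0) ^ Suc n / fact (Suc n))"
    if xb: "\<And>t. t \<in> {t0..t0 + T} \<Longrightarrow> \<bar>x n t\<bar> \<le> D T * (\<Lambda> * T) ^ n * ((t - t0) ^ n / fact n)"
      and t: "t \<in> {t0..t0 + T}" for n T t
  proof -
    have "norm (y (Suc n) t) \<le> integral {t0..t} (\<lambda>s. \<Lambda> * (D T * (\<Lambda> * T) ^ n) * ((s - t0) ^ n / fact n))"
      unfolding yS
    proof (rule integral_norm_bound_integral)
      show "(\<lambda>s. - c s * x n s) integrable_on {t0..t}"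
        by (rule integrable_continuous_interval)
          (use cont[of n] c in \<open>auto intro!: continuous_intros intro: continuous_on_subset\<close>)
      show "(\<lambda>s. \<Lambda> * (D T * (\<Lambda> * T) ^ n) * ((s - t0) ^ n / fact n)) integrable_on {t0..t}"
        using int(2) t by simp
      show "norm (- c s * x n s) \<le> \<Lambda> * (D T * (\<Lambda> * T) ^ n) * ((s - t0) ^ n / fact n)" if "s \<in> {t0..t}" for s
      proof -
        have "norm (- c s * x n s) \<le> \<Lambda> * (D T * (\<Lambda> * T) ^ n * ((s - t0) ^ n / fact n))"
          using cb[of s] xb[of s] that t \<Lambda>0 unfolding real_norm_def abs_mult
          by (intro mult_mono) auto
        then show ?thesis by (simp add: mult.assoc)
      qed
    qed
    then show ?thesis using int(1) t by simp
  qed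
  have xbound: "\<bar>x n t\<bar> \<le> D T * (\<Lambda> * T) ^ n * ((t - t0) ^ n / fact n)"
    if T: "T \<ge> 1" and t: "t \<in> {t0..t0 + T}" for n t T
    using t
  proof (induction n arbitrary: t)
    case 0
    have "\<bar>\<alpha> + \<beta> * (t - t0)\<bar> \<le> \<bar>\<alpha>\<bar> + \<bar>\<beta> * (t - t0)\<bar>" by (rule abs_triangle_ineq)
    also have "\<bar>\<beta> * (t - t0)\<bar> \<le> \<bar>\<beta>\<bar> * T"
      using 0 by (auto simp: abs_mult intro!: mult_left_mono)
    finally show ?case by (simp add: x0 D_def)
  next
    case (Suc n)
    define B where "B = \<Lambda> * (D T * (\<Lambda> * T) ^ n) * ((t - t0) ^ Suc n / fact (Suc n))"
    have K0: "0 \<le> \<Lambda> * (D T * (\<Lambda> * T) ^ n)" using \<Lambda>0 D0[OF T] T by simp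
    have B0: "0 \<le> B" unfolding B_def by (rule mult_nonneg_nonneg[OF K0]) (use Suc.prems in auto)
    have "norm (x (Suc n) t) \<le> integral {t0..t} (\<lambda>s. B)"
      unfolding xS
    proof (rule integral_norm_bound_integral)
      show "y (Suc n) integrable_on {t0..t}"
        by (rule integrable_continuous_interval)
          (use cont[of "Suc n"] in \<open>auto intro: continuous_on_subset\<close>)
      show "norm (y (Suc n) s) \<le> B" if s: "s \<in> {t0..t}" for s
      proof -
        have "norm (y (Suc n) s) \<le> \<Lambda> * (D T * (\<Lambda> * T) ^ n) * ((s - t0) ^ Suc n / fact (Suc n))"
          using ybound[OF Suc.IH, of s] s Suc.prems by auto
        also have "\<dots> \<le> B"
          unfolding B_def
          by (rule mult_left_mono[OF _ K0]) (use s in \<open>auto intro!: divide_right_mono power_mono simp del: power_Suc\<close>)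
        finally show ?thesis .
      qed
    qed (rule integrable_const_ivl)
    also have "\<dots> = (t - t0) * B" using Suc.prems by simp
    also have "\<dots> \<le> T * B" using Suc.prems B0 by (intro mult_right_mono) auto
    also have "\<dots> = D T * (\<Lambda> * T) ^ Suc n * ((t - t0) ^ Suc n / fact (Suc n))"
      by (simp add: B_def algebra_simps)
    finally show ?case by simp
  qed
  have E: "summable (\<lambda>n. C * (\<bar>z\<bar> ^ n * (D T * ((\<Lambda> * T * T) ^ n / fact n))))" for C z T
  proof -
    have "summable (\<lambda>n. (C * D T) * ((\<bar>z\<bar> * (\<Lambda> * T * T)) ^ n / fact n))"
      by (intro summable_mult) (use summable_exp[of "\<bar>z\<bar> * (\<Lambda> * T * T)"] in \<open>simp add: field_simps\<close>)
    then show ?thesis by (simp add: power_mult_distrib algebra_simps)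
  qed
  have pw: "(t - t0) ^ n \<le> T ^ n" if "t \<in> {t0..t0 + T}" for t T n
    using that by (intro power_mono) auto
  have xB: "\<bar>x n t\<bar> \<le> D T * ((\<Lambda> * T * T) ^ n / fact n)" if T: "T \<ge> 1" and t: "t \<in> {t0..t0 + T}" for n t T
  proof -
    have "\<bar>x n t\<bar> \<le> D T * (\<Lambda> * T) ^ n * ((t - t0) ^ n / fact n)" by (rule xbound[OF T t])
    also have "\<dots> \<le> D T * (\<Lambda> * T) ^ n * (T ^ n / fact n)"
      using pw[OF t] D0[OF T] \<Lambda>0 T by (intro mult_left_mono divide_right_mono) auto
    finally show ?thesis by (simp add: power_mult_distrib)
  qed
  have yB: "\<bar>y n t\<bar> \<le> D T * ((\<Lambda> * T * T) ^ n / fact n)" if T: "T \<ge> 1" and t: "t \<in> {t0..t0 + T}" for n t T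
  proof (cases n)
    case 0
    have "\<bar>\<beta>\<bar> * 1 \<le> \<bar>\<beta>\<bar> * T" using T by (intro mult_left_mono) auto
    then show ?thesis using 0 by (simp add: y0 D_def)
  next
    case (Suc m)
    have "\<bar>y n t\<bar> \<le> \<Lambda> * (D T * (\<Lambda> * T) ^ m) * ((t - t0) ^ Suc m / fact (Suc m))"
      unfolding Suc by (rule ybound[OF xbound[OF T] t])
    also have "\<dots> \<le> \<Lambda> * (D T * (\<Lambda> * T) ^ m) * (T ^ Suc m / fact (Suc m))"
      using pw[OF t] D0[OF T] \<Lambda>0 T by (intro mult_left_mono divide_right_mono) (auto simp del: power_Suc)
    also have "\<dots> \<le> T * (\<Lambda> * (D T * (\<Lambda> * T) ^ m) * (T ^ Suc m / fact (Suc m)))"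
    proof -
      have "0 \<le> \<Lambda> * (D T * (\<Lambda> * T) ^ m) * (T ^ Suc m / fact (Suc m))"
        using D0[OF T] \<Lambda>0 T by simp
      from mult_right_mono[OF T this] show ?thesis by simp
    qed
    also have "\<dots> = D T * ((\<Lambda> * T * T) ^ n / fact n)"
      unfolding Suc by (simp add: power_mult_distrib algebra_simps)
    finally show ?thesis .
  qed
  have zb: "\<bar>p * z ^ n\<bar> \<le> 1 * (\<bar>z\<bar> ^ n * K)" if "\<bar>p\<bar> \<le> K" for p z K :: real and n
    using mult_right_mono[OF that, of "\<bar>z\<bar> ^ n"] by (simp add: abs_mult power_abs mult.commute)
  have xsum: "summable (\<lambda>n. x n t * z ^ n)" if "t \<ge> t0" for t z
  proof (rule summable_comparison_test'[OF E[of 1 z "t - t0 + 1"]])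
    show "norm (x n t * z ^ n) \<le> 1 * (\<bar>z\<bar> ^ n * (D (t - t0 + 1) * ((\<Lambda> * (t - t0 + 1) * (t - t0 + 1)) ^ n / fact n)))" for n
      unfolding real_norm_def by (intro zb xB) (use that in auto)
  qed
  have ysum: "summable (\<lambda>n. y n t * z ^ n)" if "t \<ge> t0" for t z
  proof (rule summable_comparison_test'[OF E[of 1 z "t - t0 + 1"]])
    show "norm (y n t * z ^ n) \<le> 1 * (\<bar>z\<bar> ^ n * (D (t - t0 + 1) * ((\<Lambda> * (t - t0 + 1) * (t - t0 + 1)) ^ n / fact n)))" for n
      unfolding real_norm_def by (intro zb yB) (use that in auto)
  qed
  define X where "X z t = (\<Sum>n. x n t * z ^ n)" for z t
  define Y where "Y z t = (\<Sum>n. y n t * z ^ n)" for z t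
  have dX: "(X z has_real_derivative Y z t) (at t within {t0..})" if t: "t \<ge> t0" for z t
    unfolding X_def Y_def
  proof (rule series_has_real_derivative[OF _ xsum _ t])
    show "((\<lambda>t. x n t * z ^ n) has_real_derivative y n t * z ^ n) (at t within {t0..})" if "t \<ge> t0" for n t
      using DERIV_cmult_right[OF dx[OF that]] .
    show "\<exists>M. summable M \<and> (\<forall>n. \<forall>t\<in>{t0..t0 + T}. \<bar>y n t * z ^ n\<bar> \<le> M n)" if "T \<ge> 1" for T
      by (rule exI[of _ "\<lambda>n. 1 * (\<bar>z\<bar> ^ n * (D T * ((\<Lambda> * T * T) ^ n / fact n)))"])
        (use E[of 1 z T] yB[OF that] zb in blast)
  qed simp
  \<comment> \<open>Differentiating the series for \<open>Y\<close> shifts the index by one, which produces the factor \<open>z\<close>.\<close>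
  have dY: "(Y z has_real_derivative - c t * z * X z t) (at t within {t0..})" if t: "t \<ge> t0" for z t
  proof -
    define f' where "f' n s = (case n of 0 \<Rightarrow> 0 | Suc m \<Rightarrow> (- c s * x m s) * z ^ Suc m)" for n s
    have "((\<lambda>t. \<Sum>n. y n t * z ^ n) has_real_derivative (\<Sum>n. f' n t)) (at t within {t0..})"
    proof (rule series_has_real_derivative[OF _ ysum _ t])
      show "((\<lambda>t. y n t * z ^ n) has_real_derivative f' n t) (at t within {t0..})" if "t \<ge> t0" for n t
      proof (cases n)
        case 0 then show ?thesis by (simp add: y0 f'_def)
      next
        case (Suc m)
        show ?thesis using DERIV_cmult_right[OF dy[OF that, of m], of "z ^ Suc m"]
          by (simp add: Suc f'_def)
      qed
      show "\<exists>M. summable M \<and> (\<forall>n. \<forall>t\<in>{t0..t0 + T}. \<bar>f' n t\<bar> \<le> M n)" if T: "T \<ge> 1" for T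
      proof (intro exI conjI)
        define M where "M n = (case n of 0 \<Rightarrow> 0 | Suc m \<Rightarrow>
          (\<Lambda> * \<bar>z\<bar>) * (\<bar>z\<bar> ^ m * (D T * ((\<Lambda> * T * T) ^ m / fact m))))" for n
        have "summable (\<lambda>n. M (Suc n))" unfolding M_def using E[of "\<Lambda> * \<bar>z\<bar>" z T] by simp
        then show "summable M" by (simp only: summable_Suc_iff)
        show "\<forall>n. \<forall>t\<in>{t0..t0 + T}. \<bar>f' n t\<bar> \<le> M n"
        proof (intro allI ballI)
          fix n s assume s: "s \<in> {t0..t0 + T}"
          show "\<bar>f' n s\<bar> \<le> M n"
          proof (cases n)
            case 0 then show ?thesis by (simp add: f'_def M_def)
          next
            case (Suc m)
            have "\<bar>f' n s\<bar> = (\<bar>c s\<bar> * \<bar>x m s\<bar>) * \<bar>z\<bar> ^ Suc m"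
              by (simp add: Suc f'_def abs_mult power_abs)
            also have "\<dots> \<le> (\<Lambda> * (D T * ((\<Lambda> * T * T) ^ m / fact m))) * \<bar>z\<bar> ^ Suc m"
              using cb[of s] xB[OF T s, of m] s \<Lambda>0 by (intro mult_right_mono mult_mono) auto
            also have "\<dots> = M n" by (simp add: Suc M_def algebra_simps)
            finally show ?thesis .
          qed
        qed
      qed
    qed simp
    moreover have "(\<Sum>n. f' n t) = - c t * z * X z t"
    proof -
      have "(\<lambda>n. (- c t * z) * (x n t * z ^ n)) sums ((- c t * z) * X z t)"
        unfolding X_def by (intro sums_mult summable_sums xsum t)
      then have "(\<lambda>n. f' (Suc n) t) sums (- c t * z * X z t)"
        by (simp add: f'_def algebra_simps)
      then have "(\<lambda>n. f' n t) sums (- c t * z * X z t + f' 0 t)"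
        by (rule sums_Suc_iff[THEN iffD1])
      then show ?thesis by (simp add: f'_def sums_iff)
    qed
    ultimately show ?thesis unfolding Y_def by simp
  qed
  show ?thesis
  proof
    show "X z t0 = \<alpha>" for z
    proof -
      have "x (Suc n) t0 = 0" for n by (simp add: xS)
      then have "(\<lambda>n. x n t0 * z ^ n) sums (x 0 t0 * z ^ 0)"
        using sums_finite[of "{0}" "\<lambda>n. x n t0 * z ^ n"] by (auto simp: gr0_conv_Suc)
      then show ?thesis unfolding X_def x0 using sums_unique by fastforce
    qed
    show "Y z t0 = \<beta>" for z
    proof -
      have "y (Suc n) t0 = 0" for n by (simp add: yS)
      then have "(\<lambda>n. y n t0 * z ^ n) sums (y 0 t0 * z ^ 0)"
        using sums_finite[of "{0}" "\<lambda>n. y n t0 * z ^ n"] by (auto simp: gr0_conv_Suc)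
      then show ?thesis unfolding Y_def y0 using sums_unique by fastforce
    qed
    show "isCont (\<lambda>z. X z t) z" if "t \<ge> t0" for z t
      unfolding X_def by (rule isCont_powser_converges_everywhere) (rule xsum[OF that])
    show "isCont (\<lambda>z. Y z t) z" if "t \<ge> t0" for z t
      unfolding Y_def by (rule isCont_powser_converges_everywhere) (rule ysum[OF that])
  qed (use dX dY in auto)
qed

text \<open>The derivative of the energy is \<open>c' z w\<^sup>2\<close>, hence at most \<open>(\<bar>c'\<bar> / c) * E\<close> in absolute value: the parameter \<open>z\<close>
cancels. This uniformity in the frequency allows frequencies to be chosen after the loss has been estimated.\<close>

lemma oscillator_energy_bounds:
  fixes w v c c' \<Gamma> g :: "real \<Rightarrow> real"
  assumes st: "s \<le> t" and L: "0 < L" and z: "0 \<le> z"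
    and dw: "\<And>r. r \<in> {s..t} \<Longrightarrow> (w has_real_derivative v r) (at r within {s..t})"
    and dv: "\<And>r. r \<in> {s..t} \<Longrightarrow> (v has_real_derivative - c r * z * w r) (at r within {s..t})"
    and dc: "\<And>r. r \<in> {s..t} \<Longrightarrow> (c has_real_derivative c' r) (at r within {s..t})"
    and d\<Gamma>: "\<And>r. r \<in> {s..t} \<Longrightarrow> (\<Gamma> has_real_derivative g r) (at r within {s..t})"
    and cL: "\<And>r. r \<in> {s..t} \<Longrightarrow> L \<le> c r"
    and c'g: "\<And>r. r \<in> {s..t} \<Longrightarrow> \<bar>c' r\<bar> \<le> L * g r"
  defines "E \<equiv> \<lambda>r. (v r)\<^sup>2 + c r * z * (w r)\<^sup>2"
  shows "E t \<le> E s * exp (\<Gamma> t - \<Gamma> s)" and "E s \<le> E t * exp (\<Gamma> t - \<Gamma> s)"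
proof -
  have dE: "(E has_real_derivative c' r * z * (w r)\<^sup>2) (at r within {s..t})" if "r \<in> {s..t}" for r
    unfolding E_def
    by (rule derivative_eq_intros dw dv dc that refl)+ (simp add: power2_eq_square algebra_simps)
  \<comment> \<open>Used with \<open>k = -1\<close> for the upper and with \<open>k = 1\<close> for the lower bound.\<close>
  have d: "((\<lambda>r. E r * exp (k * \<Gamma> r)) has_real_derivative
      (c' r * z * (w r)\<^sup>2 + k * g r * E r) * exp (k * \<Gamma> r)) (at r within {s..t})"
    if "r \<in> {s..t}" for r k
    by (rule derivative_eq_intros dE d\<Gamma> that refl)+ (simp add: algebra_simps)
  have le: "\<bar>c' r * z * (w r)\<^sup>2\<bar> \<le> g r * E r" if r: "r \<in> {s..t}" for r
  proof -
    have g0: "0 \<le> g r" using c'g[OF r] L by (metis abs_ge_zero order_trans zero_le_mult_iff not_less)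
    have zw: "0 \<le> z * (w r)\<^sup>2" using z by simp
    have "\<bar>c' r * z * (w r)\<^sup>2\<bar> = \<bar>c' r\<bar> * (z * (w r)\<^sup>2)"
      using z by (simp add: abs_mult)
    also have "\<dots> \<le> (L * g r) * (z * (w r)\<^sup>2)" by (rule mult_right_mono[OF c'g[OF r] zw])
    also have "\<dots> = g r * (L * (z * (w r)\<^sup>2))" by simp
    also have "\<dots> \<le> g r * (c r * (z * (w r)\<^sup>2))"
      by (intro mult_left_mono mult_right_mono cL r zw g0)
    also have "\<dots> \<le> g r * E r"
      unfolding E_def by (intro mult_left_mono g0) simp
    finally show ?thesis .
  qed
  have cont: "continuous_on {s..t} (\<lambda>r. E r * exp (k * \<Gamma> r))" for k
    by (rule DERIV_continuous_on) (rule d)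
  have D: "DERIV (\<lambda>r. E r * exp (k * \<Gamma> r)) r :> (c' r * z * (w r)\<^sup>2 + k * g r * E r) * exp (k * \<Gamma> r)"
    if "s < r" "r < t" for r k
    using d[of r k] that by (simp add: at_within_Icc_at)
  have "E t * exp (-1 * \<Gamma> t) \<le> E s * exp (-1 * \<Gamma> s)"
  proof (rule DERIV_nonpos_imp_decreasing_open[OF st _ cont])
    fix r assume r: "s < r" "r < t"
    then have "(c' r * z * (w r)\<^sup>2 + (-1) * g r * E r) * exp (-1 * \<Gamma> r) \<le> 0"
      using le[of r] by (intro mult_nonpos_nonneg) auto
    with D[OF r, of "-1"] show "\<exists>y. DERIV (\<lambda>r. E r * exp (-1 * \<Gamma> r)) r :> y \<and> y \<le> 0" by blast
  qed
  from mult_right_mono[OF this, of "exp (\<Gamma> t)"]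
  have "E t * (exp (- \<Gamma> t) * exp (\<Gamma> t)) \<le> E s * (exp (- \<Gamma> s) * exp (\<Gamma> t))" by (simp add: mult.assoc)
  then show "E t \<le> E s * exp (\<Gamma> t - \<Gamma> s)" unfolding exp_add[symmetric] by simp
  have "E s * exp (1 * \<Gamma> s) \<le> E t * exp (1 * \<Gamma> t)"
  proof (rule DERIV_nonneg_imp_increasing_open[OF st _ cont])
    fix r assume r: "s < r" "r < t"
    then have "(c' r * z * (w r)\<^sup>2 + 1 * g r * E r) * exp (1 * \<Gamma> r) \<ge> 0"
      using le[of r] by (intro mult_nonneg_nonneg) auto
    with D[OF r, of "1"] show "\<exists>y. DERIV (\<lambda>r. E r * exp (1 * \<Gamma> r)) r :> y \<and> y \<ge> 0" by blast
  qed
  from mult_right_mono[OF this, of "exp (- \<Gamma> s)"]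
  have "E s * (exp (\<Gamma> s) * exp (- \<Gamma> s)) \<le> E t * (exp (\<Gamma> t) * exp (- \<Gamma> s))" by (simp add: mult.assoc)
  then show "E s \<le> E t * exp (\<Gamma> t - \<Gamma> s)" unfolding exp_add[symmetric] by simp
qed

section \<open>An explicit resonance on one interval\<close>

text \<open>A function with its first three derivatives, all four bounded by the same function \<open>B\<close> and all vanishing on \<open>Z\<close>.
The derivatives are carried along explicitly because all of them appear in the resonant speed.\<close>

definition C3_dominated :: "real \<Rightarrow> real set \<Rightarrow> (real \<Rightarrow> real) \<Rightarrow> (real \<Rightarrow> real) \<Rightarrow>
    (real \<Rightarrow> real) \<Rightarrow> (real \<Rightarrow> real) \<Rightarrow> (real \<Rightarrow> real) \<Rightarrow> bool" where
  "C3_dominated t0 Z B f f1 f2 f3 \<longleftrightarrow>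
    (\<forall>t\<ge>t0. (f has_real_derivative f1 t) (at t within {t0..}) \<and>
      (f1 has_real_derivative f2 t) (at t within {t0..}) \<and>
      (f2 has_real_derivative f3 t) (at t within {t0..}) \<and>
      \<bar>f t\<bar> \<le> B t \<and> \<bar>f1 t\<bar> \<le> B t \<and> \<bar>f2 t\<bar> \<le> B t \<and> \<bar>f3 t\<bar> \<le> B t) \<and>
    continuous_on {t0..} f3 \<and>
    (\<forall>t\<in>Z. f t = 0 \<and> f1 t = 0 \<and> f2 t = 0 \<and> f3 t = 0)"

lemma abs_add_le: "\<bar>x\<bar> \<le> X \<Longrightarrow> \<bar>y\<bar> \<le> Y \<Longrightarrow> \<bar>x + y\<bar> \<le> X + Y" for x :: real
  by linarith

lemma abs_diff_le: "\<bar>x\<bar> \<le> X \<Longrightarrow> \<bar>y\<bar> \<le> Y \<Longrightarrow> \<bar>x - y\<bar> \<le> X + Y" for x :: real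
  by linarith

lemma abs_mult_le: "\<bar>x\<bar> \<le> X \<Longrightarrow> \<bar>y\<bar> \<le> Y \<Longrightarrow> \<bar>x * y\<bar> \<le> X * Y" for x :: real
  unfolding abs_mult by (intro mult_mono) auto

lemma abs_power2_le: "\<bar>x\<bar> \<le> X \<Longrightarrow> \<bar>x\<^sup>2\<bar> \<le> X\<^sup>2" for x :: real
  unfolding power_abs by (intro power_mono) auto

lemmas abs_bounds = abs_add_le abs_diff_le abs_mult_le abs_power2_le

text \<open>By the Leibniz rule; \<open>8 = 1 + 3 + 3 + 1\<close> is the number of terms in the third derivative.\<close>

lemma C3_dominated_mult:
  assumes f: "C3_dominated t0 Z B f f1 f2 f3" and g: "C3_dominated t0 Z' B' g g1 g2 g3"
  shows "\<exists>h1 h2 h3. C3_dominated t0 (Z \<union> Z') (\<lambda>t. 8 * (B t * B' t)) (\<lambda>t. f t * g t) h1 h2 h3"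
proof (intro exI)
  have df: "(f has_real_derivative f1 t) (at t within {t0..})"
      "(f1 has_real_derivative f2 t) (at t within {t0..})"
      "(f2 has_real_derivative f3 t) (at t within {t0..})"
    and bf: "\<bar>f t\<bar> \<le> B t" "\<bar>f1 t\<bar> \<le> B t" "\<bar>f2 t\<bar> \<le> B t" "\<bar>f3 t\<bar> \<le> B t"
    and dg: "(g has_real_derivative g1 t) (at t within {t0..})"
      "(g1 has_real_derivative g2 t) (at t within {t0..})"
      "(g2 has_real_derivative g3 t) (at t within {t0..})"
    and bg: "\<bar>g t\<bar> \<le> B' t" "\<bar>g1 t\<bar> \<le> B' t" "\<bar>g2 t\<bar> \<le> B' t" "\<bar>g3 t\<bar> \<le> B' t"
    if "t \<ge> t0" for t
    using f g that unfolding C3_dominated_def by blast+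
  have cont: "continuous_on {t0..} f" "continuous_on {t0..} f1" "continuous_on {t0..} f2"
    "continuous_on {t0..} g" "continuous_on {t0..} g1" "continuous_on {t0..} g2"
    by (rule DERIV_continuous_on, rule df dg, simp)+
  have cont3: "continuous_on {t0..} f3" "continuous_on {t0..} g3"
    using f g unfolding C3_dominated_def by blast+
  show "C3_dominated t0 (Z \<union> Z') (\<lambda>t. 8 * (B t * B' t)) (\<lambda>t. f t * g t)
    (\<lambda>t. f1 t * g t + f t * g1 t)
    (\<lambda>t. f2 t * g t + 2 * (f1 t * g1 t) + f t * g2 t)
    (\<lambda>t. f3 t * g t + 3 * (f2 t * g1 t) + 3 * (f1 t * g2 t) + f t * g3 t)"
    unfolding C3_dominated_def
  proof (intro conjI allI impI ballI)
    fix t assume t: "t \<ge> t0"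
    note d = df[OF t] dg[OF t]
    note b = bf[OF t] bg[OF t]
    show "((\<lambda>t. f t * g t) has_real_derivative f1 t * g t + f t * g1 t) (at t within {t0..})"
      by (rule derivative_eq_intros d refl)+ (simp add: algebra_simps)
    show "((\<lambda>t. f1 t * g t + f t * g1 t) has_real_derivative
        f2 t * g t + 2 * (f1 t * g1 t) + f t * g2 t) (at t within {t0..})"
      by (rule derivative_eq_intros d refl)+ (simp add: algebra_simps)
    show "((\<lambda>t. f2 t * g t + 2 * (f1 t * g1 t) + f t * g2 t) has_real_derivative
        f3 t * g t + 3 * (f2 t * g1 t) + 3 * (f1 t * g2 t) + f t * g3 t) (at t within {t0..})"
      by (rule derivative_eq_intros d refl)+ (simp add: algebra_simps)
    have P: "0 \<le> B t * B' t" using b by (intro mult_nonneg_nonneg) linarith+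
    have "\<bar>f t * g t\<bar> \<le> B t * B' t" by (intro abs_bounds b)
    then show "\<bar>f t * g t\<bar> \<le> 8 * (B t * B' t)" using P by linarith
    have "\<bar>f1 t * g t + f t * g1 t\<bar> \<le> B t * B' t + B t * B' t" by (intro abs_bounds b)
    then show "\<bar>f1 t * g t + f t * g1 t\<bar> \<le> 8 * (B t * B' t)" using P by linarith
    have "\<bar>f2 t * g t + 2 * (f1 t * g1 t) + f t * g2 t\<bar> \<le> B t * B' t + 2 * (B t * B' t) + B t * B' t"
      by (intro abs_bounds b) auto
    then show "\<bar>f2 t * g t + 2 * (f1 t * g1 t) + f t * g2 t\<bar> \<le> 8 * (B t * B' t)" using P by linarith
    have "\<bar>f3 t * g t + 3 * (f2 t * g1 t) + 3 * (f1 t * g2 t) + f t * g3 t\<bar>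
        \<le> B t * B' t + 3 * (B t * B' t) + 3 * (B t * B' t) + B t * B' t"
      by (intro abs_bounds b) auto
    then show "\<bar>f3 t * g t + 3 * (f2 t * g1 t) + 3 * (f1 t * g2 t) + f t * g3 t\<bar> \<le> 8 * (B t * B' t)"
      by simp
  next
    show "continuous_on {t0..} (\<lambda>t. f3 t * g t + 3 * (f2 t * g1 t) + 3 * (f1 t * g2 t) + f t * g3 t)"
      by (intro continuous_intros cont cont3)
  next
    fix t assume "t \<in> Z \<union> Z'"
    then consider "f t = 0 \<and> f1 t = 0 \<and> f2 t = 0 \<and> f3 t = 0" | "g t = 0 \<and> g1 t = 0 \<and> g2 t = 0 \<and> g3 t = 0"
      using f g unfolding C3_dominated_def by blast
    then show "f t * g t = 0" "f1 t * g t + f t * g1 t = 0"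
      "f2 t * g t + 2 * (f1 t * g1 t) + f t * g2 t = 0"
      "f3 t * g t + 3 * (f2 t * g1 t) + 3 * (f1 t * g2 t) + f t * g3 t = 0"
      by (cases; simp)+
  qed
qed

lemma DERIV_zero_extension:
  fixes q q' :: "real \<Rightarrow> real"
  assumes d: "\<And>x. DERIV q x :> q' x" and 0: "q 0 = 0" "q' 0 = 0"
  shows "DERIV (\<lambda>x. if x \<le> 0 then 0 else q x) x :> (if x \<le> 0 then 0 else q' x)"
proof -
  consider "x < 0" | "x = 0" | "x > 0" by linarith
  then show ?thesis
  proof cases
    case 1
    have "DERIV (\<lambda>x. 0::real) x :> 0" by simp
    then have "DERIV (\<lambda>x. if x \<le> 0 then 0 else q x) x :> 0"
      by (rule has_field_derivative_transform_within_open[where S = "{..<0}"]) (use 1 in auto)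
    with 1 show ?thesis by simp
  next
    case 3
    have "DERIV (\<lambda>x. if x \<le> 0 then 0 else q x) x :> q' x"
      by (rule has_field_derivative_transform_within_open[OF d, where S = "{0<..}"]) (use 3 in auto)
    with 3 show ?thesis by simp
  next
    case 2
    have "((\<lambda>y. (q y - q 0) / (y - 0)) \<longlongrightarrow> 0) (at 0)"
      using d[of 0] 0 unfolding has_field_derivative_iff by simp
    then have "((\<lambda>y. ((if y \<le> 0 then 0 else q y) - 0) / (y - 0)) \<longlongrightarrow> 0) (at 0)"
      by (rule Lim_null_comparison[OF _ tendsto_norm_zero, rotated])
        (rule always_eventually, auto simp: 0 divide_nonneg_nonpos)
    then show ?thesis using 2 unfolding has_field_derivative_iff by simp
  qed
qed

text \<open>A \<open>C\<^sup>3\<close> step from \<open>0\<close> to \<open>1\<close>: the fourth power makes three derivatives vanish at the origin, and the exponential keeps all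
derivatives bounded. It never reaches \<open>1\<close>, which is harmless, since only a positive lower bound away from the
origin is needed.\<close>

definition soft_step :: "real \<Rightarrow> real" where
  "soft_step x = (if x \<le> 0 then 0 else (1 - exp (- x)) ^ 4)"

lemma soft_step_jet:
  obtains s1 s2 s3 where
    "\<And>x. DERIV soft_step x :> s1 x" "\<And>x. DERIV s1 x :> s2 x" "\<And>x. DERIV s2 x :> s3 x"
    "continuous_on UNIV s3"
    "\<And>x. \<bar>soft_step x\<bar> \<le> 64" "\<And>x. \<bar>s1 x\<bar> \<le> 64" "\<And>x. \<bar>s2 x\<bar> \<le> 64" "\<And>x. \<bar>s3 x\<bar> \<le> 64"
    "\<And>x. x \<le> 0 \<Longrightarrow> s1 x = 0 \<and> s2 x = 0 \<and> s3 x = 0"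
proof -
  define q where "q x = (1 - exp (- x)) ^ 4" for x :: real
  define q1 where "q1 x = 4 * (1 - exp (- x)) ^ 3 * exp (- x)" for x :: real
  define q2 where "q2 x = 12 * (1 - exp (- x))\<^sup>2 * (exp (- x))\<^sup>2 - 4 * (1 - exp (- x)) ^ 3 * exp (- x)" for x :: real
  define q3 where "q3 x = 24 * (1 - exp (- x)) * exp (- x) ^ 3 - 36 * (1 - exp (- x))\<^sup>2 * (exp (- x))\<^sup>2
    + 4 * (1 - exp (- x)) ^ 3 * exp (- x)" for x :: real
  let ?e = "\<lambda>f x. if x \<le> 0 then 0 else (f x :: real)"
  have eq: "soft_step = ?e q" by (auto simp: soft_step_def q_def)
  have d0: "DERIV q x :> q1 x" for x
    unfolding q_def q1_def by (rule derivative_eq_intros refl)+ (simp add: numeral_eq_Suc)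
  have d1: "DERIV q1 x :> q2 x" for x
    unfolding q1_def q2_def by (rule derivative_eq_intros refl)+ (simp add: numeral_eq_Suc algebra_simps)
  have d2: "DERIV q2 x :> q3 x" for x
    unfolding q2_def q3_def by (rule derivative_eq_intros refl)+ (simp add: numeral_eq_Suc algebra_simps)
  have cq3: "continuous_on A q3" for A unfolding q3_def by (intro continuous_intros)
  have q30: "q3 0 = 0" by (simp add: q3_def)
  have y: "\<bar>1 - exp (- x)\<bar> \<le> 1" "\<bar>exp (- x)\<bar> \<le> 1" if "x > 0" for x :: real
    using that by auto
  have p3: "\<bar>u\<bar> \<le> 1 \<Longrightarrow> \<bar>u ^ n\<bar> \<le> 1" for u :: real and n by (simp add: power_abs power_le_one)
  have b0: "\<bar>q x\<bar> \<le> 64" if "x > 0" for x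
    using p3[OF y(1)[OF that], of 4] unfolding q_def by linarith
  have b1: "\<bar>q1 x\<bar> \<le> 64" if "x > 0" for x
  proof -
    have "\<bar>q1 x\<bar> \<le> 4 * 1 * 1" unfolding q1_def by (intro abs_bounds p3 y that) auto
    then show ?thesis by simp
  qed
  have b2: "\<bar>q2 x\<bar> \<le> 64" if "x > 0" for x
  proof -
    have "\<bar>q2 x\<bar> \<le> 12 * 1\<^sup>2 * 1\<^sup>2 + 4 * 1 * 1" unfolding q2_def by (intro abs_bounds p3 y that) auto
    then show ?thesis by simp
  qed
  have b3: "\<bar>q3 x\<bar> \<le> 64" if "x > 0" for x
  proof -
    have "\<bar>q3 x\<bar> \<le> 24 * 1 * 1 + 36 * 1\<^sup>2 * 1\<^sup>2 + 4 * 1 * 1"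
      unfolding q3_def by (intro abs_bounds p3 y that) auto
    then show ?thesis by simp
  qed
  show ?thesis
  proof (rule that[of "?e q1" "?e q2" "?e q3"])
    show "DERIV soft_step x :> ?e q1 x" for x
      unfolding eq by (rule DERIV_zero_extension[OF d0]) (auto simp: q_def q1_def)
    show "DERIV (?e q1) x :> ?e q2 x" for x
      by (rule DERIV_zero_extension[OF d1]) (auto simp: q1_def q2_def)
    show "DERIV (?e q2) x :> ?e q3 x" for x
      by (rule DERIV_zero_extension[OF d2]) (auto simp: q2_def q3_def)
    show "continuous_on UNIV (?e q3)"
    proof -
      have "continuous_on ({..0} \<union> {0..}) (?e q3)"
        by (rule continuous_on_If) (auto intro: cq3 simp: q30)
      moreover have "{..0} \<union> {0..} = (UNIV :: real set)" by auto
      ultimately show ?thesis by simp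
    qed
    show "\<bar>soft_step x\<bar> \<le> 64" for x unfolding eq using b0[of x] by auto
    show "\<bar>?e q1 x\<bar> \<le> 64" for x using b1[of x] by auto
    show "\<bar>?e q2 x\<bar> \<le> 64" for x using b2[of x] by auto
    show "\<bar>?e q3 x\<bar> \<le> 64" for x using b3[of x] by auto
  qed auto
qed

lemma soft_step_zero: "x \<le> 0 \<Longrightarrow> soft_step x = 0"
  by (simp add: soft_step_def)

lemma soft_step_nonneg: "0 \<le> soft_step x"
  by (simp add: soft_step_def)

lemma soft_step_mono: "x \<le> y \<Longrightarrow> soft_step x \<le> soft_step y"
  by (auto simp: soft_step_def intro!: power_mono)

lemma soft_step_pos: "0 < x \<Longrightarrow> 0 < soft_step x"
  by (simp add: soft_step_def)

text \<open>The constant is \<open>8 * (8 * 64 * 64) * 8 = 2\<^sup>2\<^sup>1\<close>: three products, and the bound \<open>64\<close> for each of the two steps.\<close>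

lemma cutoff_profile:
  assumes \<gamma>: "C3_dominated t0 {} (\<lambda>t. L * \<gamma> t) \<gamma> \<gamma>1 \<gamma>2 \<gamma>3"
  shows "\<exists>f1 f2 f3. C3_dominated t0 ({..a} \<union> {b..}) (\<lambda>t. 2 ^ 21 * L\<^sup>2 * (\<gamma> t)\<^sup>2)
    (\<lambda>t. soft_step (t - a) * soft_step (b - t) * (\<gamma> t)\<^sup>2) f1 f2 f3"
proof -
  obtain s1 s2 s3 where s: "\<And>x. DERIV soft_step x :> s1 x" "\<And>x. DERIV s1 x :> s2 x" "\<And>x. DERIV s2 x :> s3 x"
    "continuous_on UNIV s3"
    "\<And>x. \<bar>soft_step x\<bar> \<le> 64" "\<And>x. \<bar>s1 x\<bar> \<le> 64" "\<And>x. \<bar>s2 x\<bar> \<le> 64" "\<And>x. \<bar>s3 x\<bar> \<le> 64"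
    "\<And>x. x \<le> 0 \<Longrightarrow> s1 x = 0 \<and> s2 x = 0 \<and> s3 x = 0"
    by (rule soft_step_jet, rule that)
  have up: "C3_dominated t0 {..a} (\<lambda>t. 64) (\<lambda>t. soft_step (t - a)) (\<lambda>t. s1 (t - a))
      (\<lambda>t. s2 (t - a)) (\<lambda>t. s3 (t - a))"
  proof -
    have sh: "((\<lambda>t. f (t - a)) has_real_derivative f' (t - a)) (at t within A)"
      if "\<And>x. DERIV f x :> f' x" for f f' :: "real \<Rightarrow> real" and t A
    proof -
      have "((\<lambda>t. t - a) has_real_derivative 1) (at t within A)" by (auto intro!: derivative_eq_intros)
      from DERIV_chain2[where f = f and g = "\<lambda>t. t - a", OF that this] show ?thesis by simp
    qed
    have "continuous_on {t0..} (\<lambda>t. s3 (t - a))"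
      by (rule continuous_on_compose2[OF s(4)]) (auto intro!: continuous_intros)
    then show ?thesis
      unfolding C3_dominated_def
      by (intro conjI allI impI ballI sh s(1-3)) (simp_all add: s(5-9) soft_step_zero)
  qed
  have down: "C3_dominated t0 {b..} (\<lambda>t. 64) (\<lambda>t. soft_step (b - t)) (\<lambda>t. - s1 (b - t))
      (\<lambda>t. s2 (b - t)) (\<lambda>t. - s3 (b - t))"
  proof -
    have sh: "((\<lambda>t. f (b - t)) has_real_derivative - f' (b - t)) (at t within A)"
      if "\<And>x. DERIV f x :> f' x" for f f' :: "real \<Rightarrow> real" and t A
    proof -
      have "((\<lambda>t. b - t) has_real_derivative -1) (at t within A)" by (auto intro!: derivative_eq_intros)
      from DERIV_chain2[where f = f and g = "\<lambda>t. b - t", OF that this] show ?thesis by simp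
    qed
    have sh2: "((\<lambda>t. - f (b - t)) has_real_derivative f' (b - t)) (at t within A)"
      if "\<And>x. DERIV f x :> f' x" for f f' :: "real \<Rightarrow> real" and t A
      using DERIV_minus[OF sh[OF that, of t A]] by simp
    have "continuous_on {t0..} (\<lambda>t. - s3 (b - t))"
      by (intro continuous_on_minus continuous_on_compose2[OF s(4)]) (auto intro!: continuous_intros)
    then show ?thesis
      unfolding C3_dominated_def
      by (intro conjI allI impI ballI sh sh2 s(1-3)) (simp_all add: s(5-9) soft_step_zero)
  qed
  obtain c1 c2 c3 where c: "C3_dominated t0 ({..a} \<union> {b..}) (\<lambda>t. 8 * (64 * 64))
      (\<lambda>t. soft_step (t - a) * soft_step (b - t)) c1 c2 c3"
    using C3_dominated_mult[OF up down] by blast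
  obtain g1 g2 g3 where g: "C3_dominated t0 ({} \<union> {}) (\<lambda>t. 8 * ((L * \<gamma> t) * (L * \<gamma> t))) (\<lambda>t. \<gamma> t * \<gamma> t) g1 g2 g3"
    using C3_dominated_mult[OF \<gamma> \<gamma>] by blast
  have "\<exists>f1 f2 f3. C3_dominated t0 (({..a} \<union> {b..}) \<union> ({} \<union> {}))
      (\<lambda>t. 8 * (8 * (64 * 64) * (8 * ((L * \<gamma> t) * (L * \<gamma> t)))))
      (\<lambda>t. soft_step (t - a) * soft_step (b - t) * (\<gamma> t * \<gamma> t)) f1 f2 f3"
    by (rule C3_dominated_mult[OF c g])
  then show ?thesis by (simp add: power2_eq_square mult_ac)
qed

text \<open>A perturbation \<open>p\<close> of the constant speed \<open>\<kappa>\<^sup>2\<close> with support in \<open>[a, b]\<close>, admissible for \<open>\<gamma>\<close>, together with the solution \<open>V\<close> of the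
perturbed equation for the parameter \<open>z\<close> that starts from zero at \<open>a\<close> with unit velocity.\<close>

definition resonant_piece :: "real \<Rightarrow> (real \<Rightarrow> real) \<Rightarrow> real \<Rightarrow> real \<Rightarrow> real \<Rightarrow> real \<Rightarrow> real \<Rightarrow>
    (real \<Rightarrow> real) \<Rightarrow> (real \<Rightarrow> real) \<Rightarrow> (real \<Rightarrow> real) \<Rightarrow> (real \<Rightarrow> real) \<Rightarrow> (real \<Rightarrow> real) \<Rightarrow> bool" where
  "resonant_piece t0 \<gamma> \<kappa> z d a b p p1 p2 V V1 \<longleftrightarrow>
    (\<forall>t\<ge>t0. (p has_real_derivative p1 t) (at t within {t0..}) \<and>
      (p1 has_real_derivative p2 t) (at t within {t0..}) \<and>
      (V has_real_derivative V1 t) (at t within {t0..}) \<and>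
      (V1 has_real_derivative - (\<kappa>\<^sup>2 + p t) * z * V t) (at t within {t0..}) \<and>
      \<bar>p t\<bar> \<le> d * (\<gamma> t)\<^sup>2 / z \<and> \<bar>p t\<bar> \<le> d \<and> \<bar>p1 t\<bar> \<le> \<gamma> t \<and> \<bar>p2 t\<bar> \<le> (\<gamma> t)\<^sup>2) \<and>
    continuous_on {t0..} p2 \<and>
    (\<forall>t. t \<le> a \<or> b \<le> t \<longrightarrow> p t = 0 \<and> p1 t = 0 \<and> p2 t = 0) \<and>
    V a = 0 \<and> V1 a = 1"

text \<open>With \<open>e = (\<delta> / l) * f\<close> and \<open>s = t - a\<close> the function \<open>V = sin (m s) / m * exp (\<integral> e sin\<^sup>2 (m s))\<close> satisfies
\<open>V'' = - (m\<^sup>2 - 2 m e sin (2 m s) - e' sin\<^sup>2 (m s) - e\<^sup>2 sin\<^sup>4 (m s)) * V\<close>. So it solves the oscillator equation with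
\<open>z = l\<^sup>2\<close> for the speed \<open>\<kappa>\<^sup>2 + p\<close>, where \<open>m = \<kappa> l\<close> and \<open>p\<close> is given by the lower-order terms divided by \<open>- l\<^sup>2\<close>. The
polynomial in \<open>\<kappa>\<close> collects the coefficients of \<open>p''\<close>, whose leading part is \<open>8 m\<^sup>3 e / l\<^sup>2\<close>.
Since \<open>e\<close> vanishes at \<open>b\<close>, the final energy is exactly the square of the exponential.\<close>

lemma resonant_block:
  fixes t0 a b \<kappa> l \<delta> C d :: real and \<gamma> f f1 f2 f3 :: "real \<Rightarrow> real"
  assumes f: "C3_dominated t0 ({..a} \<union> {b..}) (\<lambda>t. C * (\<gamma> t)\<^sup>2) f f1 f2 f3"
    and ab: "t0 \<le> a" "a \<le> b" and \<kappa>: "\<kappa> > 0" and l: "l \<ge> 1"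
    and \<gamma>0: "\<And>t. t \<ge> t0 \<Longrightarrow> 0 \<le> \<gamma> t" and \<gamma>l: "\<And>t. t \<in> {t0..b} \<Longrightarrow> \<gamma> t \<le> l"
    and C0: "C \<ge> 0" and \<delta>: "\<delta> \<ge> 0" "\<delta> * C * (8 * \<kappa> ^ 3 + 16 * \<kappa>\<^sup>2 + 12 * \<kappa> + 5) \<le> d" and d1: "d \<le> 1"
  shows "\<exists>p p1 p2 V V1. resonant_piece t0 \<gamma> \<kappa> (l\<^sup>2) d a b p p1 p2 V V1 \<and>
    (V1 b)\<^sup>2 + \<kappa>\<^sup>2 * l\<^sup>2 * (V b)\<^sup>2 =
      exp (2 * (\<delta> / l) * integral {t0..b} (\<lambda>t. f t * (sin (\<kappa> * l * (t - a)))\<^sup>2))"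
proof -
  define m where "m = \<kappa> * l"
  have m0: "m > 0" using \<kappa> l by (simp add: m_def)
  have d0: "d \<ge> 0"
  proof -
    have "0 \<le> \<delta> * C * (8 * \<kappa> ^ 3 + 16 * \<kappa>\<^sup>2 + 12 * \<kappa> + 5)"
      using \<delta>(1) C0 \<kappa> by (intro mult_nonneg_nonneg add_nonneg_nonneg) auto
    then show ?thesis using \<delta>(2) by linarith
  qed
  define k where "k = \<delta> / l"
  have k0: "k \<ge> 0" using \<delta> l by (simp add: k_def)
  define e where "e t = k * f t" for t
  define e1 where "e1 t = k * f1 t" for t
  define e2 where "e2 t = k * f2 t" for t
  define e3 where "e3 t = k * f3 t" for t
  \<comment> \<open>\<open>S\<close>, \<open>K\<close> and \<open>Q\<close> are closed under differentiation up to factors \<open>m\<close>, which makes \<open>p'\<close> and \<open>p''\<close>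
    polynomials in them.\<close>
  define S where "S t = sin (2 * (m * (t - a)))" for t
  define K where "K t = cos (2 * (m * (t - a)))" for t
  define Q where "Q t = (sin (m * (t - a)))\<^sup>2" for t
  have df: "(f has_real_derivative f1 t) (at t within {t0..})"
      "(f1 has_real_derivative f2 t) (at t within {t0..})"
      "(f2 has_real_derivative f3 t) (at t within {t0..})"
    and bf: "\<bar>f t\<bar> \<le> C * (\<gamma> t)\<^sup>2" "\<bar>f1 t\<bar> \<le> C * (\<gamma> t)\<^sup>2" "\<bar>f2 t\<bar> \<le> C * (\<gamma> t)\<^sup>2" "\<bar>f3 t\<bar> \<le> C * (\<gamma> t)\<^sup>2"
    if "t \<ge> t0" for t
    using f that unfolding C3_dominated_def by blast+
  have cont3: "continuous_on {t0..} f3" using f unfolding C3_dominated_def by blast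
  have cont: "continuous_on {t0..} f" "continuous_on {t0..} f1" "continuous_on {t0..} f2"
    by (rule DERIV_continuous_on, rule df, simp)+
  have zero: "e t = 0 \<and> e1 t = 0 \<and> e2 t = 0 \<and> e3 t = 0" if "t \<le> a \<or> b \<le> t" for t
    using f that unfolding C3_dominated_def by (auto simp: e_def e1_def e2_def e3_def)
  have de: "(e has_real_derivative e1 t) (at t within {t0..})"
      "(e1 has_real_derivative e2 t) (at t within {t0..})"
      "(e2 has_real_derivative e3 t) (at t within {t0..})" if "t \<ge> t0" for t
    unfolding e_def e1_def e2_def e3_def by (intro DERIV_cmult df that)+
  have dS: "(S has_real_derivative 2 * m * K t) (at t within A)" for t A
    unfolding S_def K_def by (rule derivative_eq_intros refl)+ simp
  have dK: "(K has_real_derivative - 2 * m * S t) (at t within A)" for t A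
    unfolding S_def K_def by (rule derivative_eq_intros refl)+ simp
  have dQ: "(Q has_real_derivative m * S t) (at t within A)" for t A
    unfolding S_def Q_def sin_double by (rule derivative_eq_intros refl)+ simp
  define n0 where "n0 t = 2 * m * e t * S t + e1 t * Q t + (e t)\<^sup>2 * (Q t)\<^sup>2" for t
  define n1 where "n1 t = 3 * m * e1 t * S t + 4 * m\<^sup>2 * e t * K t + e2 t * Q t
    + 2 * e t * e1 t * (Q t)\<^sup>2 + 2 * m * (e t)\<^sup>2 * Q t * S t" for t
  define n2 where "n2 t = 4 * m * e2 t * S t + 10 * m\<^sup>2 * e1 t * K t - 8 * m ^ 3 * e t * S t
    + e3 t * Q t + 2 * ((e1 t)\<^sup>2 + e t * e2 t) * (Q t)\<^sup>2 + 8 * m * e t * e1 t * Q t * S t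
    + 2 * m\<^sup>2 * (e t)\<^sup>2 * ((S t)\<^sup>2 + 2 * Q t * K t)" for t
  define p where "p t = - (1 / l\<^sup>2) * n0 t" for t
  define p1 where "p1 t = - (1 / l\<^sup>2) * n1 t" for t
  define p2 where "p2 t = - (1 / l\<^sup>2) * n2 t" for t
  have dp: "(p has_real_derivative p1 t) (at t within {t0..})" if "t \<ge> t0" for t
    unfolding p_def p1_def n0_def n1_def
    by (rule derivative_eq_intros de dS dK dQ that refl)+ (simp add: algebra_simps power2_eq_square)
  have dp1: "(p1 has_real_derivative p2 t) (at t within {t0..})" if "t \<ge> t0" for t
    unfolding p1_def p2_def n1_def n2_def
    by (rule derivative_eq_intros de dS dK dQ that refl)+
      (simp add: algebra_simps power2_eq_square power3_eq_cube)
  have cSK: "continuous_on A S" "continuous_on A K" "continuous_on A Q" for A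
    unfolding S_def K_def Q_def by (intro continuous_intros)+
  have ce: "continuous_on {t0..} e" "continuous_on {t0..} e1" "continuous_on {t0..} e2" "continuous_on {t0..} e3"
    unfolding e_def e1_def e2_def e3_def by (intro continuous_intros cont cont3)+
  have cp2: "continuous_on {t0..} p2"
    unfolding p2_def n2_def by (intro continuous_intros ce cSK)
  have pz: "p t = 0 \<and> p1 t = 0 \<and> p2 t = 0" if "t \<le> a \<or> b \<le> t" for t
    using zero[OF that] by (simp add: p_def p1_def p2_def n0_def n1_def n2_def)
  have bounds: "\<bar>p t\<bar> \<le> d * (\<gamma> t)\<^sup>2 / l\<^sup>2 \<and> \<bar>p t\<bar> \<le> d \<and> \<bar>p1 t\<bar> \<le> \<gamma> t \<and> \<bar>p2 t\<bar> \<le> (\<gamma> t)\<^sup>2" if t: "t \<ge> t0" for t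
  proof (cases "t \<le> a \<or> b \<le> t")
    case True
    then show ?thesis using pz[OF True] d0 \<gamma>0[OF t] by simp
  next
    case False
    define g where "g = \<gamma> t"
    have g: "0 \<le> g" "g \<le> l" using \<gamma>0[OF t] \<gamma>l[of t] t False by (auto simp: g_def)
    define D where "D = \<delta> * C"
    have D0: "D \<ge> 0" using \<delta> C0 by (simp add: D_def)
    define B where "B = 8 * \<kappa> ^ 3 + 16 * \<kappa>\<^sup>2 + 12 * \<kappa> + 5"
    have DB: "D * B \<le> d" using \<delta>(2) by (simp add: D_def B_def)
    have \<kappa>p: "\<kappa>\<^sup>2 > 0" "\<kappa> ^ 3 > 0" using \<kappa> by auto
    have B5: "B \<ge> 1" using \<kappa> \<kappa>p unfolding B_def by linarith
    have D1: "D \<le> 1"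
    proof -
      have "D * 1 \<le> D * B" by (rule mult_left_mono[OF B5 D0])
      then show ?thesis using DB d1 by linarith
    qed
    \<comment> \<open>\<open>x\<close> bounds \<open>e\<close> and its three derivatives. From \<open>x \<le> l\<close> and \<open>1 \<le> l\<close> every term of the
      numerators of \<open>p\<close>, \<open>p'\<close> and \<open>p''\<close> is at most its coefficient times \<open>l * x\<close>, \<open>l\<^sup>2 * x\<close> and \<open>l\<^sup>3 * x\<close>.\<close>
    define x where "x = D * g\<^sup>2 / l"
    have x0: "x \<ge> 0" using D0 l by (simp add: x_def)
    have xl: "x * l = D * g\<^sup>2" using l by (simp add: x_def)
    have gl2: "g\<^sup>2 \<le> g * l" using mult_left_mono[OF g(2) g(1)] by (simp add: power2_eq_square)
    have gl3: "g\<^sup>2 \<le> l\<^sup>2" using g by (intro power_mono) auto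
    have xg: "x \<le> D * g"
    proof -
      have "x * l \<le> (D * g) * l" using mult_left_mono[OF gl2 D0] by (simp add: xl mult.assoc)
      then show ?thesis using l by simp
    qed
    have xl1: "x \<le> l"
    proof -
      have "D * g \<le> 1 * l" using D1 D0 g by (intro mult_mono) auto
      then show ?thesis using xg by simp
    qed
    have be: "\<bar>e t\<bar> \<le> x" "\<bar>e1 t\<bar> \<le> x" "\<bar>e2 t\<bar> \<le> x" "\<bar>e3 t\<bar> \<le> x"
    proof -
      have *: "\<bar>k * y\<bar> \<le> x" if "\<bar>y\<bar> \<le> C * (\<gamma> t)\<^sup>2" for y
      proof -
        have "\<bar>k * y\<bar> \<le> k * (C * (\<gamma> t)\<^sup>2)"
          using that k0 by (simp add: abs_mult mult_left_mono)
        also have "\<dots> = x" by (simp add: x_def k_def D_def g_def)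
        finally show ?thesis .
      qed
      show "\<bar>e t\<bar> \<le> x" "\<bar>e1 t\<bar> \<le> x" "\<bar>e2 t\<bar> \<le> x" "\<bar>e3 t\<bar> \<le> x"
        unfolding e_def e1_def e2_def e3_def by (intro * bf[OF t])+
    qed
    have bS: "\<bar>S t\<bar> \<le> 1" "\<bar>K t\<bar> \<le> 1" by (simp_all add: S_def K_def)
    have bQ: "\<bar>Q t\<bar> \<le> 1"
      using abs_power2_le[of "sin (m * (t - a))" 1] by (simp add: Q_def)
    have bm: "\<bar>m\<bar> \<le> m" "\<bar>m ^ 3\<bar> \<le> m ^ 3" using m0 by auto
    have bn: "\<bar>numeral n\<bar> \<le> (numeral n :: real)" for n by simp
    note bb = abs_bounds be bS bQ bm bn
    have lx1: "x \<le> l * x" using mult_right_mono[OF l x0] by simp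
    have lx2: "l * x \<le> l\<^sup>2 * x" using mult_left_mono[OF lx1, of l] l by (simp add: power2_eq_square)
    have lx3: "l\<^sup>2 * x \<le> l ^ 3 * x"
      using mult_left_mono[OF lx2, of l] l by (simp add: power2_eq_square power3_eq_cube mult.assoc)
    have xx0: "x\<^sup>2 \<le> l * x" using mult_right_mono[OF xl1 x0] by (simp add: power2_eq_square)
    have xx1: "l * x\<^sup>2 \<le> l\<^sup>2 * x" using mult_left_mono[OF xx0, of l] l by (simp add: power2_eq_square)
    have xx2: "l\<^sup>2 * x\<^sup>2 \<le> l ^ 3 * x"
      using mult_left_mono[OF xx1, of l] l by (simp add: power2_eq_square power3_eq_cube)
    have l2: "l\<^sup>2 > 0" using l by simp
    have scale: "\<bar>- (1 / l\<^sup>2) * Y\<bar> \<le> R" if "\<bar>Y\<bar> \<le> R * l\<^sup>2" for Y R :: real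
      using that l2 by (simp add: abs_mult abs_divide field_simps)
    have A0: "\<bar>n0 t\<bar> \<le> D * B * g\<^sup>2"
    proof -
      have "\<bar>n0 t\<bar> \<le> 2 * m * x * 1 + x * 1 + x\<^sup>2 * 1\<^sup>2"
        unfolding n0_def by (intro bb)
      also have "\<dots> = (l * x) * (2 * \<kappa>) + x + x\<^sup>2" by (simp add: m_def)
      also have "\<dots> \<le> (l * x) * (2 * \<kappa>) + (l * x) + (l * x)" using lx1 xx0 by linarith
      also have "\<dots> = (l * x) * (2 * \<kappa> + 2)" by (simp add: algebra_simps)
      also have "\<dots> \<le> (l * x) * B" using x0 l \<kappa> \<kappa>p by (intro mult_left_mono) (auto simp: B_def)
      also have "\<dots> = D * B * g\<^sup>2" using xl by (simp add: algebra_simps)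
      finally show ?thesis .
    qed
    have P0: "\<bar>p t\<bar> \<le> D * B * g\<^sup>2 / l\<^sup>2"
      unfolding p_def by (rule scale) (use A0 l2 in simp)
    have A1: "\<bar>n1 t\<bar> \<le> x * B * l\<^sup>2"
    proof -
      have "\<bar>n1 t\<bar>
        \<le> 3 * m * x * 1 + 4 * m\<^sup>2 * x * 1 + x * 1 + 2 * x * x * 1\<^sup>2 + 2 * m * x\<^sup>2 * 1 * 1"
        unfolding n1_def by (intro bb)
      also have "\<dots> = (3 * \<kappa>) * (l * x) + 4 * \<kappa>\<^sup>2 * (l\<^sup>2 * x) + x + 2 * x\<^sup>2 + (2 * \<kappa>) * (l * x\<^sup>2)"
        by (simp add: m_def power2_eq_square)
      also have "\<dots> \<le> (3 * \<kappa>) * (l\<^sup>2 * x) + 4 * \<kappa>\<^sup>2 * (l\<^sup>2 * x) + (l\<^sup>2 * x) + 2 * (l\<^sup>2 * x) + (2 * \<kappa>) * (l\<^sup>2 * x)"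
        using \<kappa> by (intro add_mono mult_left_mono order_refl lx2 xx1 order_trans[OF lx1 lx2] order_trans[OF xx0 lx2]) auto
      also have "\<dots> = (l\<^sup>2 * x) * (5 * \<kappa> + 4 * \<kappa>\<^sup>2 + 3)" by (simp add: algebra_simps)
      also have "\<dots> \<le> (l\<^sup>2 * x) * B" using x0 l \<kappa> \<kappa>p by (intro mult_left_mono) (auto simp: B_def)
      finally show ?thesis by (simp add: mult_ac)
    qed
    have P1: "\<bar>p1 t\<bar> \<le> x * B"
      unfolding p1_def by (rule scale) (rule A1)
    have A2: "\<bar>n2 t\<bar> \<le> D * B * g\<^sup>2 * l\<^sup>2"
    proof -
      have "\<bar>n2 t\<bar>
        \<le> 4 * m * x * 1 + 10 * m\<^sup>2 * x * 1 + 8 * m ^ 3 * x * 1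
          + x * 1 + 2 * (x\<^sup>2 + x * x) * 1\<^sup>2 + 8 * m * x * x * 1 * 1
          + 2 * m\<^sup>2 * x\<^sup>2 * (1\<^sup>2 + 2 * 1 * 1)"
        unfolding n2_def by (intro bb)
      also have "\<dots> = (4 * \<kappa>) * (l * x) + (10 * \<kappa>\<^sup>2) * (l\<^sup>2 * x) + (8 * \<kappa> ^ 3) * (l ^ 3 * x)
          + x + 4 * x\<^sup>2 + (8 * \<kappa>) * (l * x\<^sup>2) + (6 * \<kappa>\<^sup>2) * (l\<^sup>2 * x\<^sup>2)"
        by (simp add: m_def power2_eq_square power3_eq_cube)
      also have "\<dots> \<le> (4 * \<kappa>) * (l ^ 3 * x) + (10 * \<kappa>\<^sup>2) * (l ^ 3 * x) + (8 * \<kappa> ^ 3) * (l ^ 3 * x)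
          + l ^ 3 * x + 4 * (l ^ 3 * x) + (8 * \<kappa>) * (l ^ 3 * x) + (6 * \<kappa>\<^sup>2) * (l ^ 3 * x)"
      proof -
        have y1: "l * x \<le> l ^ 3 * x" using lx2 lx3 by linarith
        have y2: "x \<le> l ^ 3 * x" "x\<^sup>2 \<le> l ^ 3 * x" using lx1 xx0 y1 by linarith+
        have y3: "l * x\<^sup>2 \<le> l ^ 3 * x" using xx1 lx3 by linarith
        show ?thesis using \<kappa> by (intro add_mono mult_left_mono order_refl y1 y2 y3 lx3 xx2) auto
      qed
      also have "\<dots> = (l ^ 3 * x) * B" by (simp add: B_def algebra_simps)
      also have "\<dots> = (x * l) * B * l\<^sup>2" by (simp add: power2_eq_square power3_eq_cube)
      also have "\<dots> = D * B * g\<^sup>2 * l\<^sup>2" unfolding xl by simp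
      finally show ?thesis .
    qed
    have P2: "\<bar>p2 t\<bar> \<le> D * B * g\<^sup>2"
      unfolding p2_def by (rule scale) (rule A2)
    have "D * B * g\<^sup>2 / l\<^sup>2 \<le> d * g\<^sup>2 / l\<^sup>2"
      using DB by (intro divide_right_mono mult_right_mono) auto
    moreover have "d * g\<^sup>2 / l\<^sup>2 \<le> d"
      using mult_left_mono[OF gl3 d0] l2 by (simp add: field_simps)
    moreover have "x * B \<le> g"
    proof -
      have "x * B \<le> (D * g) * B" using xg B5 by (intro mult_right_mono) auto
      also have "\<dots> = (D * B) * g" by simp
      also have "\<dots> \<le> 1 * g" using DB d1 g by (intro mult_right_mono) auto
      finally show ?thesis by simp
    qed
    moreover have "D * B * g\<^sup>2 \<le> g\<^sup>2"
      using mult_right_mono[of "D * B" 1 "g\<^sup>2"] DB d1 by simp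
    ultimately show ?thesis using P0 P1 P2 unfolding g_def by linarith
  qed
  define E where "E t = integral {t0..t} (\<lambda>s. e s * Q s)" for t
  have dE: "(E has_real_derivative e t * Q t) (at t within {t0..})" if "t \<ge> t0" for t
    unfolding E_def by (rule half_line_antiderivative) (use that in \<open>auto intro!: continuous_intros ce cSK\<close>)
  have dexp: "((\<lambda>t. exp (E t)) has_real_derivative exp (E t) * (e t * Q t)) (at t within {t0..})"
    if "t \<ge> t0" for t
    by (rule DERIV_chain2[OF DERIV_exp dE[OF that]])
  have dsin: "((\<lambda>t. sin (m * (t - a)) / m) has_real_derivative cos (m * (t - a))) (at t within A)" for t A
    by (rule derivative_eq_intros refl)+ (use m0 in simp_all)
  define V where "V t = sin (m * (t - a)) / m * exp (E t)" for t
  define V1 where "V1 t = (cos (m * (t - a)) + e t / m * sin (m * (t - a)) ^ 3) * exp (E t)" for t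
  have dV: "(V has_real_derivative V1 t) (at t within {t0..})" if "t \<ge> t0" for t
  proof -
    have "(V has_real_derivative cos (m * (t - a)) * exp (E t) + exp (E t) * (e t * Q t) * (sin (m * (t - a)) / m))
        (at t within {t0..})"
      unfolding V_def by (rule DERIV_mult[OF dsin dexp[OF that]])
    then show ?thesis
      by (rule DERIV_cong) (simp add: V1_def Q_def algebra_simps power2_eq_square power3_eq_cube)
  qed
  have dV1: "(V1 has_real_derivative - (\<kappa>\<^sup>2 + p t) * l\<^sup>2 * V t) (at t within {t0..})" if "t \<ge> t0" for t
  proof -
    define s where "s = sin (m * (t - a))"
    define c where "c = cos (m * (t - a))"
    have "(\<kappa>\<^sup>2 + p t) * l\<^sup>2 = m\<^sup>2 - (4 * m * e t * s * c + e1 t * s\<^sup>2 + (e t)\<^sup>2 * s ^ 4)"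
    proof -
      have "S t = 2 * s * c" "Q t = s\<^sup>2" unfolding S_def Q_def s_def c_def by (simp_all only: sin_double)
      then show ?thesis
        using l by (simp add: p_def n0_def m_def field_simps power_mult_distrib)
    qed
    note coeff = this
    have "- (\<kappa>\<^sup>2 + p t) * l\<^sup>2 * V t = - ((\<kappa>\<^sup>2 + p t) * l\<^sup>2) * V t" by (simp add: algebra_simps)
    also have "\<dots> = - (m\<^sup>2 - (4 * m * e t * s * c + e1 t * s\<^sup>2 + (e t)\<^sup>2 * s ^ 4)) * (s / m * exp (E t))"
      unfolding coeff V_def s_def[symmetric] ..
    also have "\<dots> = (- m * s + e1 t / m * s ^ 3 + 4 * e t * s\<^sup>2 * c + (e t)\<^sup>2 / m * s ^ 5) * exp (E t)"
      using m0 by (simp add: field_simps power2_eq_square numeral_eq_Suc)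
    finally have eq: "- (\<kappa>\<^sup>2 + p t) * l\<^sup>2 * V t
        = (- m * s + e1 t / m * s ^ 3 + 4 * e t * s\<^sup>2 * c + (e t)\<^sup>2 / m * s ^ 5) * exp (E t)" .
    have "(V1 has_real_derivative
        (- m * s + e1 t / m * s ^ 3 + 4 * e t * s\<^sup>2 * c + (e t)\<^sup>2 / m * s ^ 5) * exp (E t)) (at t within {t0..})"
    proof -
      have "((\<lambda>t. cos (m * (t - a)) + e t / m * sin (m * (t - a)) ^ 3) has_real_derivative
          - m * s + (e1 t / m * s ^ 3 + 3 * e t * s\<^sup>2 * c)) (at t within {t0..})"
      proof (rule DERIV_cong)
        have 1: "((\<lambda>t. cos (m * (t - a))) has_real_derivative - m * s) (at t within {t0..})"
          unfolding s_def by (rule derivative_eq_intros refl)+ simp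
        have 2: "((\<lambda>t. sin (m * (t - a)) ^ 3) has_real_derivative 3 * s\<^sup>2 * (c * m)) (at t within {t0..})"
          unfolding s_def c_def by (rule derivative_eq_intros refl)+ simp
        show "((\<lambda>t. cos (m * (t - a)) + e t / m * sin (m * (t - a)) ^ 3) has_real_derivative
            - m * s + (e1 t / m * sin (m * (t - a)) ^ 3 + 3 * s\<^sup>2 * (c * m) * (e t / m))) (at t within {t0..})"
          by (rule DERIV_add[OF 1 DERIV_mult[OF DERIV_cdivide[OF de(1)[OF that]] 2]])
        show "- m * s + (e1 t / m * sin (m * (t - a)) ^ 3 + 3 * s\<^sup>2 * (c * m) * (e t / m))
            = - m * s + (e1 t / m * s ^ 3 + 3 * e t * s\<^sup>2 * c)"
          using m0 unfolding s_def[symmetric] by simp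
      qed
      from DERIV_mult[OF this dexp[OF that]]
      have "(V1 has_real_derivative
          (- m * s + (e1 t / m * s ^ 3 + 3 * e t * s\<^sup>2 * c)) * exp (E t)
            + exp (E t) * (e t * s\<^sup>2) * (c + e t / m * s ^ 3)) (at t within {t0..})"
        unfolding V1_def Q_def s_def[symmetric] c_def[symmetric] .
      then show ?thesis
        by (rule DERIV_cong) (simp add: algebra_simps numeral_eq_Suc)
    qed
    then show ?thesis unfolding eq .
  qed
  have Ea: "E a = 0"
    unfolding E_def by (rule integral_unique, rule has_integral_is_0) (use zero in auto)
  have Va: "V a = 0" "V1 a = 1"
    using Ea by (simp_all add: V_def V1_def)
  have "(V1 b)\<^sup>2 + m\<^sup>2 * (V b)\<^sup>2 = (exp (E b))\<^sup>2"
  proof -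
    have "(V1 b)\<^sup>2 + m\<^sup>2 * (V b)\<^sup>2 = ((cos (m * (b - a)))\<^sup>2 + (sin (m * (b - a)))\<^sup>2) * (exp (E b))\<^sup>2"
      using zero[of b] m0 by (simp add: V_def V1_def power_mult_distrib power_divide flip: distrib_right)
    then show ?thesis by simp
  qed
  also have "\<dots> = exp (2 * E b)" by (simp add: exp_double)
  also have "E b = k * integral {t0..b} (\<lambda>t. f t * Q t)"
    unfolding E_def e_def by (simp add: mult.assoc)
  finally have Vb: "(V1 b)\<^sup>2 + \<kappa>\<^sup>2 * l\<^sup>2 * (V b)\<^sup>2 =
      exp (2 * (\<delta> / l) * integral {t0..b} (\<lambda>t. f t * (sin (\<kappa> * l * (t - a)))\<^sup>2))"
    by (simp add: m_def k_def Q_def power_mult_distrib mult.assoc)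
  have "resonant_piece t0 \<gamma> \<kappa> (l\<^sup>2) d a b p p1 p2 V V1"
    unfolding resonant_piece_def using dp dp1 cp2 pz bounds dV dV1 Va by blast
  with Vb show ?thesis by blast
qed

text \<open>The mean of \<open>sin\<^sup>2\<close> is \<open>1/2\<close>. The oscillating rest \<open>f cos (2 m s) / 2\<close> is the derivative of \<open>f sin (2 m s) / (4 m)\<close> up to a
term with \<open>f'\<close>; the boundary terms vanish, and the term with \<open>f'\<close> gains the factor \<open>1 / (4 m)\<close>.\<close>

lemma resonant_integral_lower_bound:
  assumes f: "C3_dominated t0 ({..a} \<union> {b..}) (\<lambda>t. C * (\<gamma> t)\<^sup>2) f f1 f2 f3"
    and \<gamma>: "continuous_on {t0..} \<gamma>" and ab: "t0 \<le> a" "a \<le> b" and m: "m > 0"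
  shows "integral {t0..b} f / 2 - C / (4 * m) * G_fun t0 \<gamma> b
    \<le> integral {t0..b} (\<lambda>t. f t * (sin (m * (t - a)))\<^sup>2)"
proof -
  have df: "(f has_real_derivative f1 t) (at t within {t0..})"
      "(f1 has_real_derivative f2 t) (at t within {t0..})"
    and bf: "\<bar>f1 t\<bar> \<le> C * (\<gamma> t)\<^sup>2" if "t \<ge> t0" for t
    using f that unfolding C3_dominated_def by blast+
  have zero: "f t0 = 0" "f b = 0"
    using f ab unfolding C3_dominated_def by auto
  have cont: "continuous_on {t0..} f" "continuous_on {t0..} f1"
    by (rule DERIV_continuous_on, rule df, simp)+
  have cont': "continuous_on {t0..b} f" "continuous_on {t0..b} f1" "continuous_on {t0..b} \<gamma>"
    using cont \<gamma> by (auto intro: continuous_on_subset)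
  define S where "S t = sin (2 * (m * (t - a)))" for t
  define K where "K t = cos (2 * (m * (t - a)))" for t
  have cSK: "continuous_on A S" "continuous_on A K" for A
    unfolding S_def K_def by (intro continuous_intros)+
  have dS: "(S has_real_derivative 2 * m * K t) (at t within A)" for t A
    unfolding S_def K_def by (rule derivative_eq_intros refl)+ simp
  have "((\<lambda>t. f1 t * S t / (4 * m) + f t * K t / 2) has_integral f b * S b / (4 * m) - f t0 * S t0 / (4 * m)) {t0..b}"
  proof (rule fundamental_theorem_of_calculus)
    fix t assume "t \<in> {t0..b}"
    then have "(f has_real_derivative f1 t) (at t within {t0..b})"
      using df(1)[of t] by (auto intro: DERIV_subset)
    from DERIV_cdivide[OF DERIV_mult[OF this dS], of "4 * m"]
    have "((\<lambda>t. f t * S t / (4 * m)) has_real_derivative f1 t * S t / (4 * m) + f t * K t / 2) (at t within {t0..b})"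
      by (rule DERIV_cong) (use m in \<open>simp add: field_simps\<close>)
    then show "((\<lambda>t. f t * S t / (4 * m)) has_vector_derivative f1 t * S t / (4 * m) + f t * K t / 2) (at t within {t0..b})"
      by (simp add: has_real_derivative_iff_has_vector_derivative)
  qed (use ab in auto)
  then have H: "((\<lambda>t. f1 t * S t / (4 * m) + f t * K t / 2) has_integral 0) {t0..b}"
    by (simp add: zero)
  have I: "f integrable_on {t0..b}" "(\<lambda>t. f1 t * S t / (4 * m)) integrable_on {t0..b}"
    "(\<lambda>t. (\<gamma> t)\<^sup>2) integrable_on {t0..b}"
    using m by (auto intro!: integrable_continuous_interval continuous_intros cont' cSK)
  have "((\<lambda>t. f t / 2 - (f1 t * S t / (4 * m) + f t * K t / 2) + f1 t * S t / (4 * m))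
      has_integral (integral {t0..b} f / 2 - 0 + integral {t0..b} (\<lambda>t. f1 t * S t / (4 * m)))) {t0..b}"
    by (intro has_integral_add has_integral_diff has_integral_divide H integrable_integral I)
  moreover have "f t / 2 - (f1 t * S t / (4 * m) + f t * K t / 2) + f1 t * S t / (4 * m) = f t * (sin (m * (t - a)))\<^sup>2" for t
  proof -
    have "K t = 1 - 2 * (sin (m * (t - a)))\<^sup>2" unfolding K_def by (rule cos_double_sin)
    then show ?thesis by (simp only:) (simp add: field_simps)
  qed
  ultimately have eq: "integral {t0..b} (\<lambda>t. f t * (sin (m * (t - a)))\<^sup>2)
      = integral {t0..b} f / 2 + integral {t0..b} (\<lambda>t. f1 t * S t / (4 * m))"
    by (simp add: has_integral_iff)
  have "norm (integral {t0..b} (\<lambda>t. f1 t * S t / (4 * m))) \<le> integral {t0..b} (\<lambda>t. C / (4 * m) * (\<gamma> t)\<^sup>2)"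
  proof (rule integral_norm_bound_integral)
    show "(\<lambda>t. C / (4 * m) * (\<gamma> t)\<^sup>2) integrable_on {t0..b}"
      by (rule integrable_on_mult_right[OF I(3)])
    show "norm (f1 t * S t / (4 * m)) \<le> C / (4 * m) * (\<gamma> t)\<^sup>2" if "t \<in> {t0..b}" for t
    proof -
      have "\<bar>f1 t * S t\<bar> \<le> C * (\<gamma> t)\<^sup>2 * 1"
        by (intro abs_mult_le bf) (use that in \<open>auto simp: S_def\<close>)
      then show ?thesis using m by (simp add: abs_divide divide_right_mono)
    qed
  qed (rule I)
  also have "\<dots> = C / (4 * m) * G_fun t0 \<gamma> b" by (simp add: G_fun_def)
  finally show ?thesis unfolding eq real_norm_def by linarith
qed

section \<open>Choice of the resonance intervals\<close>

text \<open>The data of the problem, with the bounds on \<open>\<gamma>\<close> and its derivatives merged into one constant \<open>L\<close>. What matters below is that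
all requirements on the end point \<open>b\<close> of a resonance interval hold eventually, while \<open>M b\<close> can be made arbitrarily large
at arbitrarily late record times of \<open>G S\<close>.\<close>

locale speed_data =
  fixes t0 L :: real and S \<gamma> \<gamma>1 \<gamma>2 \<gamma>3 :: "real \<Rightarrow> real"
  assumes S_cont: "continuous_on {t0..} S" and S_anti: "antimono_on {t0..} S"
    and S_lim: "(S \<longlongrightarrow> 0) at_top"
    and \<gamma>_jet: "C3_dominated t0 {} (\<lambda>t. L * \<gamma> t) \<gamma> \<gamma>1 \<gamma>2 \<gamma>3"
    and \<gamma>_nonneg: "\<And>t. t \<ge> t0 \<Longrightarrow> 0 \<le> \<gamma> t" and L1: "1 \<le> L"
    and GS_unbounded: "\<not> bdd_above ((\<lambda>\<tau>. G_fun t0 \<gamma> \<tau> * S \<tau>) ` {t0..})"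
begin

abbreviation "G \<equiv> G_fun t0 \<gamma>"
abbreviation "M \<equiv> M_fun t0 S \<gamma>"

lemma d\<gamma>: "t \<ge> t0 \<Longrightarrow> (\<gamma> has_real_derivative \<gamma>1 t) (at t within {t0..})"
  and \<gamma>1_le: "t \<ge> t0 \<Longrightarrow> \<bar>\<gamma>1 t\<bar> \<le> L * \<gamma> t"
  using \<gamma>_jet unfolding C3_dominated_def by blast+

lemma \<gamma>_cont: "continuous_on {t0..} \<gamma>"
  by (rule DERIV_continuous_on) (use d\<gamma> in auto)

lemma \<gamma>2_integrable: "t0 \<le> s \<Longrightarrow> (\<lambda>t. (\<gamma> t)\<^sup>2) integrable_on {s..t}"
  by (intro integrable_continuous_interval continuous_intros continuous_on_subset[OF \<gamma>_cont]) auto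

lemma G_diff: "t0 \<le> s \<Longrightarrow> s \<le> t \<Longrightarrow> G t - G s = integral {s..t} (\<lambda>t. (\<gamma> t)\<^sup>2)"
  unfolding G_fun_def
  using Henstock_Kurzweil_Integration.integral_combine[of t0 s t "\<lambda>t. (\<gamma> t)\<^sup>2"] \<gamma>2_integrable[of t0 t] by simp

lemma G_mono: "t0 \<le> s \<Longrightarrow> s \<le> t \<Longrightarrow> G s \<le> G t"
  using G_diff[of s t] integral_nonneg[OF \<gamma>2_integrable, of s t] by simp

lemma G_t0: "G t0 = 0"
  by (simp add: G_fun_def)

lemma G_nonneg: "t0 \<le> t \<Longrightarrow> 0 \<le> G t"
  using G_mono[of t0 t] by (simp add: G_t0)

lemma G_cont: "continuous_on {t0..} G"
  unfolding G_fun_def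
  by (rule DERIV_continuous_on, rule half_line_antiderivative) (auto intro!: continuous_intros \<gamma>_cont)

lemma GS_cont: "continuous_on {t0..} (\<lambda>t. G t * S t)"
  by (intro continuous_intros G_cont S_cont)

lemma S_mono: "t0 \<le> s \<Longrightarrow> s \<le> t \<Longrightarrow> S t \<le> S s"
  using S_anti by (auto simp: monotone_on_def)

lemma GS_bounded_Icc: "\<exists>K. \<forall>t\<in>{t0..T}. G t * S t \<le> K"
proof -
  have "compact ((\<lambda>t. G t * S t) ` {t0..T})"
    by (intro compact_continuous_image continuous_on_subset[OF GS_cont]) auto
  then have "bdd_above ((\<lambda>t. G t * S t) ` {t0..T})"
    by (intro bounded_imp_bdd_above compact_imp_bounded)
  then show ?thesis by (auto simp: bdd_above_def)
qed

lemma GS_large: "\<exists>T\<ge>t0. N < G T * S T"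
  using GS_unbounded by (force simp: bdd_above_def not_le)

text \<open>If \<open>S\<close> became nonpositive, it would stay so, and \<open>G S\<close> would be bounded.\<close>

lemma S_pos: assumes t: "t0 \<le> t" shows "0 < S t"
proof (rule ccontr)
  assume "\<not> 0 < S t"
  obtain K where K: "\<And>s. s \<in> {t0..t} \<Longrightarrow> G s * S s \<le> K" using GS_bounded_Icc by blast
  obtain T where T: "T \<ge> t0" "max K 0 < G T * S T" using GS_large by blast
  show False
  proof (cases "T \<le> t")
    case True then show False using K[of T] T by auto
  next
    case False
    then have "S T \<le> 0" using S_mono[of t T] t \<open>\<not> 0 < S t\<close> by linarith
    then have "G T * S T \<le> 0" using G_nonneg[OF T(1)] by (rule mult_nonneg_nonpos[rotated])
    with T show False by simp
  qed
qed

text \<open>Take a maximum point of \<open>G S\<close> on an interval \<open>[t0, T]\<close> so long that \<open>G S\<close> exceeds at \<open>T\<close> all its values before \<open>N\<close>.\<close>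

lemma record_times: "\<exists>b\<ge>N. t0 \<le> b \<and> M b = G b * S b \<and> N \<le> M b"
proof -
  obtain K where K: "\<And>s. s \<in> {t0..max t0 N} \<Longrightarrow> G s * S s \<le> K" using GS_bounded_Icc by blast
  obtain T where T: "T \<ge> t0" "max K N < G T * S T" using GS_large by blast
  obtain b where b: "b \<in> {t0..T}" "\<And>s. s \<in> {t0..T} \<Longrightarrow> G s * S s \<le> G b * S b"
    using continuous_attains_sup[of "{t0..T}" "\<lambda>t. G t * S t"] T
      continuous_on_subset[OF GS_cont, of "{t0..T}"] by auto
  have big: "max K N < G b * S b" using b(2)[of T] T by auto
  then have "b > max t0 N" using K[of b] b(1) by (cases "b \<le> max t0 N") auto
  moreover have "M b = G b * S b"
    unfolding M_fun_def by (rule cSup_eq_maximum) (use b in auto)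
  ultimately show ?thesis using big b(1) by (intro exI[of _ b]) auto
qed

lemma G_at_top: "filterlim G at_top at_top"
proof (rule filterlim_at_top[THEN iffD2], rule allI)
  fix Z
  have s0: "S t0 > 0" by (rule S_pos) simp
  obtain T where T: "T \<ge> t0" "max 0 Z * S t0 < G T * S T" using GS_large by blast
  have "G T * S T \<le> G T * S t0" using S_mono[of t0 T] G_nonneg T(1) by (intro mult_left_mono) auto
  with T(2) have Z: "max 0 Z < G T" using s0 by (meson less_le_trans mult_less_cancel_right_pos)
  show "eventually (\<lambda>x. Z \<le> G x) at_top"
    by (rule eventually_mono[OF eventually_ge_at_top[of T]]) (use G_mono[of T] T(1) Z in force)
qed

lemma eventually_G_ge: "eventually (\<lambda>b. Z \<le> G b) at_top"
  using G_at_top by (simp add: filterlim_at_top)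

lemma eventually_S_le: "e > 0 \<Longrightarrow> eventually (\<lambda>b. S b \<le> e) at_top"
  using order_tendstoD(2)[OF S_lim, of e] by (auto elim!: eventually_mono)

lemma eventually_ratio_ge: "eventually (\<lambda>b. Z \<le> G b / S b) at_top"
  using eventually_G_ge[of "max Z 0"] eventually_S_le[OF zero_less_one] eventually_ge_at_top[of t0]
proof eventually_elim
  case (elim b)
  have "S b > 0" using S_pos elim by simp
  have "Z * S b \<le> max Z 0 * S b" using \<open>S b > 0\<close> by (intro mult_right_mono) auto
  also have "\<dots> \<le> max Z 0 * 1" using elim by (intro mult_left_mono) auto
  also have "\<dots> \<le> G b" using elim by simp
  finally have "Z * S b \<le> G b" .
  then show ?case using \<open>S b > 0\<close> by (simp add: field_simps)
qed

text \<open>Because \<open>(\<gamma>\<^sup>2)' \<le> 2 L \<gamma>\<^sup>2 = 2 L G'\<close>. This comparison of \<open>\<gamma>\<^sup>2\<close> with its primitive gives the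
frequency condition \<open>\<gamma> \<le> l\<close> and also prevents \<open>G\<close> from concentrating near the end of an interval.\<close>

lemma \<gamma>_sq_le: assumes t: "t0 \<le> t" shows "(\<gamma> t)\<^sup>2 \<le> (\<gamma> t0)\<^sup>2 + 2 * L * G t"
proof -
  have "((\<lambda>s. 2 * L * (\<gamma> s)\<^sup>2 - 2 * \<gamma>1 s * \<gamma> s) has_integral
      (2 * L * G t - (\<gamma> t)\<^sup>2) - (2 * L * G t0 - (\<gamma> t0)\<^sup>2)) {t0..t}"
  proof (rule fundamental_theorem_of_calculus[OF t])
    fix s assume s: "s \<in> {t0..t}"
    have "((\<lambda>s. 2 * L * G s - (\<gamma> s)\<^sup>2) has_real_derivative 2 * L * (\<gamma> s)\<^sup>2 - 2 * \<gamma>1 s * \<gamma> s) (at s within {t0..})"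
    proof -
      have "(G has_real_derivative (\<gamma> s)\<^sup>2) (at s within {t0..})"
        unfolding G_fun_def by (rule half_line_antiderivative) (use s in \<open>auto intro!: continuous_intros \<gamma>_cont\<close>)
      moreover have "(\<gamma> has_real_derivative \<gamma>1 s) (at s within {t0..})" using d\<gamma> s by simp
      ultimately show ?thesis
        by (auto intro!: derivative_eq_intros simp: algebra_simps power2_eq_square)
    qed
    then show "((\<lambda>s. 2 * L * G s - (\<gamma> s)\<^sup>2) has_vector_derivative 2 * L * (\<gamma> s)\<^sup>2 - 2 * \<gamma>1 s * \<gamma> s)
        (at s within {t0..t})"
      unfolding has_real_derivative_iff_has_vector_derivative[symmetric]
      by (rule DERIV_subset) auto
  qed
  moreover have "0 \<le> 2 * L * (\<gamma> s)\<^sup>2 - 2 * \<gamma>1 s * \<gamma> s" if "s \<in> {t0..t}" for s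
  proof -
    have "\<gamma>1 s * \<gamma> s \<le> L * \<gamma> s * \<gamma> s"
      using \<gamma>1_le[of s] \<gamma>_nonneg[of s] that by (intro mult_right_mono) auto
    then show ?thesis by (simp add: power2_eq_square)
  qed
  ultimately have "0 \<le> (2 * L * G t - (\<gamma> t)\<^sup>2) - (2 * L * G t0 - (\<gamma> t0)\<^sup>2)"
    by (rule has_integral_nonneg)
  then show ?thesis by (simp add: G_t0)
qed

lemma eventually_\<gamma>_le_frequency: "eventually (\<lambda>b. \<forall>t\<in>{t0..b}. (\<gamma> t)\<^sup>2 \<le> G b / S b) at_top"
proof -
  define e where "e = 1 / (2 * (2 * L))"
  have e: "e > 0" using L1 by (simp add: e_def)
  show ?thesis
    using eventually_S_le[OF e] eventually_G_ge[of "2 * (\<gamma> t0)\<^sup>2 * S t0"] eventually_ge_at_top[of t0]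
  proof eventually_elim
    case (elim b)
    have sb: "0 < S b" "S b \<le> S t0" using S_pos S_mono[of t0 b] elim by auto
    show ?case
    proof
      fix t assume t: "t \<in> {t0..b}"
      have "(\<gamma> t)\<^sup>2 \<le> (\<gamma> t0)\<^sup>2 + 2 * L * G b"
        using \<gamma>_sq_le[of t] G_mono[of t b] t L1 by (smt (verit) atLeastAtMost_iff mult_left_mono)
      then have "(\<gamma> t)\<^sup>2 * S b \<le> ((\<gamma> t0)\<^sup>2 + 2 * L * G b) * S b" using sb by (intro mult_right_mono) auto
      also have "\<dots> = (\<gamma> t0)\<^sup>2 * S b + G b * (2 * L * S b)" by (simp add: algebra_simps)
      also have "\<dots> \<le> (\<gamma> t0)\<^sup>2 * S t0 + G b * (1 / 2)"
      proof (intro add_mono mult_left_mono)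
        show "2 * L * S b \<le> 1 / 2" using elim(1) L1 by (simp add: e_def field_simps)
      qed (use sb G_nonneg elim in auto)
      also have "\<dots> \<le> G b" using elim(2) by linarith
      finally show "(\<gamma> t)\<^sup>2 \<le> G b / S b" using sb by (simp add: field_simps)
    qed
  qed
qed

definition profile :: "real \<Rightarrow> real \<Rightarrow> real \<Rightarrow> real" where
  "profile a b t = soft_step (t - a) * soft_step (b - t) * (\<gamma> t)\<^sup>2"

lemma profile_jet: "\<exists>f1 f2 f3. C3_dominated t0 ({..a} \<union> {b..}) (\<lambda>t. 2 ^ 21 * L\<^sup>2 * (\<gamma> t)\<^sup>2) (profile a b) f1 f2 f3"
  using cutoff_profile[OF \<gamma>_jet] unfolding profile_def .

text \<open>The width of the zones at the ends of an interval in which the cutoff is disregarded: \<open>G\<close> grows by at most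
\<open>\<eta> * ((\<gamma> t0)\<^sup>2 + 2 L G)\<close> there, and with this choice that is at most \<open>G / 4\<close> eventually.\<close>

definition \<eta> :: real where "\<eta> = 1 / (16 * L)"

lemma \<eta>: "0 < \<eta>" "\<eta> \<le> 1"
  using L1 by (auto simp: \<eta>_def field_simps)

lemma eventually_profile_mass:
  assumes a: "t0 \<le> a"
  shows "eventually (\<lambda>b. (soft_step \<eta>)\<^sup>2 / 2 * G b \<le> integral {t0..b} (profile a b)) at_top"
  using eventually_ge_at_top[of "a + 2"] eventually_G_ge[of "4 * G (a + 1)"] eventually_G_ge[of "(\<gamma> t0)\<^sup>2"]
proof eventually_elim
  case (elim b)
  have G0: "0 \<le> G b" using G_nonneg elim a by simp
  have order: "t0 \<le> a + \<eta>" "a + \<eta> \<le> b - \<eta>" "b - \<eta> \<le> b" using a elim \<eta> by auto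
  have "G b - G (b - \<eta>) = integral {b - \<eta>..b} (\<lambda>t. (\<gamma> t)\<^sup>2)"
    by (rule G_diff) (use order in auto)
  also have "\<dots> \<le> integral {b - \<eta>..b} (\<lambda>t. (\<gamma> t0)\<^sup>2 + 2 * L * G b)"
  proof (rule integral_le)
    show "(\<lambda>t. (\<gamma> t)\<^sup>2) integrable_on {b - \<eta>..b}" using order by (intro \<gamma>2_integrable) auto
    show "(\<gamma> t)\<^sup>2 \<le> (\<gamma> t0)\<^sup>2 + 2 * L * G b" if t: "t \<in> {b - \<eta>..b}" for t
    proof -
      have "t0 \<le> t" using t order by auto
      moreover have "2 * L * G t \<le> 2 * L * G b"
        using G_mono[of t b] t \<open>t0 \<le> t\<close> L1 by (intro mult_left_mono) auto
      ultimately show ?thesis using \<gamma>_sq_le[of t] by linarith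
    qed
  qed (rule integrable_const_ivl)
  also have "\<dots> = \<eta> * ((\<gamma> t0)\<^sup>2 + 2 * L * G b)" using \<eta> by simp
  also have "\<dots> = \<eta> * (\<gamma> t0)\<^sup>2 + G b / 8" using L1 by (simp add: \<eta>_def field_simps)
  also have "\<eta> * (\<gamma> t0)\<^sup>2 \<le> 1 / 16 * G b"
    using elim(3) L1 \<eta> by (intro mult_mono) (auto simp: \<eta>_def field_simps)
  finally have loss: "G b - G (b - \<eta>) \<le> G b / 4" using G0 by linarith
  have "G (a + \<eta>) \<le> G (a + 1)" using G_mono a \<eta> by simp
  then have mass: "G b / 2 \<le> G (b - \<eta>) - G (a + \<eta>)" using loss elim(2) by linarith
  have cont: "continuous_on {t0..} (profile a b)"
  proof -
    obtain f1 f2 f3 where "C3_dominated t0 ({..a} \<union> {b..}) (\<lambda>t. 2 ^ 21 * L\<^sup>2 * (\<gamma> t)\<^sup>2) (profile a b) f1 f2 f3"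
      using profile_jet by blast
    then show ?thesis unfolding C3_dominated_def by (intro DERIV_continuous_on) auto
  qed
  have "(soft_step \<eta>)\<^sup>2 * (G b / 2) \<le> (soft_step \<eta>)\<^sup>2 * (G (b - \<eta>) - G (a + \<eta>))"
    by (intro mult_left_mono mass) simp
  also have "\<dots> = integral {a + \<eta>..b - \<eta>} (\<lambda>t. (soft_step \<eta>)\<^sup>2 * (\<gamma> t)\<^sup>2)"
    using G_diff[OF order(1,2)] by simp
  also have "\<dots> \<le> integral {a + \<eta>..b - \<eta>} (profile a b)"
  proof (rule integral_le)
    show "(\<lambda>t. (soft_step \<eta>)\<^sup>2 * (\<gamma> t)\<^sup>2) integrable_on {a + \<eta>..b - \<eta>}"
      by (intro integrable_on_mult_right \<gamma>2_integrable order)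
    show "profile a b integrable_on {a + \<eta>..b - \<eta>}"
      by (intro integrable_continuous_interval continuous_on_subset[OF cont]) (use order in auto)
    show "(soft_step \<eta>)\<^sup>2 * (\<gamma> t)\<^sup>2 \<le> profile a b t" if "t \<in> {a + \<eta>..b - \<eta>}" for t
      unfolding profile_def power2_eq_square[of "soft_step \<eta>"]
      by (intro mult_right_mono mult_mono soft_step_mono soft_step_nonneg) (use that in auto)
  qed
  also have "\<dots> \<le> integral {t0..b} (profile a b)"
  proof (rule integral_subset_le)
    show "profile a b integrable_on {a + \<eta>..b - \<eta>}" "profile a b integrable_on {t0..b}"
      by (intro integrable_continuous_interval continuous_on_subset[OF cont]; use order in auto)+
    show "\<forall>t\<in>{t0..b}. 0 \<le> profile a b t"
      unfolding profile_def by (intro ballI mult_nonneg_nonneg soft_step_nonneg) auto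
  qed (use order in auto)
  finally show ?case by simp
qed

text \<open>The frequency at which the budget \<open>S b\<close> for the deviation of the speed is just used up.\<close>

definition frequency :: "real \<Rightarrow> real" where "frequency b = sqrt (G b / S b)"

text \<open>Half of the cutoff mass \<open>(soft_step \<eta>)\<^sup>2 / 2\<close> survives averaging, and half of that the oscillating error.\<close>

definition gain :: real where "gain = (soft_step \<eta>)\<^sup>2 / 8"

lemma gain_pos: "0 < gain"
  using soft_step_pos[OF \<eta>(1)] by (simp add: gain_def)

text \<open>The exponent is a multiple of \<open>G b / frequency b = sqrt (G b * S b)\<close>; the averaging error is small because the
frequency tends to infinity.\<close>

lemma eventually_growth:
  assumes a: "t0 \<le> a" and \<kappa>: "0 < \<kappa>" and \<delta>: "0 \<le> \<delta>"
  shows "eventually (\<lambda>b. gain * \<delta> * sqrt (G b * S b)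
    \<le> \<delta> / frequency b * integral {t0..b} (\<lambda>t. profile a b t * (sin (\<kappa> * frequency b * (t - a)))\<^sup>2)) at_top"
proof -
  define C where "C = 2 ^ 21 * L\<^sup>2"
  define c1 where "c1 = (soft_step \<eta>)\<^sup>2 / 2"
  have c1: "c1 > 0" using soft_step_pos[OF \<eta>(1)] by (simp add: c1_def)
  have C: "C > 0" using L1 by (simp add: C_def)
  show ?thesis
    using eventually_profile_mass[OF a] eventually_ge_at_top[of a] eventually_ratio_ge[of "(C / c1 / \<kappa>)\<^sup>2"]
      eventually_G_ge[of 1]
  proof eventually_elim
    case (elim b)
    have b: "t0 \<le> b" using a elim by simp
    have pos: "G b > 0" "S b > 0" using elim(4) S_pos[OF b] by auto
    define l where "l = frequency b"
    have lpos: "l > 0" using pos by (simp add: l_def frequency_def)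
    have "C / c1 / \<kappa> \<le> l"
      unfolding l_def frequency_def by (rule real_le_rsqrt) (use elim(3) in simp)
    then have m: "C \<le> c1 * (\<kappa> * l)" using \<kappa> c1 by (simp add: field_simps)
    have mpos: "\<kappa> * l > 0" using \<kappa> lpos by simp
    obtain f1 f2 f3 where f: "C3_dominated t0 ({..a} \<union> {b..}) (\<lambda>t. C * (\<gamma> t)\<^sup>2) (profile a b) f1 f2 f3"
      using profile_jet unfolding C_def by blast
    have "C / (4 * (\<kappa> * l)) * G b \<le> c1 / 4 * G b"
      using m mpos pos by (intro mult_right_mono) (auto simp: field_simps)
    then have "c1 / 4 * G b \<le> integral {t0..b} (profile a b) / 2 - C / (4 * (\<kappa> * l)) * G b"
      using elim(1) unfolding c1_def[symmetric] by linarith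
    also have "\<dots> \<le> integral {t0..b} (\<lambda>t. profile a b t * (sin (\<kappa> * l * (t - a)))\<^sup>2)"
      by (rule resonant_integral_lower_bound[OF f \<gamma>_cont a elim(2) mpos])
    finally have "\<delta> / l * (c1 / 4 * G b) \<le> \<delta> / l * integral {t0..b} (\<lambda>t. profile a b t * (sin (\<kappa> * l * (t - a)))\<^sup>2)"
      using \<delta> lpos by (intro mult_left_mono) auto
    moreover have "\<delta> / l * (c1 / 4 * G b) = gain * \<delta> * sqrt (G b * S b)"
    proof -
      have "G b / l = sqrt (G b * S b)"
      proof -
        have "sqrt (G b * S b) * l = sqrt ((G b)\<^sup>2)"
          unfolding l_def frequency_def real_sqrt_mult[symmetric] using pos by (simp add: power2_eq_square)
        then have "sqrt (G b * S b) * l = G b" using pos by simp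
        then show ?thesis using lpos by (simp add: field_simps)
      qed
      then show ?thesis using lpos by (simp add: gain_def c1_def field_simps)
    qed
    ultimately show ?case unfolding l_def by simp
  qed
qed

text \<open>What is required of a resonance interval \<open>[a, b]\<close>: \<open>z0\<close> is the bound beyond which the spectrum is full, \<open>K\<close> is the loss
that half of the exponent has to compensate, and the gap of \<open>2\<close> between consecutive squared frequencies
keeps the spectral windows of different intervals apart.\<close>

definition resonance_step :: "real \<Rightarrow> real \<Rightarrow> real \<Rightarrow> real \<Rightarrow> real \<Rightarrow> real \<Rightarrow> bool" where
  "resonance_step \<kappa> \<delta> z0 K a b \<longleftrightarrow> a + 1 \<le> b \<and> S b \<le> S a / 2 \<and> M b = G b * S b
    \<and> 2 \<le> G b / S b \<and> z0 < G b / S b \<and> G a / S a + 2 \<le> G b / S b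
    \<and> (\<forall>t\<in>{t0..b}. (\<gamma> t)\<^sup>2 \<le> G b / S b)
    \<and> gain * \<delta> * sqrt (M b)
        \<le> \<delta> / frequency b * integral {t0..b} (\<lambda>t. profile a b t * (sin (\<kappa> * frequency b * (t - a)))\<^sup>2)
    \<and> K \<le> exp (gain * \<delta> * sqrt (M b))"

lemma resonance_step_exists:
  assumes a: "t0 \<le> a" and \<kappa>: "0 < \<kappa>" and \<delta>: "0 < \<delta>"
  shows "\<exists>b. resonance_step \<kappa> \<delta> z0 K a b"
proof -
  have Sa: "S a > 0" by (rule S_pos[OF a])
  have "eventually (\<lambda>b. a + 1 \<le> b \<and> S b \<le> S a / 2 \<and> 2 \<le> G b / S b \<and> z0 + 1 \<le> G b / S b
    \<and> G a / S a + 2 \<le> G b / S b \<and> (\<forall>t\<in>{t0..b}. (\<gamma> t)\<^sup>2 \<le> G b / S b)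
    \<and> gain * \<delta> * sqrt (G b * S b)
        \<le> \<delta> / frequency b * integral {t0..b} (\<lambda>t. profile a b t * (sin (\<kappa> * frequency b * (t - a)))\<^sup>2)) at_top"
    (is "eventually ?P at_top")
    by (intro eventually_conj eventually_ge_at_top eventually_S_le eventually_ratio_ge
        eventually_\<gamma>_le_frequency eventually_growth a \<kappa>) (use Sa \<delta> in auto)
  then obtain N where N: "\<And>b. b \<ge> N \<Longrightarrow> ?P b"
    unfolding eventually_at_top_linorder by blast
  define R where "R = \<bar>K\<bar> / (gain * \<delta>)"
  have gd: "gain * \<delta> > 0" using gain_pos \<delta> by simp
  obtain b where b: "b \<ge> max N (R\<^sup>2)" "M b = G b * S b" "max N (R\<^sup>2) \<le> M b"
    using record_times by blast
  have "R \<le> sqrt (M b)" by (rule real_le_rsqrt) (use b(3) in simp)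
  then have "\<bar>K\<bar> \<le> gain * \<delta> * sqrt (M b)" using gd by (simp add: R_def field_simps)
  also have "\<dots> \<le> exp (gain * \<delta> * sqrt (M b))"
    using exp_ge_add_one_self[of "gain * \<delta> * sqrt (M b)"] by linarith
  finally have "K \<le> exp (gain * \<delta> * sqrt (M b))" by simp
  with N[of b] b show ?thesis unfolding resonance_step_def by (intro exI[of _ b]) auto
qed

lemma resonance_sequence:
  assumes \<kappa>: "0 < \<kappa>" and \<delta>: "0 < \<delta>"
  obtains b :: "nat \<Rightarrow> real" where "b 0 = t0"
    "\<And>k. resonance_step \<kappa> \<delta> z0 (K k (b k)) (b k) (b (Suc k))"
proof -
  have "\<exists>b. \<forall>n. (t0 \<le> b n \<and> (n = 0 \<longrightarrow> b n = t0)) \<and> resonance_step \<kappa> \<delta> z0 (K n (b n)) (b n) (b (Suc n))"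
  proof (rule dependent_nat_choice)
    show "\<exists>x. t0 \<le> x \<and> ((0::nat) = 0 \<longrightarrow> x = t0)" by auto
    fix x :: real and n :: nat assume "t0 \<le> x \<and> (n = 0 \<longrightarrow> x = t0)"
    then have x: "t0 \<le> x" by simp
    obtain y where y: "resonance_step \<kappa> \<delta> z0 (K n x) x y"
      using resonance_step_exists[OF x \<kappa> \<delta>] by blast
    then have "t0 \<le> y" using x unfolding resonance_step_def by linarith
    with y show "\<exists>y. (t0 \<le> y \<and> (Suc n = 0 \<longrightarrow> y = t0)) \<and> resonance_step \<kappa> \<delta> z0 (K n x) x y" by auto
  qed
  then show ?thesis using that by blast
qed

end

section \<open>Gluing the resonances into one propagation speed\<close>

text \<open>By monotone convergence along \<open>[t, t + k]\<close>.\<close>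

lemma nonneg_integrable_half_line:
  fixes f :: "real \<Rightarrow> real"
  assumes f: "continuous_on {t..} f" and f0: "\<And>x. t \<le> x \<Longrightarrow> 0 \<le> f x"
    and B: "\<And>x. t \<le> x \<Longrightarrow> integral {t..x} f \<le> B"
  shows "f integrable_on {t..}" "integral {t..} f \<le> B"
proof -
  define g where "g k x = (if x \<in> {t..t + real k} then f x else 0)" for k x
  have int: "f integrable_on {t..x}" for x
    by (rule integrable_continuous_interval) (auto intro: continuous_on_subset[OF f])
  have g: "(g k has_integral integral {t..t + real k} f) {t..}" for k
    unfolding g_def by (subst has_integral_restrict) (auto intro: integrable_integral int)
  have gi: "integral {t..} (g k) = integral {t..t + real k} f" for k
    using g by (rule integral_unique)
  have gb: "integral {t..} (g k) \<le> B" "0 \<le> integral {t..} (g k)" for k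
    unfolding gi using B[of "t + real k"] by (auto intro!: integral_nonneg int f0)
  have *: "f integrable_on {t..} \<and> (\<lambda>k. integral {t..} (g k)) \<longlonglongrightarrow> integral {t..} f"
  proof (rule monotone_convergence_increasing)
    show "g k integrable_on {t..}" for k using g by (rule has_integral_integrable)
    show "g k x \<le> g (Suc k) x" if "x \<in> {t..}" for k x using that f0[of x] by (auto simp: g_def)
    show "(\<lambda>k. g k x) \<longlonglongrightarrow> f x" if "x \<in> {t..}" for x
    proof (rule tendsto_eventually)
      obtain n where n: "x - t \<le> real n" using real_arch_simple by blast
      show "eventually (\<lambda>k. g k x = f x) sequentially"
        using eventually_ge_at_top[of n] by eventually_elim (use that n in \<open>auto simp: g_def\<close>)
    qed
    show "bounded (range (\<lambda>k. integral {t..} (g k)))"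
      unfolding bounded_real using gb by (intro exI[of _ B]) auto
  qed
  then show "f integrable_on {t..}" by simp
  show "integral {t..} f \<le> B"
    by (rule LIMSEQ_le_const2[OF conjunct2[OF *]]) (use gb in auto)
qed

text \<open>The pieces live on consecutive intervals, so at each time at most one of them is nonzero, and up to any given time only
finitely many are. Infinite sums of such pieces can therefore be differentiated and evaluated termwise.\<close>

lemma suminf_locally_finite:
  fixes b :: "nat \<Rightarrow> real" and f :: "nat \<Rightarrow> real \<Rightarrow> real"
  assumes mono: "incseq b" and supp: "\<And>k t. t \<le> b k \<Longrightarrow> f k t = 0" and t: "t \<le> b n"
  shows "(\<Sum>k. f k t) = (\<Sum>k<n. f k t)"
proof (rule suminf_finite)
  show "f k t = 0" if "k \<notin> {..<n}" for k
    using supp[of t k] t incseqD[OF mono, of n k] that by auto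
qed simp

lemma suminf_disjoint_supports:
  fixes b :: "nat \<Rightarrow> real" and f :: "nat \<Rightarrow> real \<Rightarrow> real"
  assumes mono: "incseq b" and supp: "\<And>k t. t \<le> b k \<or> b (Suc k) \<le> t \<Longrightarrow> f k t = 0"
    and t: "b k \<le> t" "t \<le> b (Suc k)"
  shows "(\<Sum>j. f j t) = f k t"
proof -
  have "(\<Sum>j. f j t) = (\<Sum>j\<in>{k}. f j t)"
  proof (rule suminf_finite)
    show "f j t = 0" if "j \<notin> {k}" for j
      using supp[of t j] t incseqD[OF mono, of "Suc j" k] incseqD[OF mono, of "Suc k" j] that
      by (cases "j < k") auto
  qed simp
  then show ?thesis by simp
qed

lemma suminf_locally_finite_has_derivative:
  fixes b :: "nat \<Rightarrow> real" and f f' :: "nat \<Rightarrow> real \<Rightarrow> real"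
  assumes mono: "incseq b" and supp: "\<And>k t. t \<le> b k \<Longrightarrow> f k t = 0" "\<And>k t. t \<le> b k \<Longrightarrow> f' k t = 0"
    and unbounded: "\<And>t. \<exists>n. t < b n"
    and d: "\<And>k. (f k has_real_derivative f' k t) (at t within A)" and t: "t \<in> A"
  shows "((\<lambda>t. \<Sum>k. f k t) has_real_derivative (\<Sum>k. f' k t)) (at t within A)"
proof -
  obtain n where n: "t < b n" using unbounded by blast
  have "((\<lambda>t. \<Sum>k<n. f k t) has_real_derivative (\<Sum>k<n. f' k t)) (at t within A)"
    by (rule DERIV_sum) (rule d)
  moreover have "(\<Sum>k<n. f' k t) = (\<Sum>k. f' k t)"
    using suminf_locally_finite[where f = f' and t = t and n = n, OF mono supp(2)] n by simp
  ultimately have "((\<lambda>t. \<Sum>k<n. f k t) has_real_derivative (\<Sum>k. f' k t)) (at t within A)" by simp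
  then show ?thesis
  proof (rule has_field_derivative_transform_within[where d = "b n - t"])
    show "(\<Sum>k<n. f k s) = (\<Sum>k. f k s)" if "dist s t < b n - t" for s
      using that suminf_locally_finite[where f = f and t = s and n = n, OF mono supp(1)] by (auto simp: dist_real_def)
  qed (use n t in auto)
qed

lemma suminf_locally_finite_continuous_on:
  fixes b :: "nat \<Rightarrow> real" and f :: "nat \<Rightarrow> real \<Rightarrow> real"
  assumes mono: "incseq b" and supp: "\<And>k t. t \<le> b k \<Longrightarrow> f k t = 0"
    and unbounded: "\<And>t. \<exists>n. t < b n"
    and c: "\<And>k. continuous_on A (f k)"
  shows "continuous_on A (\<lambda>t. \<Sum>k. f k t)"
  unfolding continuous_on_eq_continuous_within
proof
  fix t assume t: "t \<in> A"
  obtain n where n: "t < b n" using unbounded by blast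
  have "continuous (at t within A) (\<lambda>t. \<Sum>k<n. f k t)"
    using c t by (intro continuous_sum) (auto simp: continuous_on_eq_continuous_within)
  then show "continuous (at t within A) (\<lambda>t. \<Sum>k. f k t)"
  proof (rule continuous_transform_within[where \<delta> = "b n - t"])
    show "(\<Sum>k<n. f k s) = (\<Sum>k. f k s)" if "dist s t < b n - t" for s
      using that suminf_locally_finite[where f = f and t = s and n = n, OF mono supp] by (auto simp: dist_real_def)
  qed (use t n in auto)
qed

context speed_data
begin

lemma resonant_piece_exists:
  assumes step: "resonance_step \<kappa> \<delta> z0 K a b" and a: "t0 \<le> a" and \<kappa>: "0 < \<kappa>" and \<delta>: "0 < \<delta>"
    and small: "\<delta> * (2 ^ 21 * L\<^sup>2) * (8 * \<kappa> ^ 3 + 16 * \<kappa>\<^sup>2 + 12 * \<kappa> + 5) \<le> d" and d: "d \<le> 1"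
  shows "\<exists>p p1 p2 V V1. resonant_piece t0 \<gamma> \<kappa> (G b / S b) d a b p p1 p2 V V1 \<and>
    exp (2 * (gain * \<delta> * sqrt (M b))) \<le> (V1 b)\<^sup>2 + \<kappa>\<^sup>2 * (G b / S b) * (V b)\<^sup>2"
proof -
  obtain f1 f2 f3 where f: "C3_dominated t0 ({..a} \<union> {b..}) (\<lambda>t. 2 ^ 21 * L\<^sup>2 * (\<gamma> t)\<^sup>2) (profile a b) f1 f2 f3"
    using profile_jet by blast
  have ab: "a \<le> b" and r2: "2 \<le> G b / S b" and \<gamma>r: "\<And>t. t \<in> {t0..b} \<Longrightarrow> (\<gamma> t)\<^sup>2 \<le> G b / S b"
    and gr: "gain * \<delta> * sqrt (M b)
        \<le> \<delta> / frequency b * integral {t0..b} (\<lambda>t. profile a b t * (sin (\<kappa> * frequency b * (t - a)))\<^sup>2)"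
    using step unfolding resonance_step_def by auto
  have l1: "1 \<le> frequency b" unfolding frequency_def by (rule real_le_rsqrt) (use r2 in simp)
  have l2: "(frequency b)\<^sup>2 = G b / S b" unfolding frequency_def using r2 by simp
  have \<gamma>l: "\<gamma> t \<le> frequency b" if "t \<in> {t0..b}" for t
    unfolding frequency_def by (rule real_le_rsqrt[OF \<gamma>r[OF that]])
  have C0: "0 \<le> 2 ^ 21 * L\<^sup>2" by simp
  have \<delta>0: "0 \<le> \<delta>" using \<delta> by simp
  have "exp (2 * (gain * \<delta> * sqrt (M b))) \<le> exp (2 * (\<delta> / frequency b)
      * integral {t0..b} (\<lambda>t. profile a b t * (sin (\<kappa> * frequency b * (t - a)))\<^sup>2))"
    using gr by (simp add: mult.assoc)
  then show ?thesis
    using resonant_block[OF f a ab \<kappa> l1 \<gamma>_nonneg \<gamma>l C0 \<delta>0 small d] unfolding l2 by force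
qed

text \<open>The solution has energy \<open>1\<close> at \<open>a\<close>, so the last bound is the factor by which the interval amplifies the resonant mode.\<close>

definition amplifying :: "real \<Rightarrow> real \<Rightarrow> (real \<Rightarrow> real) \<Rightarrow> real \<Rightarrow> real \<Rightarrow> bool" where
  "amplifying \<kappa> \<delta> c a b \<longleftrightarrow> (\<exists>V V1. V a = 0 \<and> V1 a = 1 \<and>
    (\<forall>t\<in>{a..b}. (V has_real_derivative V1 t) (at t within {a..b}) \<and>
      (V1 has_real_derivative - c t * (G b / S b) * V t) (at t within {a..b})) \<and>
    exp (2 * (gain * \<delta> * sqrt (M b))) \<le> (V1 b)\<^sup>2 + \<kappa>\<^sup>2 * (G b / S b) * (V b)\<^sup>2)"

text \<open>On the interval that ends at \<open>b (k+1)\<close> the deviation integrates to at most \<open>d * S (b (k+1))\<close>, by the choice of the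
frequency. Since \<open>S (b (k+1)) \<le> S (b k) - S (b (k+1))\<close>, the later intervals together contribute at most \<open>S (b (k+1)) / 2\<close>, so the
integral from any time in the interval is at most \<open>S (b (k+1))\<close>, and \<open>S\<close> is nonincreasing.\<close>

lemma resonant_speed:
  fixes b :: "nat \<Rightarrow> real"
  assumes b0: "b 0 = t0" and step: "\<And>k. resonance_step \<kappa> \<delta> z0 (K k) (b k) (b (Suc k))"
    and \<kappa>: "0 < \<kappa>" and \<delta>: "0 < \<delta>"
    and small: "\<delta> * (2 ^ 21 * L\<^sup>2) * (8 * \<kappa> ^ 3 + 16 * \<kappa>\<^sup>2 + 12 * \<kappa> + 5) \<le> d" and d: "d \<le> 1 / 2"
  obtains c c1 c2 where
    "\<And>t. t \<ge> t0 \<Longrightarrow> (c has_real_derivative c1 t) (at t within {t0..})"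
    "\<And>t. t \<ge> t0 \<Longrightarrow> (c1 has_real_derivative c2 t) (at t within {t0..})"
    "continuous_on {t0..} c2"
    "\<And>t. t \<ge> t0 \<Longrightarrow> \<bar>c t - \<kappa>\<^sup>2\<bar> \<le> d \<and> \<bar>c1 t\<bar> \<le> \<gamma> t \<and> \<bar>c2 t\<bar> \<le> (\<gamma> t)\<^sup>2"
    "\<And>k. c (b k) = \<kappa>\<^sup>2"
    "asymptotic_speed t0 S c (\<kappa>\<^sup>2)"
    "\<And>k. amplifying \<kappa> \<delta> c (b k) (b (Suc k))"
proof -
  have bS: "b k + 1 \<le> b (Suc k)" for k using step[of k] by (simp add: resonance_step_def)
  have inc: "incseq b" using bS by (intro incseq_SucI) (smt (verit))
  have bk: "t0 + real k \<le> b k" for k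
  proof (induction k)
    case (Suc k) then show ?case using bS[of k] by simp
  qed (simp add: b0)
  have bt: "t0 \<le> b k" for k using bk[of k] by simp
  have unb: "\<exists>n. t < b n" for t
  proof -
    obtain n where "t - t0 < real n" using reals_Archimedean2 by blast
    then show ?thesis using bk[of n] by (intro exI[of _ n]) linarith
  qed
  have d1: "d \<le> 1" using d by simp
  have "\<forall>k. \<exists>p p1 p2 V V1. resonant_piece t0 \<gamma> \<kappa> (G (b (Suc k)) / S (b (Suc k))) d (b k) (b (Suc k)) p p1 p2 V V1 \<and>
      exp (2 * (gain * \<delta> * sqrt (M (b (Suc k)))))
        \<le> (V1 (b (Suc k)))\<^sup>2 + \<kappa>\<^sup>2 * (G (b (Suc k)) / S (b (Suc k))) * (V (b (Suc k)))\<^sup>2"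
    using resonant_piece_exists[OF step bt \<kappa> \<delta> small d1] by blast
  then obtain p p1 p2 V V1 where P': "\<And>k. resonant_piece t0 \<gamma> \<kappa> (G (b (Suc k)) / S (b (Suc k))) d
        (b k) (b (Suc k)) (p k) (p1 k) (p2 k) (V k) (V1 k)"
    and V_growth: "\<And>k. exp (2 * (gain * \<delta> * sqrt (M (b (Suc k)))))
        \<le> (V1 k (b (Suc k)))\<^sup>2 + \<kappa>\<^sup>2 * (G (b (Suc k)) / S (b (Suc k))) * (V k (b (Suc k)))\<^sup>2"
    unfolding choice_iff by blast
  have dp: "(p k has_real_derivative p1 k t) (at t within {t0..})"
    and dp1: "(p1 k has_real_derivative p2 k t) (at t within {t0..})"
    and pb: "\<bar>p k t\<bar> \<le> d * (\<gamma> t)\<^sup>2 / (G (b (Suc k)) / S (b (Suc k))) \<and> \<bar>p k t\<bar> \<le> d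
      \<and> \<bar>p1 k t\<bar> \<le> \<gamma> t \<and> \<bar>p2 k t\<bar> \<le> (\<gamma> t)\<^sup>2"
    and dV: "(V k has_real_derivative V1 k t) (at t within {t0..})"
      "(V1 k has_real_derivative - (\<kappa>\<^sup>2 + p k t) * (G (b (Suc k)) / S (b (Suc k))) * V k t) (at t within {t0..})"
    if "t \<ge> t0" for k t
    using P'[of k] that unfolding resonant_piece_def by blast+
  have cp2: "continuous_on {t0..} (p2 k)"
    and supp: "\<And>t. t \<le> b k \<or> b (Suc k) \<le> t \<Longrightarrow> p k t = 0 \<and> p1 k t = 0 \<and> p2 k t = 0"
    and Vb: "V k (b k) = 0" "V1 k (b k) = 1" for k
    using P'[of k] unfolding resonant_piece_def by blast+
  define c where "c t = \<kappa>\<^sup>2 + (\<Sum>k. p k t)" for t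
  define c1 where "c1 t = (\<Sum>k. p1 k t)" for t
  define c2 where "c2 t = (\<Sum>k. p2 k t)" for t
  have dc: "(c has_real_derivative c1 t) (at t within {t0..})" if "t \<ge> t0" for t
  proof -
    have "((\<lambda>t. \<Sum>k. p k t) has_real_derivative c1 t) (at t within {t0..})"
      unfolding c1_def by (rule suminf_locally_finite_has_derivative[where b = b and f = p and f' = p1, OF inc _ _ unb dp[OF that]])
        (use supp that in auto)
    from DERIV_add[OF DERIV_const this, of "\<kappa>\<^sup>2"] show ?thesis unfolding c_def by simp
  qed
  have dc1: "(c1 has_real_derivative c2 t) (at t within {t0..})" if "t \<ge> t0" for t
    unfolding c1_def c2_def
    by (rule suminf_locally_finite_has_derivative[where b = b and f = p1 and f' = p2, OF inc _ _ unb dp1[OF that]])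
      (use supp that in auto)
  have cc2: "continuous_on {t0..} c2"
    unfolding c2_def by (rule suminf_locally_finite_continuous_on[where b = b and f = p2, OF inc _ unb cp2]) (use supp in auto)
  have cc: "continuous_on {t0..} c" by (rule DERIV_continuous_on) (use dc in auto)
  have on_block: "c t = \<kappa>\<^sup>2 + p k t" "c1 t = p1 k t" "c2 t = p2 k t" if "t \<in> {b k..b (Suc k)}" for t k
    unfolding c_def c1_def c2_def
    using suminf_disjoint_supports[where f = p and k = k and t = t, OF inc] suminf_disjoint_supports[where f = p1 and k = k and t = t, OF inc]
      suminf_disjoint_supports[where f = p2 and k = k and t = t, OF inc] supp that by auto
  have block: "\<exists>k. b k \<le> t \<and> t < b (Suc k)" if "t \<ge> t0" for t
  proof -
    define n where "n = (LEAST n. t < b n)"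
    have n: "t < b n" unfolding n_def using unb[of t] by (rule LeastI_ex)
    then have "n \<noteq> 0" using that b0 by (cases n) auto
    then obtain k where k: "n = Suc k" by (cases n) auto
    have "\<not> t < b k" using not_less_Least[of k "\<lambda>n. t < b n"] k unfolding n_def by simp
    then show ?thesis using n k by (intro exI[of _ k]) auto
  qed
  have bounds: "\<bar>c t - \<kappa>\<^sup>2\<bar> \<le> d \<and> \<bar>c1 t\<bar> \<le> \<gamma> t \<and> \<bar>c2 t\<bar> \<le> (\<gamma> t)\<^sup>2" if t: "t \<ge> t0" for t
  proof -
    obtain k where k: "b k \<le> t" "t < b (Suc k)" using block[OF t] by blast
    then have "t \<in> {b k..b (Suc k)}" by simp
    from on_block[OF this] pb[OF t, of k] show ?thesis by simp
  qed
  have cb: "c (b k) = \<kappa>\<^sup>2" for k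
    using on_block(1)[of "b k" k] bS[of k] supp[of "b k" k] by simp
  define I where "I t = \<bar>c t - \<kappa>\<^sup>2\<bar>" for t
  have cI: "continuous_on {t0..} I" unfolding I_def by (intro continuous_intros cc)
  have intI: "I integrable_on {s..t}" if "t0 \<le> s" for s t
    by (intro integrable_continuous_interval continuous_on_subset[OF cI]) (use that in auto)
  have I0: "0 \<le> I t" for t by (simp add: I_def)
  have d0: "0 \<le> d" using bounds[of t0] by linarith
  have blockI: "integral {b k..b (Suc k)} I \<le> S (b (Suc k)) / 2" for k
  proof -
    define r where "r = G (b (Suc k)) / S (b (Suc k))"
    have r: "r \<ge> 2" using step[of k] by (simp add: resonance_step_def r_def)
    have sp: "S (b (Suc k)) > 0" by (rule S_pos[OF bt])
    have "integral {b k..b (Suc k)} I \<le> integral {b k..b (Suc k)} (\<lambda>t. d / r * (\<gamma> t)\<^sup>2)"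
    proof (rule integral_le)
      show "I integrable_on {b k..b (Suc k)}" by (rule intI[OF bt])
      show "(\<lambda>t. d / r * (\<gamma> t)\<^sup>2) integrable_on {b k..b (Suc k)}"
        by (intro integrable_on_mult_right \<gamma>2_integrable bt)
      show "I t \<le> d / r * (\<gamma> t)\<^sup>2" if "t \<in> {b k..b (Suc k)}" for t
        using on_block(1)[OF that] pb[of t k] that bt[of k] by (simp add: I_def r_def mult_ac)
    qed
    also have "\<dots> = d / r * (G (b (Suc k)) - G (b k))"
      using G_diff[OF bt[of k], of "b (Suc k)"] bS[of k] by simp
    also have "\<dots> \<le> d / r * G (b (Suc k))"
      using G_nonneg[OF bt[of k]] d0 r by (intro mult_left_mono) auto
    also have "\<dots> = d * S (b (Suc k))" using r sp by (auto simp: r_def field_simps)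
    also have "\<dots> \<le> 1 / 2 * S (b (Suc k))" using d sp by (intro mult_right_mono) auto
    finally show ?thesis by simp
  qed
  have comb: "integral {s..t} I + integral {t..u} I = integral {s..u} I" if "t0 \<le> s" "s \<le> t" "t \<le> u" for s t u
    using that by (intro Henstock_Kurzweil_Integration.integral_combine intI) auto
  have tail: "integral {b k..b (k + n)} I \<le> (S (b k) - S (b (k + n))) / 2" for k n
  proof (induction n)
    case (Suc n)
    have "integral {b k..b (k + Suc n)} I = integral {b k..b (k + n)} I + integral {b (k + n)..b (Suc (k + n))} I"
      using comb[of "b k" "b (k + n)" "b (Suc (k + n))"] bt[of k] incseqD[OF inc, of k "k + n"] bS[of "k + n"] by simp
    moreover have "S (b (Suc (k + n))) \<le> S (b (k + n)) / 2"
      using step[of "k + n"] by (simp add: resonance_step_def)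
    ultimately show ?case using Suc.IH blockI[of "k + n"] by simp
  qed simp
  have asy: "asymptotic_speed t0 S c (\<kappa>\<^sup>2)"
    unfolding asymptotic_speed_def I_def[symmetric]
  proof (intro allI impI)
    fix t assume t: "t0 \<le> t"
    obtain k where k: "b k \<le> t" "t < b (Suc k)" using block[OF t] by blast
    have le: "integral {t..x} I \<le> S t" if x: "t \<le> x" for x
    proof -
      obtain n where n: "x < b n" using unb by blast
      define N where "N = Suc k + n"
      have N: "x \<le> b N" using n incseqD[OF inc, of n N] by (simp add: N_def)
      have kN: "b (Suc k) \<le> b N" using incseqD[OF inc, of "Suc k" N] by (simp add: N_def)
      have "integral {t..x} I \<le> integral {t..b N} I"
        using N t by (intro integral_subset_le intI) (auto simp: I0)
      also have "\<dots> = integral {t..b (Suc k)} I + integral {b (Suc k)..b N} I"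
        using comb[of t "b (Suc k)" "b N"] t k kN by simp
      also have "integral {t..b (Suc k)} I \<le> integral {b k..b (Suc k)} I"
        using k t bt[of k] by (intro integral_subset_le intI) (auto simp: I0)
      also have "\<dots> \<le> S (b (Suc k)) / 2" by (rule blockI)
      also have "integral {b (Suc k)..b N} I \<le> S (b (Suc k)) / 2"
        using tail[of "Suc k" n] S_pos[OF bt[of N]] unfolding N_def by simp
      finally show ?thesis using S_mono[of t "b (Suc k)"] t k by simp
    qed
    have cIt: "continuous_on {t..} I" by (rule continuous_on_subset[OF cI]) (use t in auto)
    show "I integrable_on {t..} \<and> integral {t..} I \<le> S t"
      using nonneg_integrable_half_line[OF cIt I0 le] by simp
  qed
  have V_sol: "amplifying \<kappa> \<delta> c (b k) (b (Suc k))" for k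
    unfolding amplifying_def
  proof (rule exI[of _ "V k"], rule exI[of _ "V1 k"], intro conjI ballI Vb V_growth)
    fix t assume t: "t \<in> {b k..b (Suc k)}"
    have tt: "t0 \<le> t" and sub: "{b k..b (Suc k)} \<subseteq> {t0..}" using t bt[of k] by auto
    show "(V k has_real_derivative V1 k t) (at t within {b k..b (Suc k)})"
      by (rule DERIV_subset[OF dV(1)[OF tt] sub])
    show "(V1 k has_real_derivative - c t * (G (b (Suc k)) / S (b (Suc k))) * V k t) (at t within {b k..b (Suc k)})"
      unfolding on_block(1)[OF t] by (rule DERIV_subset[OF dV(2)[OF tt] sub])
  qed
  show ?thesis
    by (rule that[OF dc dc1 cc2 bounds cb asy V_sol])
qed

end

section \<open>Modes near a resonant frequency\<close>

text \<open>Two solutions for each spectral parameter \<open>z\<close>, with unit initial data at \<open>t0\<close>; all other solutions are combinations of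
them with coefficients that do not depend on time.\<close>

locale fundamental_system =
  fixes t0 \<Lambda>1 \<Lambda>2 :: real and c c1 \<gamma> :: "real \<Rightarrow> real" and X1 Y1 X2 Y2 :: "real \<Rightarrow> real \<Rightarrow> real"
  assumes dc: "\<And>t. t \<ge> t0 \<Longrightarrow> (c has_real_derivative c1 t) (at t within {t0..})"
    and c1_le: "\<And>t. t \<ge> t0 \<Longrightarrow> \<bar>c1 t\<bar> \<le> \<gamma> t" and \<gamma>_cont: "continuous_on {t0..} \<gamma>"
    and \<Lambda>1: "0 < \<Lambda>1" and c_bounds: "\<And>t. t \<ge> t0 \<Longrightarrow> \<Lambda>1 \<le> c t \<and> c t \<le> \<Lambda>2"
    and init: "\<And>z. X1 z t0 = 1" "\<And>z. Y1 z t0 = 0" "\<And>z. X2 z t0 = 0" "\<And>z. Y2 z t0 = 1"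
    and dX: "\<And>z t. t \<ge> t0 \<Longrightarrow> (X1 z has_real_derivative Y1 z t) (at t within {t0..})"
      "\<And>z t. t \<ge> t0 \<Longrightarrow> (X2 z has_real_derivative Y2 z t) (at t within {t0..})"
    and dY: "\<And>z t. t \<ge> t0 \<Longrightarrow> (Y1 z has_real_derivative - c t * z * X1 z t) (at t within {t0..})"
      "\<And>z t. t \<ge> t0 \<Longrightarrow> (Y2 z has_real_derivative - c t * z * X2 z t) (at t within {t0..})"
    and contz: "\<And>z t. t \<ge> t0 \<Longrightarrow> isCont (\<lambda>z. X1 z t) z" "\<And>z t. t \<ge> t0 \<Longrightarrow> isCont (\<lambda>z. Y1 z t) z"
      "\<And>z t. t \<ge> t0 \<Longrightarrow> isCont (\<lambda>z. X2 z t) z" "\<And>z t. t \<ge> t0 \<Longrightarrow> isCont (\<lambda>z. Y2 z t) z"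
begin

definition \<Gamma> :: "real \<Rightarrow> real" where "\<Gamma> t = integral {t0..t} \<gamma> / \<Lambda>1"

definition sol :: "real \<Rightarrow> real \<Rightarrow> real \<Rightarrow> real \<Rightarrow> real" where
  "sol \<alpha> \<beta> z t = \<alpha> * X1 z t + \<beta> * X2 z t"

definition vel :: "real \<Rightarrow> real \<Rightarrow> real \<Rightarrow> real \<Rightarrow> real" where
  "vel \<alpha> \<beta> z t = \<alpha> * Y1 z t + \<beta> * Y2 z t"

definition mode_energy :: "real \<Rightarrow> real \<Rightarrow> real \<Rightarrow> real \<Rightarrow> real" where
  "mode_energy \<alpha> \<beta> z t = (vel \<alpha> \<beta> z t)\<^sup>2 + c t * z * (sol \<alpha> \<beta> z t)\<^sup>2"

lemma dsol: "t \<ge> t0 \<Longrightarrow> (sol \<alpha> \<beta> z has_real_derivative vel \<alpha> \<beta> z t) (at t within {t0..})"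
  unfolding sol_def vel_def by (intro DERIV_add DERIV_cmult dX)

lemma dvel: "t \<ge> t0 \<Longrightarrow> (vel \<alpha> \<beta> z has_real_derivative - c t * z * sol \<alpha> \<beta> z t) (at t within {t0..})"
proof (rule DERIV_cong)
  assume t: "t \<ge> t0"
  show "(vel \<alpha> \<beta> z has_real_derivative \<alpha> * (- c t * z * X1 z t) + \<beta> * (- c t * z * X2 z t)) (at t within {t0..})"
    unfolding vel_def by (intro DERIV_add DERIV_cmult dY t)
qed (simp add: sol_def algebra_simps)

lemma \<gamma>_nonneg: "t \<ge> t0 \<Longrightarrow> 0 \<le> \<gamma> t"
  using c1_le[of t] by simp

lemma d\<Gamma>: "t \<ge> t0 \<Longrightarrow> (\<Gamma> has_real_derivative \<gamma> t / \<Lambda>1) (at t within {t0..})"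
  unfolding \<Gamma>_def by (intro DERIV_cdivide half_line_antiderivative \<gamma>_cont)

lemma \<Gamma>_mono: "t0 \<le> s \<Longrightarrow> s \<le> t \<Longrightarrow> \<Gamma> s \<le> \<Gamma> t"
  unfolding \<Gamma>_def
  by (intro divide_right_mono integral_subset_le integrable_continuous_interval
      continuous_on_subset[OF \<gamma>_cont]) (use \<Lambda>1 \<gamma>_nonneg in auto)

lemma \<Gamma>_t0: "\<Gamma> t0 = 0"
  by (simp add: \<Gamma>_def)

lemma mode_energy_bounds:
  assumes s: "t0 \<le> s" "s \<le> t" and z: "0 \<le> z"
    and w: "\<And>r. r \<in> {s..t} \<Longrightarrow> (w has_real_derivative v r) (at r within {s..t})"
    and v: "\<And>r. r \<in> {s..t} \<Longrightarrow> (v has_real_derivative - c r * z * w r) (at r within {s..t})"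
  shows "(v t)\<^sup>2 + c t * z * (w t)\<^sup>2 \<le> ((v s)\<^sup>2 + c s * z * (w s)\<^sup>2) * exp (\<Gamma> t - \<Gamma> s)"
    and "(v s)\<^sup>2 + c s * z * (w s)\<^sup>2 \<le> ((v t)\<^sup>2 + c t * z * (w t)\<^sup>2) * exp (\<Gamma> t - \<Gamma> s)"
proof -
  have sub: "{s..t} \<subseteq> {t0..}" using s by auto
  have 1: "(c has_real_derivative c1 r) (at r within {s..t})" if "r \<in> {s..t}" for r
    by (rule DERIV_subset[OF dc sub]) (use that s in auto)
  have 2: "(\<Gamma> has_real_derivative \<gamma> r / \<Lambda>1) (at r within {s..t})" if "r \<in> {s..t}" for r
    by (rule DERIV_subset[OF d\<Gamma> sub]) (use that s in auto)
  have 3: "\<Lambda>1 \<le> c r" if "r \<in> {s..t}" for r using c_bounds[of r] that s by auto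
  have 4: "\<bar>c1 r\<bar> \<le> \<Lambda>1 * (\<gamma> r / \<Lambda>1)" if "r \<in> {s..t}" for r using c1_le[of r] that s \<Lambda>1 by auto
  show "(v t)\<^sup>2 + c t * z * (w t)\<^sup>2 \<le> ((v s)\<^sup>2 + c s * z * (w s)\<^sup>2) * exp (\<Gamma> t - \<Gamma> s)"
    by (rule oscillator_energy_bounds(1)[OF s(2) \<Lambda>1 z w v 1 2 3 4])
  show "(v s)\<^sup>2 + c s * z * (w s)\<^sup>2 \<le> ((v t)\<^sup>2 + c t * z * (w t)\<^sup>2) * exp (\<Gamma> t - \<Gamma> s)"
    by (rule oscillator_energy_bounds(2)[OF s(2) \<Lambda>1 z w v 1 2 3 4])
qed

lemma sol_energy_bounds:
  assumes "t0 \<le> s" "s \<le> t" "0 \<le> z"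
  shows "mode_energy \<alpha> \<beta> z t \<le> mode_energy \<alpha> \<beta> z s * exp (\<Gamma> t - \<Gamma> s)"
    and "mode_energy \<alpha> \<beta> z s \<le> mode_energy \<alpha> \<beta> z t * exp (\<Gamma> t - \<Gamma> s)"
proof -
  have sub: "{s..t} \<subseteq> {t0..}" using assms by auto
  have 1: "(sol \<alpha> \<beta> z has_real_derivative vel \<alpha> \<beta> z r) (at r within {s..t})"
    and 2: "(vel \<alpha> \<beta> z has_real_derivative - c r * z * sol \<alpha> \<beta> z r) (at r within {s..t})"
    if "r \<in> {s..t}" for r
    using DERIV_subset[OF dsol sub, of r] DERIV_subset[OF dvel sub, of r] that assms by auto
  show "mode_energy \<alpha> \<beta> z t \<le> mode_energy \<alpha> \<beta> z s * exp (\<Gamma> t - \<Gamma> s)"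
    and "mode_energy \<alpha> \<beta> z s \<le> mode_energy \<alpha> \<beta> z t * exp (\<Gamma> t - \<Gamma> s)"
    unfolding mode_energy_def by (intro mode_energy_bounds assms 1 2; assumption)+
qed

lemma mode_energy_scale: "mode_energy (\<rho> * \<alpha>) (\<rho> * \<beta>) z t = \<rho>\<^sup>2 * mode_energy \<alpha> \<beta> z t"
proof -
  have "sol (\<rho> * \<alpha>) (\<rho> * \<beta>) z t = \<rho> * sol \<alpha> \<beta> z t" "vel (\<rho> * \<alpha>) (\<rho> * \<beta>) z t = \<rho> * vel \<alpha> \<beta> z t"
    by (simp_all add: sol_def vel_def algebra_simps)
  then show ?thesis by (simp add: mode_energy_def power_mult_distrib algebra_simps)
qed

lemma mode_energy_isCont: "t \<ge> t0 \<Longrightarrow> isCont (\<lambda>z. mode_energy \<alpha> \<beta> z t) z"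
  unfolding mode_energy_def sol_def vel_def by (intro continuous_intros contz)

lemma wronskian:
  assumes t: "t0 \<le> t"
  shows "X1 z t * Y2 z t - Y1 z t * X2 z t = 1"
proof (cases "t0 < t")
  case True
  let ?f = "\<lambda>t. X1 z t * Y2 z t - Y1 z t * X2 z t"
  have d: "(?f has_real_derivative 0) (at r within {t0..})" if "r \<ge> t0" for r
    by (rule derivative_eq_intros dX dY that refl)+ (simp add: algebra_simps)
  have "continuous_on {t0..t} ?f"
    by (rule continuous_on_subset[of "{t0..}"], rule DERIV_continuous_on, rule d) auto
  moreover have "DERIV ?f r :> 0" if "t0 < r" "r < t" for r
    using DERIV_subset[OF d, of r "{t0..t}"] that by (simp add: at_within_Icc_at subset_eq)
  ultimately have "?f t = ?f t0" by (rule DERIV_isconst_end[OF True])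
  then show ?thesis by (simp add: init)
next
  case False
  then have "t = t0" using t by simp
  then show ?thesis by (simp add: init)
qed

text \<open>The data at \<open>t0\<close> of the solution with \<open>w a = 0\<close> and \<open>w' a = 1\<close> are found from the Wronskian. For the parameter \<open>z\<close> itself this
solution starts with at most the lost energy \<open>exp (\<Gamma> a)\<close> and, by uniqueness, coincides with \<open>V\<close> on \<open>[a, b]\<close>. The same data are used for
parameters near \<open>z\<close>, where continuity costs at most a factor \<open>2\<close>.\<close>

lemma resonant_mode:
  assumes ab: "t0 \<le> a" "a \<le> b" and z: "0 < z" and R: "0 < R"
    and V: "V a = 0" "V1 a = 1"
    and dV: "\<And>t. t \<in> {a..b} \<Longrightarrow> (V has_real_derivative V1 t) (at t within {a..b})"
    and dV1: "\<And>t. t \<in> {a..b} \<Longrightarrow> (V1 has_real_derivative - c t * z * V t) (at t within {a..b})"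
    and VR: "R \<le> (V1 b)\<^sup>2 + c b * z * (V b)\<^sup>2"
  shows "\<exists>\<alpha> \<beta> r. 0 < r \<and> r \<le> 1 / 2 \<and> (\<forall>y. \<bar>y - z\<bar> \<le> r \<longrightarrow>
    mode_energy \<alpha> \<beta> y t0 \<le> 2 * exp (\<Gamma> a) \<and> R / 2 \<le> mode_energy \<alpha> \<beta> y b)"
proof -
  define \<alpha> where "\<alpha> = - X2 z a"
  define \<beta> where "\<beta> = X1 z a"
  have Wa: "sol \<alpha> \<beta> z a = 0" "vel \<alpha> \<beta> z a = 1"
    using wronskian[OF ab(1), of z] by (auto simp: sol_def vel_def \<alpha>_def \<beta>_def algebra_simps)
  have Ea: "mode_energy \<alpha> \<beta> z a = 1" by (simp add: mode_energy_def Wa)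
  have E0: "mode_energy \<alpha> \<beta> z t0 \<le> exp (\<Gamma> a)"
    using sol_energy_bounds(2)[OF order_refl ab(1), of z \<alpha> \<beta>] z by (simp add: Ea \<Gamma>_t0)
  have b0: "t0 \<le> b" using ab by simp
  have same: "sol \<alpha> \<beta> z b = V b \<and> vel \<alpha> \<beta> z b = V1 b"
  proof -
    have sub: "{a..b} \<subseteq> {t0..}" using ab by auto
    have 1: "((\<lambda>t. sol \<alpha> \<beta> z t - V t) has_real_derivative vel \<alpha> \<beta> z r - V1 r) (at r within {a..b})"
      and 2: "((\<lambda>t. vel \<alpha> \<beta> z t - V1 t) has_real_derivative - c r * z * (sol \<alpha> \<beta> z r - V r)) (at r within {a..b})"
      if r: "r \<in> {a..b}" for r
    proof -
      have r0: "r \<ge> t0" using r ab by auto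
      show "((\<lambda>t. sol \<alpha> \<beta> z t - V t) has_real_derivative vel \<alpha> \<beta> z r - V1 r) (at r within {a..b})"
        by (rule DERIV_diff[OF DERIV_subset[OF dsol[OF r0] sub] dV[OF r]])
      show "((\<lambda>t. vel \<alpha> \<beta> z t - V1 t) has_real_derivative - c r * z * (sol \<alpha> \<beta> z r - V r)) (at r within {a..b})"
        by (rule DERIV_cong[OF DERIV_diff[OF DERIV_subset[OF dvel[OF r0] sub] dV1[OF r]]])
          (simp add: algebra_simps)
    qed
    have "(vel \<alpha> \<beta> z b - V1 b)\<^sup>2 + c b * z * (sol \<alpha> \<beta> z b - V b)\<^sup>2
      \<le> ((vel \<alpha> \<beta> z a - V1 a)\<^sup>2 + c a * z * (sol \<alpha> \<beta> z a - V a)\<^sup>2) * exp (\<Gamma> b - \<Gamma> a)"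
      using z by (intro mode_energy_bounds(1)[OF ab _ 1 2]) auto
    also have "\<dots> = 0" by (simp add: Wa V)
    finally have le: "(vel \<alpha> \<beta> z b - V1 b)\<^sup>2 + c b * z * (sol \<alpha> \<beta> z b - V b)\<^sup>2 \<le> 0" .
    have cz: "c b * z > 0" using c_bounds[OF b0] \<Lambda>1 z by (intro mult_pos_pos) linarith+
    have "0 \<le> c b * z * (sol \<alpha> \<beta> z b - V b)\<^sup>2" by (rule mult_nonneg_nonneg[OF less_imp_le[OF cz]]) simp
    then have "(vel \<alpha> \<beta> z b - V1 b)\<^sup>2 = 0" "c b * z * (sol \<alpha> \<beta> z b - V b)\<^sup>2 = 0"
      using le zero_le_power2[of "vel \<alpha> \<beta> z b - V1 b"] by linarith+
    then show ?thesis using cz by auto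
  qed
  have Eb: "R \<le> mode_energy \<alpha> \<beta> z b" using VR same by (simp add: mode_energy_def)
  have "eventually (\<lambda>y. mode_energy \<alpha> \<beta> y t0 < 2 * exp (\<Gamma> a)) (at z)"
  proof (rule order_tendstoD(2))
    show "((\<lambda>y. mode_energy \<alpha> \<beta> y t0) \<longlongrightarrow> mode_energy \<alpha> \<beta> z t0) (at z)"
      using mode_energy_isCont[OF order_refl, where \<alpha> = \<alpha> and \<beta> = \<beta> and z = z] by (simp add: isCont_def)
    show "mode_energy \<alpha> \<beta> z t0 < 2 * exp (\<Gamma> a)" using E0 by (smt (verit) exp_gt_zero)
  qed
  moreover have "eventually (\<lambda>y. R / 2 < mode_energy \<alpha> \<beta> y b) (at z)"
  proof (rule order_tendstoD(1))
    show "((\<lambda>y. mode_energy \<alpha> \<beta> y b) \<longlongrightarrow> mode_energy \<alpha> \<beta> z b) (at z)"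
      using mode_energy_isCont[OF b0, where \<alpha> = \<alpha> and \<beta> = \<beta> and z = z] by (simp add: isCont_def)
    show "R / 2 < mode_energy \<alpha> \<beta> z b" using Eb R by linarith
  qed
  ultimately have "eventually (\<lambda>y. mode_energy \<alpha> \<beta> y t0 < 2 * exp (\<Gamma> a) \<and> R / 2 < mode_energy \<alpha> \<beta> y b) (at z)"
    by (rule eventually_conj)
  then obtain e where e: "e > 0" "\<And>y. y \<noteq> z \<Longrightarrow> dist y z < e \<Longrightarrow>
      mode_energy \<alpha> \<beta> y t0 < 2 * exp (\<Gamma> a) \<and> R / 2 < mode_energy \<alpha> \<beta> y b"
    unfolding eventually_at by blast
  show ?thesis
  proof (intro exI conjI allI impI)
    show "0 < min (e / 2) (1 / 2)" "min (e / 2) (1 / 2) \<le> (1 / 2 :: real)" using e by auto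
    fix y assume "\<bar>y - z\<bar> \<le> min (e / 2) (1 / 2)"
    then have y: "dist y z < e" using e by (simp add: dist_real_def)
    show "mode_energy \<alpha> \<beta> y t0 \<le> 2 * exp (\<Gamma> a)"
      using e(2)[OF _ y] E0 by (cases "y = z") (auto intro: order_trans[OF E0] less_imp_le)
    show "R / 2 \<le> mode_energy \<alpha> \<beta> y b"
      using e(2)[OF _ y] Eb R by (cases "y = z") (auto intro: less_imp_le)
  qed
qed

end

section \<open>Superposition of the modes\<close>

lemma suminf_disjoint_indicator:
  fixes a :: "nat \<Rightarrow> real"
  assumes "disjoint_family C" "p \<in> C k"
  shows "(\<Sum>j. a j * indicator (C j) p) = a k"
proof -
  have "(\<Sum>j. a j * indicator (C j) p) = (\<Sum>j\<in>{k}. a j * indicator (C j) p)"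
    by (rule suminf_finite) (use assms in \<open>auto simp: disjoint_family_on_def indicator_def\<close>)
  then show ?thesis using assms(2) by simp
qed

lemma summable_disjoint_indicator:
  fixes a :: "nat \<Rightarrow> real"
  assumes "disjoint_family C"
  shows "summable (\<lambda>j. a j * indicator (C j) p)"
proof (cases "\<exists>k. p \<in> C k")
  case True
  then obtain k where "p \<in> C k" by blast
  then show ?thesis
    by (intro summable_finite[of "{k}"]) (use assms in \<open>auto simp: disjoint_family_on_def indicator_def\<close>)
qed (simp add: indicator_def)

text \<open>The \<open>k\<close>-th mode is carried by \<open>C k\<close> and normalised to initial energy at most \<open>2\<^sup>-\<^sup>k\<close>, so that the total is at most \<open>2\<close>. As the
sets are disjoint, the energy of the sum is never less than that of a single mode. The lower bound on \<open>lam\<close>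
lets the energy dominate \<open>w\<close> itself, too.\<close>

lemma (in L2_representation) superposition_of_modes:
  fixes C :: "nat \<Rightarrow> 'm set" and \<alpha> \<beta> B :: "nat \<Rightarrow> real"
  assumes fs: "fundamental_system t0 \<Lambda>1 \<Lambda>2 c c1 \<gamma> X1 Y1 X2 Y2"
    and lam: "lam \<in> borel_measurable \<mu>"
    and C: "\<And>k. C k \<in> sets \<mu>" "\<And>k. 0 < emeasure \<mu> (C k)" "\<And>k. emeasure \<mu> (C k) < \<infinity>" "disjoint_family C"
    and lam1: "\<And>k p. p \<in> C k \<Longrightarrow> 1 \<le> (lam p)\<^sup>2"
    and B: "\<And>k. 0 < B k"
      "\<And>k p. p \<in> C k \<Longrightarrow> fundamental_system.mode_energy c X1 Y1 X2 Y2 (\<alpha> k) (\<beta> k) ((lam p)\<^sup>2) t0 \<le> B k"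
    and cinf: "c t0 = cinf" "0 < cinf"
  obtains u where "weak_solution \<mu> lam F t0 c u" "energy \<mu> lam F t0 cinf u t0 \<le> 2 / sqrt cinf"
    "\<And>t k R. t \<ge> t0 \<Longrightarrow> c t = cinf \<Longrightarrow>
      \<forall>p\<in>C k. R \<le> fundamental_system.mode_energy c X1 Y1 X2 Y2 (\<alpha> k) (\<beta> k) ((lam p)\<^sup>2) t \<Longrightarrow>
      R / (2 ^ k * B k * sqrt cinf) \<le> energy \<mu> lam F t0 cinf u t"
proof -
  interpret fundamental_system t0 \<Lambda>1 \<Lambda>2 c c1 \<gamma> X1 Y1 X2 Y2 by (rule fs)
  define m where "m k = measure \<mu> (C k)" for k
  have m: "m k > 0" for k
    unfolding m_def using C(2,3)[of k] by (simp add: measure_def enn2real_positive_iff)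
  define \<rho> where "\<rho> k = sqrt ((1 / 2) ^ k / (B k * m k))" for k
  have \<rho>2: "(\<rho> k)\<^sup>2 = (1 / 2) ^ k / (B k * m k)" for k
    unfolding \<rho>_def using B(1)[of k] m[of k] by simp
  define a1 where "a1 p = (\<Sum>k. \<rho> k * \<alpha> k * indicator (C k) p)" for p
  define a2 where "a2 p = (\<Sum>k. \<rho> k * \<beta> k * indicator (C k) p)" for p
  \<comment> \<open>\<open>g\<close> dominates the initial energy density; at time \<open>t\<close> the density is at most \<open>exp (\<Gamma> t) * g\<close>.\<close>
  define g where "g p = (\<Sum>k. (1 / 2) ^ k / m k * indicator (C k) p)" for p
  have on: "a1 p = \<rho> k * \<alpha> k" "a2 p = \<rho> k * \<beta> k" "g p = (1 / 2) ^ k / m k" if "p \<in> C k" for p k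
    unfolding a1_def a2_def g_def by (rule suminf_disjoint_indicator[OF C(4) that])+
  have off: "a1 p = 0" "a2 p = 0" "g p = 0" if "\<And>k. p \<notin> C k" for p
    unfolding a1_def a2_def g_def using that by simp_all
  note [measurable] = C(1) lam
  have am: "a1 \<in> borel_measurable \<mu>" "a2 \<in> borel_measurable \<mu>"
    unfolding a1_def a2_def by measurable
  have intC: "integrable \<mu> (\<lambda>p. a * indicator (C k) p)" "(\<integral>p. a * indicator (C k) p \<partial>\<mu>) = a * m k" for a k
    using C(1,3)[of k] by (auto simp: m_def)
  have sum_half: "(\<lambda>k. (1 / 2 :: real) ^ k) sums 2"
    using geometric_sums[of "1 / 2 :: real"] by simp
  have norm_int: "(\<integral>p. norm ((1 / 2) ^ k / m k * indicator (C k) p) \<partial>\<mu>) = (1 / 2) ^ k" for k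
  proof -
    have "(\<integral>p. norm ((1 / 2) ^ k / m k * indicator (C k) p) \<partial>\<mu>) = (\<integral>p. (1 / 2) ^ k / m k * indicator (C k) p \<partial>\<mu>)"
      using m[of k] by (intro Bochner_Integration.integral_cong) (auto simp: indicator_def)
    also have "\<dots> = (1 / 2) ^ k" using intC(2)[of "(1 / 2) ^ k / m k" k] m[of k] by simp
    finally show ?thesis .
  qed
  have AEs: "AE p in \<mu>. summable (\<lambda>k. norm ((1 / 2) ^ k / m k * indicator (C k) p))"
  proof (rule AE_I2)
    fix p
    have "(\<lambda>k. norm ((1 / 2) ^ k / m k * indicator (C k) p)) = (\<lambda>k. (1 / 2) ^ k / m k * indicator (C k) p)"
      using m by (auto simp: indicator_def fun_eq_iff less_imp_le)
    then show "summable (\<lambda>k. norm ((1 / 2) ^ k / m k * indicator (C k) p))"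
      by (simp only:) (rule summable_disjoint_indicator[OF C(4)])
  qed
  have summ: "summable (\<lambda>k. \<integral>p. norm ((1 / 2) ^ k / m k * indicator (C k) p) \<partial>\<mu>)"
    unfolding norm_int using sum_half by (rule sums_summable)
  have g_int: "integrable \<mu> g"
    unfolding g_def by (rule integrable_suminf[OF intC(1) AEs summ])
  have g_val: "(\<integral>p. g p \<partial>\<mu>) = 2"
  proof -
    have "(\<integral>p. g p \<partial>\<mu>) = (\<Sum>k. \<integral>p. (1 / 2) ^ k / m k * indicator (C k) p \<partial>\<mu>)"
      unfolding g_def by (rule integral_suminf[OF intC(1) AEs summ])
    also have "\<dots> = (\<Sum>k. (1 / 2) ^ k)"
      unfolding intC(2) using m by (intro suminf_cong) (simp add: less_imp_neq[symmetric])
    also have "\<dots> = 2" using sum_half by (rule sums_unique[symmetric])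
    finally show ?thesis .
  qed
  define w where "w t p = sol (a1 p) (a2 p) ((lam p)\<^sup>2) t" for t p
  define v where "v t p = vel (a1 p) (a2 p) ((lam p)\<^sup>2) t" for t p
  have meas_z: "(\<lambda>p. f ((lam p)\<^sup>2)) \<in> borel_measurable \<mu>" if "\<And>z. isCont f z" for f :: "real \<Rightarrow> real"
  proof -
    have "f \<in> borel_measurable borel"
      by (rule borel_measurable_continuous_onI) (use that in \<open>simp add: continuous_at_imp_continuous_on\<close>)
    then show ?thesis by measurable
  qed
  have w_meas: "w t \<in> borel_measurable \<mu>" and v_meas: "v t \<in> borel_measurable \<mu>" if t: "t \<ge> t0" for t
  proof -
    note [measurable] = am meas_z[OF contz(1)[OF t]] meas_z[OF contz(2)[OF t]]
      meas_z[OF contz(3)[OF t]] meas_z[OF contz(4)[OF t]]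
    show "w t \<in> borel_measurable \<mu>" unfolding w_def sol_def by measurable
    show "v t \<in> borel_measurable \<mu>" unfolding v_def vel_def by measurable
  qed
  have E_le: "(v t p)\<^sup>2 + c t * (lam p * w t p)\<^sup>2 \<le> exp (\<Gamma> t) * g p" if t: "t \<ge> t0" for t p
  proof (cases "\<exists>k. p \<in> C k")
    case True
    then obtain k where k: "p \<in> C k" by blast
    have "(v t p)\<^sup>2 + c t * (lam p * w t p)\<^sup>2 = mode_energy (\<rho> k * \<alpha> k) (\<rho> k * \<beta> k) ((lam p)\<^sup>2) t"
      by (simp add: mode_energy_def v_def w_def on[OF k] power_mult_distrib mult.assoc)
    also have "\<dots> \<le> mode_energy (\<rho> k * \<alpha> k) (\<rho> k * \<beta> k) ((lam p)\<^sup>2) t0 * exp (\<Gamma> t)"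
      using sol_energy_bounds(1)[OF order_refl t, of "(lam p)\<^sup>2"] by (simp add: \<Gamma>_t0)
    also have "mode_energy (\<rho> k * \<alpha> k) (\<rho> k * \<beta> k) ((lam p)\<^sup>2) t0 \<le> (\<rho> k)\<^sup>2 * B k"
      unfolding mode_energy_scale by (rule mult_left_mono[OF B(2)[OF k]]) simp
    also have "(\<rho> k)\<^sup>2 * B k = g p"
      using B(1)[of k] unfolding \<rho>2 on(3)[OF k] by simp
    finally show ?thesis by (simp add: mult.commute)
  next
    case False
    then show ?thesis using off[of p] by (simp add: v_def w_def sol_def vel_def)
  qed
  have E_eq: "(v t p)\<^sup>2 + c t * (lam p * w t p)\<^sup>2 = (\<rho> k)\<^sup>2 * mode_energy (\<alpha> k) (\<beta> k) ((lam p)\<^sup>2) t"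
    if k: "p \<in> C k" for t p k
    unfolding mode_energy_scale[symmetric]
    by (simp add: mode_energy_def v_def w_def on[OF k] power_mult_distrib mult.assoc)
  have cpos: "c t > 0" if "t \<ge> t0" for t using c_bounds[OF that] \<Lambda>1 by linarith
  have dom: "\<exists>g. integrable \<mu> g \<and> (\<forall>t\<in>{t0..T}. \<forall>p\<in>space \<mu>.
      (w t p)\<^sup>2 \<le> g p \<and> (v t p)\<^sup>2 \<le> g p \<and> (lam p * w t p)\<^sup>2 \<le> g p)" for T
  proof (intro exI conjI ballI)
    show "integrable \<mu> (\<lambda>p. (1 + 1 / \<Lambda>1) * (exp (\<Gamma> T) * g p))" using g_int by simp
    fix t p assume t: "t \<in> {t0..T}"
    have g0: "0 \<le> g p"
    proof (cases "\<exists>k. p \<in> C k")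
      case True
      then obtain k where "p \<in> C k" by blast
      then show ?thesis using on(3) m[of k] by simp
    qed (use off in simp)
    define h where "h = exp (\<Gamma> T) * g p"
    have h0: "0 \<le> h" using g0 by (simp add: h_def)
    have t': "t0 \<le> t" using t by simp
    have "exp (\<Gamma> t) * g p \<le> h"
      unfolding h_def using \<Gamma>_mono[of t T] t g0 by (intro mult_right_mono) auto
    then have E: "(v t p)\<^sup>2 + c t * (lam p * w t p)\<^sup>2 \<le> h" using E_le[OF t', of p] by linarith
    have h1: "h \<le> (1 + 1 / \<Lambda>1) * h" "h / \<Lambda>1 \<le> (1 + 1 / \<Lambda>1) * h"
      using h0 \<Lambda>1 by (auto simp: distrib_right)
    have "(v t p)\<^sup>2 \<le> h" using E cpos[OF t'] by (smt (verit) mult_nonneg_nonneg zero_le_power2)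
    then show "(v t p)\<^sup>2 \<le> (1 + 1 / \<Lambda>1) * (exp (\<Gamma> T) * g p)" using h1(1) unfolding h_def by linarith
    have "\<Lambda>1 * (lam p * w t p)\<^sup>2 \<le> c t * (lam p * w t p)\<^sup>2"
      using c_bounds[OF t'] by (intro mult_right_mono) auto
    then have "\<Lambda>1 * (lam p * w t p)\<^sup>2 \<le> h" using E zero_le_power2[of "v t p"] by linarith
    then have lw: "(lam p * w t p)\<^sup>2 \<le> h / \<Lambda>1" using \<Lambda>1 by (simp add: field_simps)
    then show "(lam p * w t p)\<^sup>2 \<le> (1 + 1 / \<Lambda>1) * (exp (\<Gamma> T) * g p)" using h1(2) unfolding h_def by linarith
    have "(w t p)\<^sup>2 \<le> (lam p * w t p)\<^sup>2"
    proof (cases "\<exists>k. p \<in> C k")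
      case True
      then have "1 \<le> (lam p)\<^sup>2" using lam1 by blast
      from mult_right_mono[OF this, of "(w t p)\<^sup>2"] show ?thesis by (simp add: power_mult_distrib)
    next
      case False
      then show ?thesis using off[of p] by (simp add: w_def sol_def)
    qed
    then show "(w t p)\<^sup>2 \<le> (1 + 1 / \<Lambda>1) * (exp (\<Gamma> T) * g p)" using lw h1(2) unfolding h_def by linarith
  qed
  have dw: "((\<lambda>s. w s p) has_real_derivative v t p) (at t within {t0..})"
    and dv: "((\<lambda>s. v s p) has_real_derivative - c t * (lam p)\<^sup>2 * w t p) (at t within {t0..})"
    if "t \<ge> t0" for t p
    unfolding w_def v_def using dsol[OF that] dvel[OF that] by auto
  have c_abs: "\<bar>c t\<bar> \<le> \<Lambda>2" if "t \<ge> t0" for t using c_bounds[OF that] \<Lambda>1 by auto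
  define u where "u = (\<lambda>t. repr (w t))"
  have weak: "weak_solution \<mu> lam F t0 c u"
    unfolding u_def by (rule fiberwise_weak_solution(1)[OF lam w_meas v_meas dw dv c_abs dom])
  have fw: "integrable \<mu> (\<lambda>p. (v t p)\<^sup>2)" "integrable \<mu> (\<lambda>p. (lam p * w t p)\<^sup>2)"
    "(norm (half_deriv t0 u t))\<^sup>2 = (\<integral>p. (v t p)\<^sup>2 \<partial>\<mu>)"
    "(norm (sqrt_op \<mu> lam F (u t)))\<^sup>2 = (\<integral>p. (lam p * w t p)\<^sup>2 \<partial>\<mu>)" if t: "t \<ge> t0" for t
    unfolding u_def
    by (rule fiberwise_weak_solution(2-5)[OF lam w_meas v_meas dw dv c_abs dom t]; assumption)+
  have Ei: "integrable \<mu> (\<lambda>p. (v t p)\<^sup>2 + cinf * (lam p * w t p)\<^sup>2)" if "t \<ge> t0" for t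
    using fw(1,2)[OF that] by simp
  have en: "energy \<mu> lam F t0 cinf u t = (\<integral>p. (v t p)\<^sup>2 + cinf * (lam p * w t p)\<^sup>2 \<partial>\<mu>) / sqrt cinf"
    if t: "t \<ge> t0" for t
  proof -
    have "energy \<mu> lam F t0 cinf u t
        = (\<integral>p. (v t p)\<^sup>2 \<partial>\<mu>) / sqrt cinf + sqrt cinf * (\<integral>p. (lam p * w t p)\<^sup>2 \<partial>\<mu>)"
      unfolding energy_def using fw(3,4)[OF t] by simp
    also have "\<dots> = ((\<integral>p. (v t p)\<^sup>2 \<partial>\<mu>) + cinf * (\<integral>p. (lam p * w t p)\<^sup>2 \<partial>\<mu>)) / sqrt cinf"
      using cinf(2) by (simp add: add_divide_distrib real_div_sqrt flip: times_divide_eq_left)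
    also have "\<dots> = (\<integral>p. (v t p)\<^sup>2 + cinf * (lam p * w t p)\<^sup>2 \<partial>\<mu>) / sqrt cinf"
      using fw(1,2)[OF t] by simp
    finally show ?thesis .
  qed
  show ?thesis
  proof (rule that[of u])
    show "weak_solution \<mu> lam F t0 c u" by (rule weak)
    have "(\<integral>p. (v t0 p)\<^sup>2 + cinf * (lam p * w t0 p)\<^sup>2 \<partial>\<mu>) \<le> (\<integral>p. g p \<partial>\<mu>)"
      using E_le[OF order_refl] by (intro integral_mono Ei g_int) (simp_all add: \<Gamma>_t0 cinf(1))
    then show "energy \<mu> lam F t0 cinf u t0 \<le> 2 / sqrt cinf"
      unfolding en[OF order_refl] g_val using cinf(2) by (intro divide_right_mono) auto
    fix t k R assume t: "t \<ge> t0" and ct: "c t = cinf"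
      and R: "\<forall>p\<in>C k. R \<le> mode_energy (\<alpha> k) (\<beta> k) ((lam p)\<^sup>2) t"
    have "R / (2 ^ k * B k) = (\<rho> k)\<^sup>2 * R * m k"
      using m[of k] B(1)[of k] by (simp add: \<rho>2 power_one_over field_simps)
    also have "\<dots> = (\<integral>p. (\<rho> k)\<^sup>2 * R * indicator (C k) p \<partial>\<mu>)" by (rule intC(2)[symmetric])
    also have "\<dots> \<le> (\<integral>p. (v t p)\<^sup>2 + cinf * (lam p * w t p)\<^sup>2 \<partial>\<mu>)"
    proof (rule integral_mono[OF intC(1) Ei[OF t]])
      show "(\<rho> k)\<^sup>2 * R * indicator (C k) p \<le> (v t p)\<^sup>2 + cinf * (lam p * w t p)\<^sup>2" for p
      proof (cases "p \<in> C k")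
        case True
        have "(\<rho> k)\<^sup>2 * R \<le> (\<rho> k)\<^sup>2 * mode_energy (\<alpha> k) (\<beta> k) ((lam p)\<^sup>2) t"
          by (rule mult_left_mono[OF bspec[OF R True]]) simp
        then show ?thesis using E_eq[OF True, of t] True by (simp add: ct)
      next
        case False
        then show ?thesis using cinf(2) by simp
      qed
    qed
    finally have "R / (2 ^ k * B k) / sqrt cinf \<le> energy \<mu> lam F t0 cinf u t"
      unfolding en[OF t] using cinf(2) by (intro divide_right_mono) auto
    then show "R / (2 ^ k * B k * sqrt cinf) \<le> energy \<mu> lam F t0 cinf u t" by simp
  qed
qed

section \<open>A speed and a solution with unbounded energy growth\<close>

lemma half_deriv_eq:
  fixes f :: "real \<Rightarrow> real"
  assumes "t \<ge> t0" "(f has_real_derivative D) (at t within {t0..})"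
  shows "half_deriv t0 f t = D"
  unfolding half_deriv_def
  by (rule vector_derivative_within[OF at_within_half_line_neq_bot[OF assms(1)]])
    (use assms(2) in \<open>simp add: has_real_derivative_iff_has_vector_derivative\<close>)

lemma half_deriv_works:
  fixes f :: "real \<Rightarrow> real"
  assumes "f differentiable_on {t0..}" "t \<ge> t0"
  shows "(f has_real_derivative half_deriv t0 f t) (at t within {t0..})"
  using assms unfolding half_deriv_def differentiable_on_def has_real_derivative_iff_has_vector_derivative
  by (auto simp: vector_derivative_works[symmetric])

lemma C_half_2I:
  fixes c c1 c2 :: "real \<Rightarrow> real"
  assumes dc: "\<And>t. t \<ge> t0 \<Longrightarrow> (c has_real_derivative c1 t) (at t within {t0..})"
    and dc1: "\<And>t. t \<ge> t0 \<Longrightarrow> (c1 has_real_derivative c2 t) (at t within {t0..})"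
    and c2: "continuous_on {t0..} c2"
  shows "C_half 2 t0 c" "\<And>t. t \<ge> t0 \<Longrightarrow> half_deriv t0 c t = c1 t"
    "\<And>t. t \<ge> t0 \<Longrightarrow> half_deriv t0 (half_deriv t0 c) t = c2 t"
proof -
  show h1: "half_deriv t0 c t = c1 t" if "t \<ge> t0" for t
    by (rule half_deriv_eq[OF that dc[OF that]])
  have dh: "(half_deriv t0 c has_real_derivative c2 t) (at t within {t0..})" if "t \<ge> t0" for t
    by (rule has_field_derivative_transform_within[OF dc1[OF that] zero_less_one]) (use that h1 in auto)
  show h2: "half_deriv t0 (half_deriv t0 c) t = c2 t" if "t \<ge> t0" for t
    by (rule half_deriv_eq[OF that dh[OF that]])
  have diff: "c differentiable_on {t0..}" "half_deriv t0 c differentiable_on {t0..}"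
    unfolding differentiable_on_def using dc dh by (auto simp: real_differentiable_def)
  have "continuous_on {t0..} (half_deriv t0 (half_deriv t0 c))"
    using c2 h2 by (subst continuous_on_cong[OF refl, where g = c2]) auto
  then show "C_half 2 t0 c"
    using diff by (auto simp: C_half_def numeral_2_eq_2 less_Suc_eq)
qed

lemma C_half_3_dominated:
  fixes \<gamma> :: "real \<Rightarrow> real"
  assumes C3: "C_half 3 t0 \<gamma>" and \<gamma>0: "\<forall>t\<ge>t0. 0 \<le> \<gamma> t"
    and bd: "\<exists>L3. \<forall>t\<ge>t0. \<forall>j\<in>{1,2,3}. \<bar>(half_deriv t0 ^^ j) \<gamma> t\<bar> \<le> L3 * \<gamma> t"
  obtains L \<gamma>1 \<gamma>2 \<gamma>3 where "1 \<le> L" "C3_dominated t0 {} (\<lambda>t. L * \<gamma> t) \<gamma> \<gamma>1 \<gamma>2 \<gamma>3"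
proof -
  let ?d = "half_deriv t0"
  obtain L3 where L3: "\<And>t j. t \<ge> t0 \<Longrightarrow> j \<in> {1,2,3} \<Longrightarrow> \<bar>(?d ^^ j) \<gamma> t\<bar> \<le> L3 * \<gamma> t" using bd by blast
  have diff: "\<gamma> differentiable_on {t0..}" "?d \<gamma> differentiable_on {t0..}" "?d (?d \<gamma>) differentiable_on {t0..}"
    and cont: "continuous_on {t0..} (?d (?d (?d \<gamma>)))"
  proof -
    have "(?d ^^ j) \<gamma> differentiable_on {t0..}" if "j < 3" for j
      using C3 that unfolding C_half_def by blast
    from this[of 0] this[of 1] this[of 2]
    show "\<gamma> differentiable_on {t0..}" "?d \<gamma> differentiable_on {t0..}" "?d (?d \<gamma>) differentiable_on {t0..}"
      by (simp_all add: numeral_2_eq_2)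
    show "continuous_on {t0..} (?d (?d (?d \<gamma>)))"
      using C3 unfolding C_half_def by (simp add: numeral_3_eq_3)
  qed
  define L where "L = max 1 L3"
  have L3L: "L3 * \<gamma> t \<le> L * \<gamma> t" if "t \<ge> t0" for t
    using \<gamma>0 that by (intro mult_right_mono) (auto simp: L_def)
  have b: "\<bar>?d \<gamma> t\<bar> \<le> L * \<gamma> t" "\<bar>?d (?d \<gamma>) t\<bar> \<le> L * \<gamma> t" "\<bar>?d (?d (?d \<gamma>)) t\<bar> \<le> L * \<gamma> t" "\<bar>\<gamma> t\<bar> \<le> L * \<gamma> t"
    if "t \<ge> t0" for t
  proof -
    show "\<bar>?d \<gamma> t\<bar> \<le> L * \<gamma> t" "\<bar>?d (?d \<gamma>) t\<bar> \<le> L * \<gamma> t" "\<bar>?d (?d (?d \<gamma>)) t\<bar> \<le> L * \<gamma> t"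
      using L3[OF that, of 1] L3[OF that, of 2] L3[OF that, of 3] L3L[OF that]
      by (simp_all add: numeral_2_eq_2 numeral_3_eq_3)
    show "\<bar>\<gamma> t\<bar> \<le> L * \<gamma> t"
      using mult_right_mono[of 1 L "\<gamma> t"] \<gamma>0 that by (simp add: L_def)
  qed
  show ?thesis
  proof (rule that[of L])
    show "1 \<le> L" by (simp add: L_def)
    show "C3_dominated t0 {} (\<lambda>t. L * \<gamma> t) \<gamma> (?d \<gamma>) (?d (?d \<gamma>)) (?d (?d (?d \<gamma>)))"
      unfolding C3_dominated_def using cont b half_deriv_works[OF diff(1)] half_deriv_works[OF diff(2)]
        half_deriv_works[OF diff(3)] by blast
  qed
qed

text \<open>A spectral value is detected by sets of possibly infinite measure; semifiniteness provides a part of finite positive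
measure, which carries nonzero elements of \<open>L\<^sup>2\<close>.\<close>

lemma spectral_window:
  assumes sf: "is_semifinite \<mu>" and lam: "lam \<in> borel_measurable \<mu>"
    and z: "z \<in> mult_spectrum \<mu> lam" and r: "0 < r"
  obtains C where "C \<in> sets \<mu>" "0 < emeasure \<mu> C" "emeasure \<mu> C < \<infinity>"
    "\<And>p. p \<in> C \<Longrightarrow> \<bar>(lam p)\<^sup>2 - z\<bar> \<le> r"
proof -
  obtain s where s: "z = s\<^sup>2"
    "0 < emeasure \<mu> {p \<in> space \<mu>. (lam p)\<^sup>2 \<in> {s\<^sup>2 - r .. s\<^sup>2 + r}}"
    using z r unfolding mult_spectrum_def by blast
  have "{p \<in> space \<mu>. (lam p)\<^sup>2 \<in> {s\<^sup>2 - r .. s\<^sup>2 + r}} \<in> sets \<mu>"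
    using lam by measurable
  with s(2) obtain C where C: "C \<in> sets \<mu>" "C \<subseteq> {p \<in> space \<mu>. (lam p)\<^sup>2 \<in> {s\<^sup>2 - r .. s\<^sup>2 + r}}"
    "0 < emeasure \<mu> C" "emeasure \<mu> C < \<infinity>"
    using sf unfolding is_semifinite_def by blast
  show ?thesis by (rule that[OF C(1,3,4)]) (use C(2) s(1) in \<open>auto simp: abs_le_iff\<close>)
qed

theorem theorem2p8:
  fixes t0 L1 L2 lam0 :: real
    and S \<gamma> :: "real \<Rightarrow> real"
    and domA :: "'h::{real_inner,complete_space} set"
    and A :: "'h \<Rightarrow> 'h"
    and \<mu> :: "'m measure"
    and lam :: "'m \<Rightarrow> real"
    and F :: "'h \<Rightarrow> 'm \<Rightarrow> real"
  assumes "0 < L1" and "L1 \<le> L2"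
    and "continuous_on {t0..} S" and "antimono_on {t0..} S" and "(S \<longlongrightarrow> 0) at_top"
    and "continuous_on {t0..} \<gamma>" and "\<forall>t\<ge>t0. 0 \<le> \<gamma> t"
    and "antimono_on {t0..} \<gamma> \<or> mono_on {t0..} \<gamma>"
    and "is_semifinite \<mu>"
    and "multiplication_operator domA A \<mu> lam F"
    and "0 \<le> lam0" and "{lam0\<^sup>2<..} \<subseteq> mult_spectrum \<mu> lam"
    and "L1 < L2"
    and "\<not> bdd_above ((\<lambda>\<tau>. G_fun t0 \<gamma> \<tau> * S \<tau>) ` {t0..})"
    and "C_half 3 t0 \<gamma>"
    and "\<exists>L3. \<forall>t\<ge>t0. \<forall>j\<in>{1,2,3}. \<bar>(half_deriv t0 ^^ j) \<gamma> t\<bar> \<le> L3 * \<gamma> t"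
  shows "\<exists>c cinf (u :: real \<Rightarrow> 'h) H5 (b :: nat \<Rightarrow> real).
           c \<in> propagation_speeds t0 L1 L2 S \<gamma> \<and>
           asymptotic_speed t0 S c cinf \<and>
           weak_solution \<mu> lam F t0 c u \<and> (\<exists>t\<ge>t0. u t \<noteq> 0) \<and>
           0 < H5 \<and>
           (\<forall>k\<ge>1. t0 \<le> b k) \<and> filterlim b at_top sequentially \<and>
           (\<forall>k\<ge>1. energy \<mu> lam F t0 cinf u (b k)
                     \<ge> energy \<mu> lam F t0 cinf u t0 * exp (H5 * sqrt (M_fun t0 S \<gamma> (b k))))"
proof -
  obtain L \<gamma>1 \<gamma>2 \<gamma>3 where L: "1 \<le> L" and jet: "C3_dominated t0 {} (\<lambda>t. L * \<gamma> t) \<gamma> \<gamma>1 \<gamma>2 \<gamma>3"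
    using C_half_3_dominated[OF assms(15) assms(7) assms(16)] by blast
  interpret speed_data t0 L S \<gamma> \<gamma>1 \<gamma>2 \<gamma>3
    using assms(3-5,7,14) L jet by unfold_locales auto
  have lam: "lam \<in> borel_measurable \<mu>" and iso: "surj_isometry_L2 \<mu> F"
    using assms(10) by (auto simp: multiplication_operator_def)
  interpret L2_representation \<mu> F by unfold_locales (rule iso)
  define \<kappa> where "\<kappa> = sqrt ((L1 + L2) / 2)"
  have \<kappa>: "\<kappa> > 0" and \<kappa>2: "\<kappa>\<^sup>2 = (L1 + L2) / 2" using assms(1,2) by (auto simp: \<kappa>_def)
  define d where "d = min (1 / 2) ((L2 - L1) / 2)"
  have d: "0 < d" "d \<le> 1 / 2" "d \<le> (L2 - L1) / 2"  unfolding d_def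
    using assms(13) by (simp_all only: min.cobounded1 min.cobounded2) simp
  define P where "P = 2 ^ 21 * L\<^sup>2 * (8 * \<kappa> ^ 3 + 16 * \<kappa>\<^sup>2 + 12 * \<kappa> + 5)"
  have P: "P > 0" unfolding P_def using L \<kappa> by (intro mult_pos_pos add_pos_pos) auto
  define \<delta> where "\<delta> = d / P"
  have \<delta>: "\<delta> > 0" using d P by (simp add: \<delta>_def)
  have small: "\<delta> * (2 ^ 21 * L\<^sup>2) * (8 * \<kappa> ^ 3 + 16 * \<kappa>\<^sup>2 + 12 * \<kappa> + 5) \<le> d"
  proof -
    have "\<delta> * P = d" using P by (simp add: \<delta>_def)
    then show ?thesis unfolding P_def by (simp add: mult.assoc)
  qed
  \<comment> \<open>The factor \<open>exp (\<integral> \<gamma> / L1)\<close> is the possible loss before \<open>b k\<close>; of \<open>2 ^ (k + 3)\<close>, the weight of the \<open>k\<close>-th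
    mode takes \<open>2 ^ k\<close>, and the total initial energy \<open>2\<close> and the two factors \<open>2\<close> in \<open>resonant_mode\<close> take the rest.\<close>
  obtain b where b0: "b 0 = t0" and step: "\<And>k. resonance_step \<kappa> \<delta> (lam0\<^sup>2)
      (2 ^ (k + 3) * exp (integral {t0..b k} \<gamma> / L1)) (b k) (b (Suc k))"
    using resonance_sequence[OF \<kappa> \<delta>, of "lam0\<^sup>2" "\<lambda>k a. 2 ^ (k + 3) * exp (integral {t0..a} \<gamma> / L1)"] by blast
  have bS: "b k + 1 \<le> b (Suc k)" for k using step[of k] by (simp add: resonance_step_def)
  have bk: "t0 + real k \<le> b k" for k
  proof (induction k)
    case (Suc k) then show ?case using bS[of k] by simp
  qed (simp add: b0)
  have bt: "t0 \<le> b k" for k using bk[of k] by simp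
  obtain c c1 c2 where
    dc: "\<And>t. t \<ge> t0 \<Longrightarrow> (c has_real_derivative c1 t) (at t within {t0..})"
    and dc1: "\<And>t. t \<ge> t0 \<Longrightarrow> (c1 has_real_derivative c2 t) (at t within {t0..})"
    and cc2: "continuous_on {t0..} c2"
    and cb: "\<And>t. t \<ge> t0 \<Longrightarrow> \<bar>c t - \<kappa>\<^sup>2\<bar> \<le> d \<and> \<bar>c1 t\<bar> \<le> \<gamma> t \<and> \<bar>c2 t\<bar> \<le> (\<gamma> t)\<^sup>2"
    and cbk: "\<And>k. c (b k) = \<kappa>\<^sup>2"
    and asy: "asymptotic_speed t0 S c (\<kappa>\<^sup>2)"
    and V: "\<And>k. amplifying \<kappa> \<delta> c (b k) (b (Suc k))"
    by (rule resonant_speed[OF b0 step \<kappa> \<delta> small d(2)], rule that)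
  have c_bounds: "L1 \<le> c t \<and> c t \<le> L2" if "t \<ge> t0" for t
    using cb[OF that] d(3) \<kappa>2 by (auto simp: abs_le_iff field_simps)
  have speed: "c \<in> propagation_speeds t0 L1 L2 S \<gamma>"
    unfolding propagation_speeds_def
    using C_half_2I[OF dc dc1 cc2] c_bounds asy cb by auto
  have c_cont: "continuous_on {t0..} c" by (rule DERIV_continuous_on) (use dc in auto)
  have c_abs: "\<bar>c t\<bar> \<le> L2" if "t \<ge> t0" for t using c_bounds[OF that] assms(1) by auto
  obtain X1 Y1 where X1: "\<And>z. X1 z t0 = 1" "\<And>z. Y1 z t0 = 0"
    "\<And>z t. t \<ge> t0 \<Longrightarrow> (X1 z has_real_derivative Y1 z t) (at t within {t0..})"
    "\<And>z t. t \<ge> t0 \<Longrightarrow> (Y1 z has_real_derivative - c t * z * X1 z t) (at t within {t0..})"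
    "\<And>z t. t \<ge> t0 \<Longrightarrow> isCont (\<lambda>z. X1 z t) z" "\<And>z t. t \<ge> t0 \<Longrightarrow> isCont (\<lambda>z. Y1 z t) z"
    by (rule linear_oscillator_solution[OF c_cont c_abs, where \<alpha> = 1 and \<beta> = 0], assumption, rule that)
  obtain X2 Y2 where X2: "\<And>z. X2 z t0 = 0" "\<And>z. Y2 z t0 = 1"
    "\<And>z t. t \<ge> t0 \<Longrightarrow> (X2 z has_real_derivative Y2 z t) (at t within {t0..})"
    "\<And>z t. t \<ge> t0 \<Longrightarrow> (Y2 z has_real_derivative - c t * z * X2 z t) (at t within {t0..})"
    "\<And>z t. t \<ge> t0 \<Longrightarrow> isCont (\<lambda>z. X2 z t) z" "\<And>z t. t \<ge> t0 \<Longrightarrow> isCont (\<lambda>z. Y2 z t) z"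
    by (rule linear_oscillator_solution[OF c_cont c_abs, where \<alpha> = 0 and \<beta> = 1], assumption, rule that)
  have fs: "fundamental_system t0 L1 L2 c c1 \<gamma> X1 Y1 X2 Y2"
    by unfold_locales (use dc cb assms(1,6) c_bounds X1 X2 in auto)
  interpret fs: fundamental_system t0 L1 L2 c c1 \<gamma> X1 Y1 X2 Y2 by (rule fs)
  define h where "h = gain * \<delta>"
  have h: "h > 0" using gain_pos \<delta> by (simp add: h_def)
  define z where "z k = G (b (Suc k)) / S (b (Suc k))" for k
  define R where "R k = exp (2 * (h * sqrt (M (b (Suc k)))))" for k
  have z2: "2 \<le> z k" and z0: "lam0\<^sup>2 < z k" for k
    using step[of k] by (simp_all add: resonance_step_def z_def)
  have zS: "z k + 2 \<le> z (Suc k)" for k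
    using step[of "Suc k"] by (simp add: resonance_step_def z_def)
  have z_gap: "z j + 2 \<le> z k" if "j < k" for j k
    using that
  proof (induction k)
    case (Suc k)
    then show ?case using zS[of k] by (cases "j = k") auto
  qed simp
  have "\<forall>k. \<exists>\<alpha> \<beta> r. 0 < r \<and> r \<le> 1 / 2 \<and> (\<forall>y. \<bar>y - z k\<bar> \<le> r \<longrightarrow>
    fs.mode_energy \<alpha> \<beta> y t0 \<le> 2 * exp (fs.\<Gamma> (b k)) \<and> R k / 2 \<le> fs.mode_energy \<alpha> \<beta> y (b (Suc k)))"
  proof
    fix k
    obtain V V1 where V: "V (b k) = 0" "V1 (b k) = 1"
      "\<And>t. t \<in> {b k..b (Suc k)} \<Longrightarrow> (V has_real_derivative V1 t) (at t within {b k..b (Suc k)})"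
      "\<And>t. t \<in> {b k..b (Suc k)} \<Longrightarrow> (V1 has_real_derivative - c t * z k * V t) (at t within {b k..b (Suc k)})"
      "R k \<le> (V1 (b (Suc k)))\<^sup>2 + c (b (Suc k)) * z k * (V (b (Suc k)))\<^sup>2"
      using V[of k] unfolding amplifying_def z_def[symmetric] R_def h_def cbk by blast
    have 1: "b k \<le> b (Suc k)" using bS[of k] by simp
    have 2: "0 < z k" using z2[of k] by simp
    have 3: "0 < R k" by (simp add: R_def)
    show "\<exists>\<alpha> \<beta> r. 0 < r \<and> r \<le> 1 / 2 \<and> (\<forall>y. \<bar>y - z k\<bar> \<le> r \<longrightarrow>
      fs.mode_energy \<alpha> \<beta> y t0 \<le> 2 * exp (fs.\<Gamma> (b k)) \<and> R k / 2 \<le> fs.mode_energy \<alpha> \<beta> y (b (Suc k)))"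
      by (rule fs.resonant_mode[OF bt 1 2 3 V])
  qed
  then obtain \<alpha> \<beta> r where modes: "\<And>k. 0 < r k \<and> r k \<le> 1 / 2 \<and> (\<forall>y. \<bar>y - z k\<bar> \<le> r k \<longrightarrow>
    fs.mode_energy (\<alpha> k) (\<beta> k) y t0 \<le> 2 * exp (fs.\<Gamma> (b k)) \<and> R k / 2 \<le> fs.mode_energy (\<alpha> k) (\<beta> k) y (b (Suc k)))"
    unfolding choice_iff by blast
  have "\<forall>k. \<exists>C. C \<in> sets \<mu> \<and> 0 < emeasure \<mu> C \<and> emeasure \<mu> C < \<infinity> \<and> (\<forall>p\<in>C. \<bar>(lam p)\<^sup>2 - z k\<bar> \<le> r k)"
  proof
    fix k
    have "z k \<in> mult_spectrum \<mu> lam" using assms(12) z0[of k] by auto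
    then show "\<exists>C. C \<in> sets \<mu> \<and> 0 < emeasure \<mu> C \<and> emeasure \<mu> C < \<infinity> \<and> (\<forall>p\<in>C. \<bar>(lam p)\<^sup>2 - z k\<bar> \<le> r k)"
      using spectral_window[OF assms(9) lam, of "z k" "r k"] modes[of k] by metis
  qed
  then obtain C where C: "\<And>k. C k \<in> sets \<mu>" "\<And>k. 0 < emeasure \<mu> (C k)" "\<And>k. emeasure \<mu> (C k) < \<infinity>"
    "\<And>k p. p \<in> C k \<Longrightarrow> \<bar>(lam p)\<^sup>2 - z k\<bar> \<le> r k"
    unfolding choice_iff by blast
  have disj: "disjoint_family C"
    unfolding disjoint_family_on_def
  proof (intro ballI impI)
    fix j k :: nat assume "j \<noteq> k"
    then have gap: "z j + 2 \<le> z k \<or> z k + 2 \<le> z j" using z_gap[of j k] z_gap[of k j] by (cases "j < k") auto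
    have near: "\<bar>(lam p)\<^sup>2 - z i\<bar> \<le> 1 / 2" if "p \<in> C i" for p i using C(4)[OF that] modes[of i] by linarith
    have False if "p \<in> C j" "p \<in> C k" for p
      using near[OF that(1)] near[OF that(2)] gap by linarith
    then show "C j \<inter> C k = {}" by blast
  qed
  have lam1: "1 \<le> (lam p)\<^sup>2" if "p \<in> C k" for k p
    using C(4)[OF that] modes[of k] z2[of k] by linarith
  have B: "fs.mode_energy (\<alpha> k) (\<beta> k) ((lam p)\<^sup>2) t0 \<le> 2 * exp (fs.\<Gamma> (b k))" if "p \<in> C k" for k p
    using modes C(4)[OF that] by blast
  have Bpos: "0 < 2 * exp (fs.\<Gamma> (b k))" for k by simp
  have ct0: "c t0 = \<kappa>\<^sup>2" using cbk[of 0] b0 by simp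
  have \<kappa>2pos: "0 < \<kappa>\<^sup>2" using \<kappa> by simp
  obtain u where u: "weak_solution \<mu> lam F t0 c u" "energy \<mu> lam F t0 (\<kappa>\<^sup>2) u t0 \<le> 2 / sqrt (\<kappa>\<^sup>2)"
    "\<And>t k R. t \<ge> t0 \<Longrightarrow> c t = \<kappa>\<^sup>2 \<Longrightarrow>
      \<forall>p\<in>C k. R \<le> fs.mode_energy (\<alpha> k) (\<beta> k) ((lam p)\<^sup>2) t \<Longrightarrow>
      R / (2 ^ k * (2 * exp (fs.\<Gamma> (b k))) * sqrt (\<kappa>\<^sup>2)) \<le> energy \<mu> lam F t0 (\<kappa>\<^sup>2) u t"
    by (rule superposition_of_modes[OF fs lam C(1-3) disj lam1 Bpos B ct0 \<kappa>2pos],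
        assumption, assumption, rule that)
  have low: "2 / \<kappa> * exp (h * sqrt (M (b (Suc k)))) \<le> energy \<mu> lam F t0 (\<kappa>\<^sup>2) u (b (Suc k))" for k
  proof -
    define e where "e = exp (h * sqrt (M (b (Suc k))))"
    have e: "R k = e * e" "e > 0" unfolding e_def R_def by (simp_all flip: exp_add)
    have K: "2 ^ (k + 3) * exp (fs.\<Gamma> (b k)) \<le> e"
      using step[of k] unfolding resonance_step_def e_def h_def fs.\<Gamma>_def by blast
    define D where "D = 2 ^ k * (2 * exp (fs.\<Gamma> (b k))) * \<kappa>"
    have D: "D > 0" using \<kappa> by (simp add: D_def)
    have "2 / \<kappa> * e * D = e * (2 ^ (k + 3) * exp (fs.\<Gamma> (b k))) / 2"
      using \<kappa> by (simp add: D_def power_add)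
    also have "\<dots> \<le> e * e / 2" using K e by (intro divide_right_mono mult_left_mono) auto
    finally have "2 / \<kappa> * e \<le> R k / 2 / D" using D by (simp add: e field_simps)
    also have "\<dots> \<le> energy \<mu> lam F t0 (\<kappa>\<^sup>2) u (b (Suc k))"
    proof -
      have "\<forall>p\<in>C k. R k / 2 \<le> fs.mode_energy (\<alpha> k) (\<beta> k) ((lam p)\<^sup>2) (b (Suc k))"
        using modes C(4) by blast
      from u(3)[OF bt cbk this] show ?thesis using \<kappa> unfolding D_def by simp
    qed
    finally show ?thesis unfolding e_def .
  qed
  have nonzero: "\<exists>t\<ge>t0. u t \<noteq> 0"
  proof (rule ccontr)
    assume "\<not> (\<exists>t\<ge>t0. u t \<noteq> 0)"
    then have u0: "u t = 0" if "t \<ge> t0" for t using that by blast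
    have t1: "t0 \<le> b 1" by (rule bt)
    have "((\<lambda>_. 0) has_vector_derivative 0) (at (b 1) within {t0..})" by simp
    then have "(u has_vector_derivative 0) (at (b 1) within {t0..})"
      by (rule has_vector_derivative_transform[rotated 2]) (use u0 t1 in auto)
    then have "half_deriv t0 u (b 1) = 0"
      unfolding half_deriv_def by (rule vector_derivative_within[OF at_within_half_line_neq_bot[OF t1]])
    moreover have "sqrt_op \<mu> lam F (u (b 1)) = 0"
    proof (rule sqrt_op_eqI)
      show "AE p in \<mu>. F 0 p = lam p * F (u (b 1)) p"
        unfolding u0[OF t1] using F_scale[of 0 0] by eventually_elim simp
    qed
    ultimately have "energy \<mu> lam F t0 (\<kappa>\<^sup>2) u (b 1) = 0" by (simp add: energy_def)
    moreover have "0 < 2 / \<kappa> * exp (h * sqrt (M (b 1)))" using \<kappa> by simp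
    ultimately show False using low[of 0] by simp
  qed
  have lim: "filterlim b at_top sequentially"
  proof (rule filterlim_at_top_mono)
    show "filterlim (\<lambda>k. t0 + real k) at_top sequentially"
      by (intro filterlim_tendsto_add_at_top[OF tendsto_const] filterlim_real_sequentially)
    show "\<forall>\<^sub>F k in sequentially. t0 + real k \<le> b k" using bk by simp
  qed
  have growth: "energy \<mu> lam F t0 (\<kappa>\<^sup>2) u t0 * exp (h * sqrt (M (b k))) \<le> energy \<mu> lam F t0 (\<kappa>\<^sup>2) u (b k)"
    if k: "k \<ge> 1" for k
  proof -
    obtain j where j: "k = Suc j" using k by (cases k) auto
    have "energy \<mu> lam F t0 (\<kappa>\<^sup>2) u t0 * exp (h * sqrt (M (b k))) \<le> 2 / \<kappa> * exp (h * sqrt (M (b k)))"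
      using u(2) \<kappa> by (intro mult_right_mono) auto
    then show ?thesis using low[of j] unfolding j by linarith
  qed
  show ?thesis
    by (rule exI[of _ c], rule exI[of _ "\<kappa>\<^sup>2"], rule exI[of _ u], rule exI[of _ h], rule exI[of _ b])
      (intro conjI allI impI speed asy u(1) nonzero h bt lim growth)
qed

end
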